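(* Let $0<\beta<1$ and let $h\in\mathcal{H}_{1/2}$. Then: 1. For every $T>0$ the measures $\mu_{\beta,T}^{h}$ and $\mu_{\beta,T}$ are equivalent (mutually absolutely continuous), and the Radon-Nikodym density, regarded as a random variable on the product space $\mathbb{W}\times\mathbb{R}^+$ by composition with $X_{\beta,T}$, is given by $$\frac{\mathrm{d}\mu_{\beta,T}^{h}}{\mathrm{d}\mu_{\beta,T}}(X_{\beta,T})=\mathcal{E}\left(\int_0^{\cdot}\dot h(s)\,\mathrm{d}W^{1/2}(s)\right)(T\mathcal{Y}_\beta)\qquad \mathbb{P}_{1/2}\otimes\mathbb{P}_{Y_\beta}\text{-a.s.}$$ 2. The measures $\mu_\beta^h$ and $\mu_\beta$ are equivalent, and the Radon-Nikodym density, regarded as a random variable on $\mathbb{W}\times\mathbb{R}^+$ by composition with $X_\beta$, is given by $$\frac{\mathrm{d}\mu_\beta^h}{\mathrm{d}\mu_\beta}(X_\beta)=\mathcal{E}\left(\int_0^{\cdot}\dot h(s)\,\mathrm{d}W^{1/2}(s)\right)(\infty)\qquad \mathbb{P}_{1/2}\otimes\mathbb{P}_{Y_\beta}\text{-a.s.}$$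
   Context: $\mathbb{R}^+=[0,\infty)$. $\mathbb{W}$ is the space of continuous $w:\mathbb{R}^+\to\mathbb{R}$ with $w(0)=0$, with the topology of locally uniform convergence and Borel $\sigma$-algebra $\mathcal{B}(\mathbb{W})$; $\mathbb{W}_T$ is the space of restrictions to $[0,T]$ of elements of $\mathbb{W}$. $\mathbb{P}_{1/2}$ is Wiener measure on $\mathbb{W}$, and $W^{1/2}(t)(w)=w(t)$ is the canonical process, a standard Brownian motion under $\mathbb{P}_{1/2}$. $\mathbb{P}_{Y_\beta}$ is the probability measure on $\mathbb{R}^+$ with density $M_\beta$, where $M_\beta$ is determined by $\int_0^\infty e^{-s\tau}M_\beta(\tau)\,d\tau=E_\beta(-s)$, $s\ge0$, with $E_\beta(z)=\sum_{n\ge0}z^n/\Gamma(\beta n+1)$. $\mathcal{Y}_\beta:\mathbb{R}^+\to\mathbb{R}^+$ is the identity map $\mathcal{Y}_\beta(\tau)=\tau$. On $(\mathbb{W}\times\mathbb{R}^+,\mathcal{B}(\mathbb{W})\otimes\mathcal{B}(\mathbb{R}^+),\mathbb{P}_{1/2}\otimes\mathbb{P}_{Y_\beta})$ the grey Brownian motion is $X_\beta(t)(w,\tau)=w(t\tau)$, $t\ge0$. $\mathcal{H}_{1/2}$ is the space of functions $h(t)=\int_0^t\dot h(s)\,\mathrm{d}s$, $t\ge0$, with $\dot h\in L^2(\mathbb{R}^+)$ (Lebesgue measure). For $h\in\mathcal{H}_{1/2}$, $X_\beta^h(t)(w,\tau)=w(t\tau)+h(t\tau)$. $\mu_\beta$,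 $\mu_\beta^h$ are the laws on $\mathbb{W}$ of $X_\beta$, $X_\beta^h$ under $\mathbb{P}_{1/2}\otimes\mathbb{P}_{Y_\beta}$; $\mu_{\beta,T}$, $\mu_{\beta,T}^h$ are the laws on $\mathbb{W}_T$ of the restrictions $X_{\beta,T}=\{X_\beta(t)\}_{t\in[0,T]}$, $X_{\beta,T}^h=\{X_\beta^h(t)\}_{t\in[0,T]}$. The exponential martingale is $\mathcal{E}\big(\int_0^\cdot\dot h\,\mathrm{d}W^{1/2}\big)(t)=\exp\big(\int_0^t\dot h(s)\,\mathrm{d}W^{1/2}(s)-\frac12\int_0^t|\dot h(s)|^2\,\mathrm{d}s\big)$ for $t\in[0,\infty]$ (at $t=\infty$ both integrals are over $[0,\infty)$; a continuous version in $t$ is used), and evaluation at $T\mathcal{Y}_\beta$ is the random variable $(w,\tau)\mapsto\mathcal{E}\big(\int_0^\cdot\dot h\,\mathrm{d}W^{1/2}\big)(T\tau)(w)$. *)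

theory Defs
  imports "HOL-Probability.Probability"
begin

section \<open>Path spaces\<close>

text \<open>
  Paths are functions on the reals that are extensional on their time set, so that a path
  is determined by its values there.
\<close>

definition paths :: "(real \<Rightarrow> real) set" where
  "paths = {w \<in> extensional {0..}. continuous_on {0..} w \<and> w 0 = 0}"

definition paths_upto :: "real \<Rightarrow> (real \<Rightarrow> real) set" where
  "paths_upto T = (\<lambda>w. restrict w {0..T}) ` paths"

text \<open>
  The topology of locally uniform convergence on a set \<open>W\<close> of functions with time set \<open>S\<close>.
  The time sets used are locally compact, so this is uniform convergence on compact subsets
  of \<open>S\<close>; if \<open>S\<close> itself is compact, it is uniform convergence on \<open>S\<close>.
\<close>

definition loc_unif_topology :: "real set \<Rightarrow> (real \<Rightarrow> real) set \<Rightarrow> (real \<Rightarrow> real) topology" where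
  "loc_unif_topology S W = topology (\<lambda>U. U \<subseteq> W \<and>
     (\<forall>w\<in>U. \<exists>K e. compact K \<and> K \<subseteq> S \<and> e > 0 \<and> {v \<in> W. \<forall>t\<in>K. \<bar>v t - w t\<bar> < e} \<subseteq> U))"

lemma openin_loc_unif_topology:
  "openin (loc_unif_topology S W) U \<longleftrightarrow> U \<subseteq> W \<and>
     (\<forall>w\<in>U. \<exists>K e. compact K \<and> K \<subseteq> S \<and> e > 0 \<and> {v \<in> W. \<forall>t\<in>K. \<bar>v t - w t\<bar> < e} \<subseteq> U)"
proof -
  define P where "P U \<longleftrightarrow> U \<subseteq> W \<and>
     (\<forall>w\<in>U. \<exists>K e. compact K \<and> K \<subseteq> S \<and> e > 0 \<and> {v \<in> W. \<forall>t\<in>K. \<bar>v t - w t\<bar> < e} \<subseteq> U)" for U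
  have "istopology P"
    unfolding istopology_def
  proof (intro conjI allI impI)
    fix U V assume U: "P U" and V: "P V"
    show "P (U \<inter> V)"
      unfolding P_def
    proof (intro conjI ballI)
      show "U \<inter> V \<subseteq> W"
        using U unfolding P_def by blast
    next
      fix w assume w: "w \<in> U \<inter> V"
      obtain K e where K: "compact K" "K \<subseteq> S" "e > 0"
          "{v \<in> W. \<forall>t\<in>K. \<bar>v t - w t\<bar> < e} \<subseteq> U"
        using U w unfolding P_def by blast
      obtain L d where L: "compact L" "L \<subseteq> S" "d > 0"
          "{v \<in> W. \<forall>t\<in>L. \<bar>v t - w t\<bar> < d} \<subseteq> V"
        using V w unfolding P_def by blast
      have "compact (K \<union> L)" "K \<union> L \<subseteq> S" "min e d > 0"
        using K L by auto
      moreover have "{v \<in> W. \<forall>t\<in>K \<union> L. \<bar>v t - w t\<bar> < min e d} \<subseteq> U \<inter> V"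
        using K(4) L(4) by fastforce
      ultimately show "\<exists>K e. compact K \<and> K \<subseteq> S \<and> e > 0 \<and>
          {v \<in> W. \<forall>t\<in>K. \<bar>v t - w t\<bar> < e} \<subseteq> U \<inter> V"
        by blast
    qed
  next
    fix \<U> assume "\<forall>U\<in>\<U>. P U"
    then show "P (\<Union>\<U>)"
      unfolding P_def by (meson Sup_le_iff UnionE Union_upper subset_trans)
  qed
  then show ?thesis
    unfolding loc_unif_topology_def P_def by (simp add: topology_inverse')
qed

lemma topspace_loc_unif_topology [simp]: "topspace (loc_unif_topology S W) = W"
proof -
  have "openin (loc_unif_topology S W) W"
    unfolding openin_loc_unif_topology
    by (auto intro!: exI[of _ "{}"] exI[of _ "1::real"])
  then show ?thesis
    by (meson openin_loc_unif_topology openin_subset openin_topspace subset_antisym)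
qed

definition borel_measure_of :: "'a topology \<Rightarrow> 'a measure" where
  "borel_measure_of X = sigma (topspace X) {U. openin X U}"

definition path_borel :: "(real \<Rightarrow> real) measure" where
  "path_borel = borel_measure_of (loc_unif_topology {0..} paths)"

definition path_borel_upto :: "real \<Rightarrow> (real \<Rightarrow> real) measure" where
  "path_borel_upto T = borel_measure_of (loc_unif_topology {0..T} (paths_upto T))"

section \<open>Wiener measure\<close>

definition standard_brownian_motion :: "'a measure \<Rightarrow> (real \<Rightarrow> 'a \<Rightarrow> real) \<Rightarrow> bool" where
  "standard_brownian_motion M B \<longleftrightarrow>
     prob_space M \<and>
     (\<forall>t\<ge>0. B t \<in> borel_measurable M) \<and>
     (\<forall>\<omega>\<in>space M. B 0 \<omega> = 0 \<and> continuous_on {0..} (\<lambda>t. B t \<omega>)) \<and>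
     (\<forall>s t. 0 \<le> s \<and> s < t \<longrightarrow>
        distributed M lborel (\<lambda>\<omega>. B t \<omega> - B s \<omega>)
          (\<lambda>x. ennreal (normal_density 0 (sqrt (t - s)) x))) \<and>
     (\<forall>(n::nat) t. 0 \<le> t 0 \<and> (\<forall>i<n. t i \<le> t (Suc i)) \<longrightarrow>
        prob_space.indep_vars M (\<lambda>_. borel) (\<lambda>i \<omega>. B (t (Suc i)) \<omega> - B (t i) \<omega>) {..<n})"

definition wiener_measure :: "(real \<Rightarrow> real) measure \<Rightarrow> bool" where
  "wiener_measure P \<longleftrightarrow>
     sets P = sets path_borel \<and> standard_brownian_motion P (\<lambda>t w. w t)"

section \<open>The random time\<close>

definition mittag_leffler :: "real \<Rightarrow> real \<Rightarrow> real" where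
  "mittag_leffler \<beta> z = (\<Sum>n. z ^ n / Gamma (\<beta> * real n + 1))"

text \<open>
  \<open>M\<close> is a version of the density \<open>M\<^sub>\<beta>\<close>. It is only determined up to Lebesgue null sets,
  by its Laplace transform; at \<open>s = 0\<close> this says that \<open>M\<close> has integral 1.
\<close>

definition time_density :: "real \<Rightarrow> (real \<Rightarrow> real) \<Rightarrow> bool" where
  "time_density \<beta> M \<longleftrightarrow>
     M \<in> borel_measurable (restrict_space lborel {0..}) \<and>
     (\<forall>\<tau>\<ge>0. M \<tau> \<ge> 0) \<and>
     (\<forall>s\<ge>0. has_bochner_integral (restrict_space lborel {0..})
        (\<lambda>\<tau>. exp (- s * \<tau>) * M \<tau>) (mittag_leffler \<beta> (- s)))"

definition time_law :: "(real \<Rightarrow> real) \<Rightarrow> real measure" where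
  "time_law M = density (restrict_space lborel {0..}) (\<lambda>\<tau>. ennreal (M \<tau>))"

section \<open>The Cameron--Martin space and the exponential martingale\<close>

abbreviation lebesgue_halfline :: "real measure" where
  "lebesgue_halfline \<equiv> lebesgue_on {0..}"

definition L2_halfline :: "(real \<Rightarrow> real) set" where
  "L2_halfline = {f \<in> borel_measurable lebesgue_halfline.
     integrable lebesgue_halfline (\<lambda>s. (f s)\<^sup>2)}"

text \<open>\<open>h\<close> lies in the Cameron--Martin space, with derivative \<open>h'\<close>.\<close>

definition cameron_martin :: "(real \<Rightarrow> real) \<Rightarrow> (real \<Rightarrow> real) \<Rightarrow> bool" where
  "cameron_martin h h' \<longleftrightarrow>
     h' \<in> L2_halfline \<and> (\<forall>t\<ge>0. h t = (LINT s|lebesgue_on {0..t}. h' s))"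

text \<open>
  A list of triples \<open>(a, l, r)\<close> represents the step function that is the sum of the functions
  \<open>a\<close> times the indicator of the interval from \<open>l\<close> to \<open>r\<close>; the intervals may overlap.
\<close>

definition step_fun :: "(real \<times> real \<times> real) list \<Rightarrow> real \<Rightarrow> real" where
  "step_fun xs s = (\<Sum>(a, l, r)\<leftarrow>xs. a * indicator {l<..r} s)"

definition step_integral ::
    "(real \<Rightarrow> 'a \<Rightarrow> real) \<Rightarrow> (real \<times> real \<times> real) list \<Rightarrow> 'a \<Rightarrow> real" where
  "step_integral B xs \<omega> = (\<Sum>(a, l, r)\<leftarrow>xs. a * (B r \<omega> - B l \<omega>))"

text \<open>
  \<open>J\<close> is a version of the stochastic integral over the half-line of the deterministic
  square integrable function \<open>f\<close> with respect to \<open>B\<close>: the mean square limit of the integrals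
  of step functions that approximate \<open>f\<close> in mean square.
\<close>

definition wiener_integral ::
    "'a measure \<Rightarrow> (real \<Rightarrow> 'a \<Rightarrow> real) \<Rightarrow> (real \<Rightarrow> real) \<Rightarrow> ('a \<Rightarrow> real) \<Rightarrow> bool" where
  "wiener_integral M B f J \<longleftrightarrow>
     f \<in> L2_halfline \<and> J \<in> borel_measurable M \<and>
     (\<exists>\<phi> :: nat \<Rightarrow> (real \<times> real \<times> real) list.
        (\<forall>n. \<forall>(a, l, r)\<in>set (\<phi> n). 0 \<le> l \<and> l \<le> r) \<and>
        (\<lambda>n. \<integral>\<^sup>+ s. ennreal ((f s - step_fun (\<phi> n) s)\<^sup>2) \<partial>lebesgue_halfline) \<longlonglongrightarrow> 0 \<and>
        (\<lambda>n. \<integral>\<^sup>+ \<omega>. ennreal ((J \<omega> - step_integral B (\<phi> n) \<omega>)\<^sup>2) \<partial>M) \<longlonglongrightarrow> 0)"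

text \<open>
  The times in \<open>[0,\<infinity>]\<close> are the elements of \<^typ>\<open>ennreal\<close>. At infinity the time interval
  below is the half-line.
\<close>

definition time_interval :: "ennreal \<Rightarrow> real set" where
  "time_interval t = {s. 0 \<le> s \<and> ennreal s \<le> t}"

text \<open>
  \<open>J t\<close> is the stochastic integral of \<open>f\<close> from \<open>0\<close> to \<open>t\<close>, for all \<open>t\<close> in \<open>[0,\<infinity>]\<close>, in a
  version that is continuous in finite \<open>t\<close>. Continuity at infinity is not needed to
  determine \<open>J\<close> up to a null set, and it is not required.
\<close>

definition continuous_wiener_integral ::
    "'a measure \<Rightarrow> (real \<Rightarrow> 'a \<Rightarrow> real) \<Rightarrow> (real \<Rightarrow> real) \<Rightarrow> (ennreal \<Rightarrow> 'a \<Rightarrow> real) \<Rightarrow> bool" where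
  "continuous_wiener_integral M B f J \<longleftrightarrow>
     (\<forall>t. wiener_integral M B (\<lambda>s. f s * indicator (time_interval t) s) (J t)) \<and>
     (AE \<omega> in M. continuous_on {0..} (\<lambda>t. J (ennreal t) \<omega>))"

definition exp_martingale ::
    "(real \<Rightarrow> real) \<Rightarrow> (ennreal \<Rightarrow> 'a \<Rightarrow> real) \<Rightarrow> ennreal \<Rightarrow> 'a \<Rightarrow> real" where
  "exp_martingale f J t \<omega> =
     exp (J t \<omega> - (LINT s|lebesgue_on (time_interval t). (f s)\<^sup>2) / 2)"

section \<open>Grey Brownian motion\<close>

definition gbm_shifted ::
    "(real \<Rightarrow> real) \<Rightarrow> (real \<Rightarrow> real) \<times> real \<Rightarrow> real \<Rightarrow> real" where
  "gbm_shifted h = (\<lambda>(w, \<tau>). \<lambda>t\<in>{0..}. w (t * \<tau>) + h (t * \<tau>))"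

definition gbm :: "(real \<Rightarrow> real) \<times> real \<Rightarrow> real \<Rightarrow> real" where
  "gbm = (\<lambda>(w, \<tau>). \<lambda>t\<in>{0..}. w (t * \<tau>))"

definition gbm_upto :: "real \<Rightarrow> (real \<Rightarrow> real) \<times> real \<Rightarrow> real \<Rightarrow> real" where
  "gbm_upto T x = restrict (gbm x) {0..T}"

definition gbm_shifted_upto ::
    "real \<Rightarrow> (real \<Rightarrow> real) \<Rightarrow> (real \<Rightarrow> real) \<times> real \<Rightarrow> real \<Rightarrow> real" where
  "gbm_shifted_upto T h x = restrict (gbm_shifted h x) {0..T}"

definition gbm_space :: "(real \<Rightarrow> real) measure \<Rightarrow> (real \<Rightarrow> real) \<Rightarrow> ((real \<Rightarrow> real) \<times> real) measure" where
  "gbm_space P M = P \<Otimes>\<^sub>M time_law M"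

definition gbm_law :: "(real \<Rightarrow> real) measure \<Rightarrow> (real \<Rightarrow> real) \<Rightarrow> (real \<Rightarrow> real) measure" where
  "gbm_law P M = distr (gbm_space P M) path_borel gbm"

definition gbm_shifted_law ::
    "(real \<Rightarrow> real) measure \<Rightarrow> (real \<Rightarrow> real) \<Rightarrow> (real \<Rightarrow> real) \<Rightarrow> (real \<Rightarrow> real) measure" where
  "gbm_shifted_law P M h = distr (gbm_space P M) path_borel (gbm_shifted h)"

definition gbm_law_upto ::
    "(real \<Rightarrow> real) measure \<Rightarrow> (real \<Rightarrow> real) \<Rightarrow> real \<Rightarrow> (real \<Rightarrow> real) measure" where
  "gbm_law_upto P M T = distr (gbm_space P M) (path_borel_upto T) (gbm_upto T)"

definition gbm_shifted_law_upto ::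
    "(real \<Rightarrow> real) measure \<Rightarrow> (real \<Rightarrow> real) \<Rightarrow> (real \<Rightarrow> real) \<Rightarrow> real \<Rightarrow> (real \<Rightarrow> real) measure" where
  "gbm_shifted_law_upto P M h T =
     distr (gbm_space P M) (path_borel_upto T) (gbm_shifted_upto T h)"

definition equivalent_measures :: "'a measure \<Rightarrow> 'a measure \<Rightarrow> bool" where
  "equivalent_measures M N \<longleftrightarrow>
     sets M = sets N \<and> absolutely_continuous M N \<and> absolutely_continuous N M"

end

theory Submission
  imports Defs
begin

text \<open>
  For a fixed value \<open>\<tau>\<close> of the random time, the grey path \<open>s \<mapsto> w (s * \<tau>)\<close> is a rescaled Brownian
  path. By the Cameron--Martin formula the law of the shifted path up to the horizon \<open>t\<close> is the
  law of the unshifted one under Wiener measure weighted with the exponential martingale at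
  \<open>t * \<tau>\<close> (\<open>fixed_time_shift\<close>). Integrating over \<open>\<tau>\<close>, the law of the shifted grey path is the image
  of the product measure weighted with the exponential at the random time. In general its density
  would only be the conditional expectation of this weight given the grey path. But the quadratic
  variation of the grey path up to a time \<open>R\<close> is \<open>R * \<tau>\<close>, so the path reveals \<open>\<tau>\<close>, hence also
  the Brownian path up to \<open>t * \<tau>\<close> and the weight itself (\<open>exp_martingale_function_of_path\<close>).
  So the weight is the density, and the laws are equivalent because it is positive
  (\<open>RN_deriv_of_image\<close>).

  The Cameron--Martin formula is proved on half-line cylinders, which determine a law on path
  space (\<open>measure_eqI_half_line_cylinders\<close>). For step functions it follows from independence of
  the increments and completing the square (\<open>step_cameron_martin\<close>). This also yields the
  exponential moments of step integrals, and with them the passage to the limit in mean square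
  (\<open>cameron_martin_cylinders\<close>).

  Finite and infinite horizons are treated together: the horizon is an extended number \<open>t\<close>, the
  times up to it form \<open>time_interval t\<close>, and a grey path up to \<open>t\<close> runs through the Brownian
  path up to \<open>t * \<tau>\<close>, which is infinite when \<open>t\<close> is.
\<close>

section \<open>Path spaces and their Borel sets\<close>

lemma floor_fraction_tendsto:
  fixes t :: real
  assumes "0 \<le> t"
  shows "(\<lambda>n. real (nat \<lfloor>real (Suc n) * t\<rfloor>) / real (Suc n)) \<longlonglongrightarrow> t"
proof (rule real_tendsto_sandwich[of "\<lambda>n. t - 1 / real (Suc n)" _ _ "\<lambda>n. t"])
  have fl: "real (nat \<lfloor>real (Suc n) * t\<rfloor>) = of_int \<lfloor>real (Suc n) * t\<rfloor>" for n
    using assms by (intro of_nat_nat) auto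
  show "\<forall>\<^sub>F n in sequentially. t - 1 / real (Suc n) \<le> real (nat \<lfloor>real (Suc n) * t\<rfloor>) / real (Suc n)"
  proof (intro always_eventually allI)
    fix n
    have "real (Suc n) * t - 1 \<le> real (nat \<lfloor>real (Suc n) * t\<rfloor>)" unfolding fl by linarith
    then have "(real (Suc n) * t - 1) / real (Suc n) \<le> real (nat \<lfloor>real (Suc n) * t\<rfloor>) / real (Suc n)"
      by (intro divide_right_mono) auto
    then show "t - 1 / real (Suc n) \<le> real (nat \<lfloor>real (Suc n) * t\<rfloor>) / real (Suc n)"
      by (simp add: diff_divide_distrib del: of_nat_Suc)
  qed
  show "\<forall>\<^sub>F n in sequentially. real (nat \<lfloor>real (Suc n) * t\<rfloor>) / real (Suc n) \<le> t"
  proof (intro always_eventually allI)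
    fix n
    have "real (nat \<lfloor>real (Suc n) * t\<rfloor>) \<le> real (Suc n) * t" unfolding fl by linarith
    then show "real (nat \<lfloor>real (Suc n) * t\<rfloor>) / real (Suc n) \<le> t"
      by (simp add: field_simps)
  qed
  have "(\<lambda>n. t - 1 / real (Suc n)) \<longlonglongrightarrow> t - 0"
    by (intro tendsto_diff tendsto_const LIMSEQ_Suc lim_1_over_n)
  then show "(\<lambda>n. t - 1 / real (Suc n)) \<longlonglongrightarrow> t" by simp
qed simp

lemma floor_fraction_le:
  fixes t :: real
  assumes "0 \<le> t"
  shows "real (nat \<lfloor>real (Suc n) * t\<rfloor>) / real (Suc n) \<le> t"
proof -
  have "real (nat \<lfloor>real (Suc n) * t\<rfloor>) = of_int \<lfloor>real (Suc n) * t\<rfloor>"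
    using assms by (intro of_nat_nat) auto
  then have "real (nat \<lfloor>real (Suc n) * t\<rfloor>) \<le> real (Suc n) * t" by linarith
  then show ?thesis by (simp add: field_simps)
qed

text \<open>
  A continuous process is the limit of its values at the times rounded down to a grid, and
  there it takes only countably many measurable values. Rounding down never leaves the time set.
\<close>

lemma measurable_eval_random_time:
  fixes X :: "real \<Rightarrow> 'a \<Rightarrow> real"
  assumes X: "\<And>t. t \<in> S \<Longrightarrow> X t \<in> borel_measurable M"
    and S: "S \<subseteq> {0..}" "\<And>s t. t \<in> S \<Longrightarrow> 0 \<le> s \<Longrightarrow> s \<le> t \<Longrightarrow> s \<in> S"
    and cont: "\<And>\<omega>. \<omega> \<in> space M \<Longrightarrow> continuous_on S (\<lambda>t. X t \<omega>)"
    and rho[measurable]: "\<rho> \<in> borel_measurable M"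
    and rhoS: "\<And>\<omega>. \<omega> \<in> space M \<Longrightarrow> \<rho> \<omega> \<in> S"
  shows "(\<lambda>\<omega>. X (\<rho> \<omega>) \<omega>) \<in> borel_measurable M"
proof -
  define f where "f n i \<omega> = (if real i / real (Suc n) \<in> S then X (real i / real (Suc n)) \<omega> else 0)"
    for n i :: nat and \<omega>
  define g where "g n \<omega> = nat \<lfloor>real (Suc n) * \<rho> \<omega>\<rfloor>" for n \<omega>
  have f: "f n i \<in> borel_measurable M" for n i
    unfolding f_def using X by (cases "real i / real (Suc n) \<in> S") auto
  have g: "g n \<in> measurable M (count_space UNIV)" for n
    unfolding g_def by measurable
  have "(\<lambda>\<omega>. f n (g n \<omega>) \<omega>) \<in> borel_measurable M" for n
    by (rule measurable_compose_countable[OF f g])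
  moreover have "(\<lambda>n. f n (g n \<omega>) \<omega>) \<longlonglongrightarrow> X (\<rho> \<omega>) \<omega>" if \<omega>: "\<omega> \<in> space M" for \<omega>
  proof -
    have r: "\<rho> \<omega> \<in> S" "0 \<le> \<rho> \<omega>" using rhoS[OF \<omega>] S(1) by auto
    let ?u = "\<lambda>n. real (g n \<omega>) / real (Suc n)"
    have u: "?u n \<in> S" for n
      by (rule S(2)[OF r(1)]) (use floor_fraction_le[OF r(2), of n] in \<open>auto simp: g_def\<close>)
    have "?u \<longlonglongrightarrow> \<rho> \<omega>"
      unfolding g_def by (rule floor_fraction_tendsto[OF r(2)])
    then have "(\<lambda>n. X (?u n) \<omega>) \<longlonglongrightarrow> X (\<rho> \<omega>) \<omega>"
      by (intro continuous_on_tendsto_compose[OF cont[OF \<omega>] _ r(1)] always_eventually allI u)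
    then show ?thesis using u unfolding f_def by (simp del: of_nat_Suc)
  qed
  ultimately show ?thesis by (rule borel_measurable_LIMSEQ_metric)
qed

text \<open>
  A box prescribes a path, up to a tolerance, on each of \<open>m\<close> equal pieces of \<open>[0, R]\<close>. It is
  tested on rational fractions of \<open>R\<close> only, which keeps it measurable with respect to the
  coordinates. There are countably many boxes for given \<open>R\<close>.
\<close>

definition path_box :: "(real \<Rightarrow> real) set \<Rightarrow> real \<Rightarrow> nat \<times> nat \<times> rat list \<Rightarrow> (real \<Rightarrow> real) set" where
  "path_box W R = (\<lambda>(m, k, c). {v \<in> W. \<forall>j i. j \<le> Suc i \<longrightarrow>
     \<bar>v (R * real j / real (Suc i)) - real_of_rat (c ! (m * j div Suc i))\<bar> \<le> 1 / real (Suc k)})"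

text \<open>
  Uniform continuity on \<open>[0, R]\<close> puts a path into a box of any prescribed tolerance.
\<close>

lemma box_cover:
  assumes w: "w \<in> W" "continuous_on {0..R} w" and R: "0 \<le> R"
  shows "\<exists>m c. w \<in> path_box W R (m, k, c)"
proof -
  define \<epsilon> where "\<epsilon> = 1 / (2 * real (Suc k))"
  have \<epsilon>: "\<epsilon> > 0" "\<epsilon> + \<epsilon> = 1 / real (Suc k)" unfolding \<epsilon>_def by (auto simp: field_simps)
  have "uniformly_continuous_on {0..R} w"
    using w(2) by (intro compact_uniformly_continuous) auto
  then obtain \<delta> where \<delta>: "\<delta> > 0"
      "\<And>s t. s \<in> {0..R} \<Longrightarrow> t \<in> {0..R} \<Longrightarrow> dist t s < \<delta> \<Longrightarrow> dist (w t) (w s) < \<epsilon>"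
    unfolding uniformly_continuous_on_def using \<epsilon>(1) by meson
  obtain m :: nat where m: "R / \<delta> < real m"
    using reals_Archimedean2 by blast
  then have m0: "m > 0" using R \<delta>(1)
    by (metis divide_nonneg_pos gr0I less_le_not_le of_nat_0)
  have mR: "R / real m < \<delta>" using m m0 \<delta>(1) by (simp add: field_simps)
  have "\<exists>q. \<bar>x - real_of_rat q\<bar> < \<epsilon>" for x
  proof -
    have "x - \<epsilon> < x + \<epsilon>" using \<epsilon>(1) by linarith
    from of_rat_dense[OF this] obtain q where "x - \<epsilon> < real_of_rat q" "real_of_rat q < x + \<epsilon>" by blast
    then show ?thesis by (intro exI[of _ q]) linarith
  qed
  then obtain q where q: "\<And>x. \<bar>x - real_of_rat (q x)\<bar> < \<epsilon>" by metis
  \<comment> \<open>On each piece the box follows a rational close to the value at the left end.\<close>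
  define c where "c = map (\<lambda>j. q (w (R * real j / real m))) [0..<Suc m]"
  have "w \<in> path_box W R (m, k, c)"
    unfolding path_box_def
  proof (clarsimp simp: w(1) simp del: of_nat_Suc)
    fix j i :: nat assume ji: "j \<le> Suc i"
    define d where "d = m * j div Suc i"
    have "m * j \<le> m * Suc i" using ji by (rule mult_le_mono2)
    then have dm: "d \<le> m" unfolding d_def
      by (metis div_le_mono nonzero_mult_div_cancel_right nat.distinct(1))
    have c: "c ! d = q (w (R * real d / real m))"
      using dm unfolding c_def by (subst nth_map) (auto simp del: upt_Suc)
    have "d * Suc i \<le> m * j" unfolding d_def by (rule div_times_less_eq_dividend)
    then have "real (d * Suc i) \<le> real (m * j)" using of_nat_mono by blast
    then have d1: "real d / real m \<le> real j / real (Suc i)"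
      using m0 by (simp add: field_simps)
    have "m * j < (d + 1) * Suc i" unfolding d_def
      using dividend_less_div_times[of "Suc i" "m * j"] by (simp add: algebra_simps)
    then have "real (m * j) < real ((d + 1) * Suc i)" using of_nat_less_iff by blast
    then have d2: "real j / real (Suc i) \<le> real d / real m + 1 / real m"
      using m0 by (simp add: field_simps)
    have "R * (real j / real (Suc i)) \<le> R * (real d / real m + 1 / real m)"
         "R * (real d / real m) \<le> R * (real j / real (Suc i))"
      using d1 d2 R by (intro mult_left_mono; simp)+
    then have "dist (R * real j / real (Suc i)) (R * real d / real m) \<le> R / real m"
      unfolding dist_real_def by (simp add: algebra_simps abs_le_iff)
    moreover have "R * x \<in> {0..R}" if "0 \<le> x" "x \<le> 1" for x
      using mult_left_mono[OF that(2) R] that(1) R by simp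
    then have "R * (real j / real (Suc i)) \<in> {0..R}" "R * (real d / real m) \<in> {0..R}"
      using ji dm m0 by (simp_all only: divide_le_eq_1 divide_nonneg_nonneg of_nat_0_le_iff of_nat_le_iff
          of_nat_0_less_iff zero_less_Suc simp_thms)
    then have "R * real j / real (Suc i) \<in> {0..R}" "R * real d / real m \<in> {0..R}"
      by (simp_all only: times_divide_eq_right)
    ultimately have "dist (w (R * real j / real (Suc i))) (w (R * real d / real m)) < \<epsilon>"
      using mR by (intro \<delta>(2)) auto
    then show "\<bar>w (R * real j / real (Suc i)) - real_of_rat (c ! (m * j div Suc i))\<bar> \<le> 1 / real (Suc k)"
      using q[of "w (R * real d / real m)"] \<epsilon>(2) unfolding d_def[symmetric] c dist_real_def
      by linarith
  qed
  then show ?thesis by blast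
qed

lemma box_diameter:
  assumes v: "v \<in> path_box W R (m, k, c)" "continuous_on {0..R} v"
    and w: "w \<in> path_box W R (m, k, c)" "continuous_on {0..R} w"
    and t: "t \<in> {0..R}"
  shows "\<bar>v t - w t\<bar> \<le> 2 / real (Suc k)"
proof -
  define u where "u = (if R = 0 then 0 else t / R)"
  have u: "0 \<le> u" "u \<le> 1" "R * u = t"
    using t unfolding u_def by (auto simp: field_simps)
  let ?x = "\<lambda>n. R * real (nat \<lfloor>real (Suc n) * u\<rfloor>) / real (Suc n)"
  have le: "nat \<lfloor>real (Suc n) * u\<rfloor> \<le> Suc n" for n
  proof -
    have "real (Suc n) * u \<le> real (Suc n) * 1" using u by (intro mult_left_mono) auto
    then have "\<lfloor>real (Suc n) * u\<rfloor> \<le> int (Suc n)"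
      by (metis floor_mono floor_of_nat mult.right_neutral)
    then show ?thesis by (simp add: nat_le_iff)
  qed
  have x: "?x n \<in> {0..R}" for n
  proof -
    have "real (nat \<lfloor>real (Suc n) * u\<rfloor>) / real (Suc n) \<le> 1"
      using le[of n] by (simp add: field_simps del: of_nat_Suc)
    then have "R * (real (nat \<lfloor>real (Suc n) * u\<rfloor>) / real (Suc n)) \<le> R * 1"
      using t by (intro mult_left_mono) auto
    then show ?thesis using t by auto
  qed
  have "(\<lambda>n. R * (real (nat \<lfloor>real (Suc n) * u\<rfloor>) / real (Suc n))) \<longlonglongrightarrow> R * u"
    by (intro tendsto_mult tendsto_const floor_fraction_tendsto u)
  then have lim: "?x \<longlonglongrightarrow> t" using u(3) by simp
  have "(\<lambda>n. \<bar>v (?x n) - w (?x n)\<bar>) \<longlonglongrightarrow> \<bar>v t - w t\<bar>"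
    by (intro tendsto_rabs tendsto_diff continuous_on_tendsto_compose[OF v(2) lim t]
        continuous_on_tendsto_compose[OF w(2) lim t] always_eventually allI x)
  moreover have "\<bar>v (?x n) - w (?x n)\<bar> \<le> 2 / real (Suc k)" for n
  proof -
    let ?c = "real_of_rat (c ! (m * nat \<lfloor>real (Suc n) * u\<rfloor> div Suc n))"
    have "\<bar>v (?x n) - ?c\<bar> \<le> 1 / real (Suc k)" "\<bar>w (?x n) - ?c\<bar> \<le> 1 / real (Suc k)"
      using v(1) w(1) le[of n] unfolding path_box_def by blast+
    then show ?thesis by linarith
  qed
  ultimately show ?thesis by (intro LIMSEQ_le_const2) auto
qed

text \<open>
  Every open set of paths is a union of boxes, hence a countable union of sets that are
  described by countably many coordinates. So a map into a path space is Borel measurable as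
  soon as each of its coordinates is measurable. The countable set \<open>C\<close> of horizons has to
  exhaust the time set.
\<close>

lemma measurable_into_loc_unif:
  assumes S: "\<And>s t. t \<in> S \<Longrightarrow> 0 \<le> s \<Longrightarrow> s \<le> t \<Longrightarrow> s \<in> S"
    and W: "\<And>w. w \<in> W \<Longrightarrow> continuous_on S w"
    and C: "countable C" "\<And>R. R \<in> C \<Longrightarrow> 0 \<le> R \<and> R \<in> S"
      "\<And>K. compact K \<Longrightarrow> K \<subseteq> S \<Longrightarrow> \<exists>R\<in>C. K \<subseteq> {0..R}"
    and fW: "f \<in> space M \<rightarrow> W"
    and f: "\<And>t. t \<in> S \<Longrightarrow> (\<lambda>\<omega>. f \<omega> t) \<in> borel_measurable M"
  shows "f \<in> measurable M (borel_measure_of (loc_unif_topology S W))"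
  unfolding borel_measure_of_def topspace_loc_unif_topology
proof (rule measurable_measure_of)
  show "{U. openin (loc_unif_topology S W) U} \<subseteq> Pow W"
    unfolding openin_loc_unif_topology by auto
  show "f \<in> space M \<rightarrow> W" by fact
  have CS: "{0..R} \<subseteq> S" if "R \<in> C" for R using C(2)[OF that] S by auto
  have Wc: "continuous_on {0..R} w" if "R \<in> C" "w \<in> W" for R w
    using W[OF that(2)] CS[OF that(1)] by (rule continuous_on_subset)
  fix U assume "U \<in> {U. openin (loc_unif_topology S W) U}"
  then have UW: "U \<subseteq> W"
    and U: "\<And>w. w \<in> U \<Longrightarrow> \<exists>K e. compact K \<and> K \<subseteq> S \<and> e > 0 \<and> {v \<in> W. \<forall>t\<in>K. \<bar>v t - w t\<bar> < e} \<subseteq> U"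
    unfolding openin_loc_unif_topology by auto
  define I where "I = {(R, p). R \<in> C \<and> path_box W R p \<subseteq> U}"
  have I: "countable I"
    by (rule countable_subset[of _ "C \<times> UNIV"]) (use C(1) in \<open>auto simp: I_def\<close>)
  have "U \<subseteq> (\<Union>(R, p)\<in>I. path_box W R p)"
  proof
    fix w assume w: "w \<in> U"
    obtain K e where K: "compact K" "K \<subseteq> S" "e > 0" "{v \<in> W. \<forall>t\<in>K. \<bar>v t - w t\<bar> < e} \<subseteq> U"
      using U[OF w] by blast
    obtain R where R: "R \<in> C" "K \<subseteq> {0..R}" using C(3)[OF K(1,2)] by blast
    obtain k :: nat where "2 / e < real k" using reals_Archimedean2 by blast
    then have "2 / e < real (Suc k)" by simp
    then have k: "2 / real (Suc k) < e" using K(3) by (simp add: field_simps)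
    obtain m c where b: "w \<in> path_box W R (m, k, c)"
      using box_cover[where w=w and W=W and R=R and k=k] Wc[OF R(1)] w UW C(2)[OF R(1)] by blast
    have "path_box W R (m, k, c) \<subseteq> U"
    proof
      fix v assume v: "v \<in> path_box W R (m, k, c)"
      then have vW: "v \<in> W" unfolding path_box_def by auto
      have "\<bar>v t - w t\<bar> < e" if "t \<in> K" for t
        using box_diameter[OF v Wc[OF R(1) vW] b Wc[OF R(1)], of t] w UW that R(2) k by force
      then show "v \<in> U" using K(4) vW by blast
    qed
    then show "w \<in> (\<Union>(R, p)\<in>I. path_box W R p)" using b R(1) unfolding I_def by blast
  qed
  moreover have "(\<Union>(R, p)\<in>I. path_box W R p) \<subseteq> U" unfolding I_def by auto
  ultimately have "U = (\<Union>(R, p)\<in>I. path_box W R p)" by blast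
  then have eq: "f -` U \<inter> space M = (\<Union>i\<in>I. f -` path_box W (fst i) (snd i) \<inter> space M)"
    by (auto simp: case_prod_beta)
  have "f -` path_box W R (m, k, c) \<inter> space M \<in> sets M" if R: "R \<in> C" for R m k c
  proof -
    have "f -` path_box W R (m, k, c) \<inter> space M = {\<omega>\<in>space M. \<forall>j i. j \<le> Suc i \<longrightarrow>
        \<bar>f \<omega> (R * real j / real (Suc i)) - real_of_rat (c ! (m * j div Suc i))\<bar> \<le> 1 / real (Suc k)}"
      using fW unfolding path_box_def by auto
    moreover have "(\<lambda>\<omega>. f \<omega> (R * real j / real (Suc i))) \<in> borel_measurable M" if "j \<le> Suc i" for i j
    proof (rule f, rule S)
      show "R \<in> S" "0 \<le> R * real j / real (Suc i)" using C(2)[OF R] by auto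
      have "real j / real (Suc i) \<le> 1" using that by (simp add: field_simps del: of_nat_Suc)
      then have "R * (real j / real (Suc i)) \<le> R * 1"
        using C(2)[OF R] by (intro mult_left_mono) auto
      then show "R * real j / real (Suc i) \<le> R" by simp
    qed
    then have "{\<omega>\<in>space M. j \<le> Suc i \<longrightarrow>
        \<bar>f \<omega> (R * real j / real (Suc i)) - real_of_rat (c ! (m * j div Suc i))\<bar> \<le> 1 / real (Suc k)} \<in> sets M"
      for i j
    proof (cases "j \<le> Suc i")
      case True
      note [measurable] = \<open>\<And>j i. j \<le> Suc i \<Longrightarrow> (\<lambda>\<omega>. f \<omega> (R * real j / real (Suc i))) \<in> borel_measurable M\<close>[OF True]
      show ?thesis using True by measurable
    qed simp
    then have "{\<omega>\<in>space M. \<forall>j i. j \<le> Suc i \<longrightarrow>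
        \<bar>f \<omega> (R * real j / real (Suc i)) - real_of_rat (c ! (m * j div Suc i))\<bar> \<le> 1 / real (Suc k)} \<in> sets M"
      by (intro sets.sets_Collect_countable_All)
    ultimately show ?thesis by (simp only:)
  qed
  then show "f -` U \<inter> space M \<in> sets M"
    unfolding eq using I by (intro sets.countable_UN') (auto simp: I_def)
qed

lemma space_borel_measure_of [simp]:
  "space (borel_measure_of (loc_unif_topology S W)) = W"
  unfolding borel_measure_of_def by (simp add: space_measure_of_conv)

lemma measurable_coordinate:
  assumes t: "t \<in> S"
  shows "(\<lambda>w. w t) \<in> borel_measurable (borel_measure_of (loc_unif_topology S W))"
proof (rule borel_measurableI)
  fix A :: "real set" assume A: "open A"
  have "openin (loc_unif_topology S W) ((\<lambda>w. w t) -` A \<inter> W)"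
    unfolding openin_loc_unif_topology
  proof (intro conjI ballI)
    fix w assume "w \<in> (\<lambda>w. w t) -` A \<inter> W"
    then obtain e where e: "e > 0" "\<And>y. dist y (w t) < e \<Longrightarrow> y \<in> A"
      using A unfolding open_dist by (metis IntE vimageD)
    show "\<exists>K e. compact K \<and> K \<subseteq> S \<and> 0 < e \<and> {v \<in> W. \<forall>t\<in>K. \<bar>v t - w t\<bar> < e} \<subseteq> (\<lambda>w. w t) -` A \<inter> W"
      using e t by (intro exI[of _ "{t}"] exI[of _ e]) (auto simp: dist_real_def)
  qed auto
  then have "(\<lambda>w. w t) -` A \<inter> W \<in> {U. openin (loc_unif_topology S W) U}" by simp
  then show "(\<lambda>w. w t) -` A \<inter> space (borel_measure_of (loc_unif_topology S W))
      \<in> sets (borel_measure_of (loc_unif_topology S W))"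
    unfolding space_borel_measure_of
    unfolding borel_measure_of_def topspace_loc_unif_topology
    by (rule in_measure_of[rotated]) (auto simp: openin_loc_unif_topology)
qed

text \<open>
  Finite-dimensional distributions determine a law on a path space: the half-line cylinders
  form a \<open>\<pi>\<close>-system, and by the previous results they generate the Borel sets.
\<close>

lemma measure_eqI_half_line_cylinders:
  fixes N1 N2 :: "(real \<Rightarrow> real) measure"
  assumes S: "\<And>s t. t \<in> S \<Longrightarrow> 0 \<le> s \<Longrightarrow> s \<le> t \<Longrightarrow> s \<in> S"
    and W: "\<And>w. w \<in> W \<Longrightarrow> continuous_on S w"
    and C: "countable C" "\<And>R. R \<in> C \<Longrightarrow> 0 \<le> R \<and> R \<in> S"
      "\<And>K. compact K \<Longrightarrow> K \<subseteq> S \<Longrightarrow> \<exists>R\<in>C. K \<subseteq> {0..R}"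
    and sets: "sets N1 = sets (borel_measure_of (loc_unif_topology S W))"
      "sets N2 = sets (borel_measure_of (loc_unif_topology S W))"
    and fin: "emeasure N1 W \<noteq> \<infinity>"
    and eq: "\<And>F c. finite F \<Longrightarrow> F \<subseteq> S \<Longrightarrow>
      emeasure N1 {w \<in> W. \<forall>s\<in>F. w s \<le> c s} = emeasure N2 {w \<in> W. \<forall>s\<in>F. w s \<le> c s}"
  shows "N1 = N2"
proof -
  define E where "E = {{w \<in> W. \<forall>s\<in>F. w s \<le> c s} | F c. finite F \<and> F \<subseteq> S}"
  have EW: "E \<subseteq> Pow W" unfolding E_def by auto
  let ?B = "borel_measure_of (loc_unif_topology S W)"
  have sub1: "(\<lambda>w. w) \<in> measurable (sigma W E) ?B"
  proof (rule measurable_into_loc_unif[OF S W C])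
    fix t assume t: "t \<in> S"
    show "(\<lambda>w. w t) \<in> borel_measurable (sigma W E)"
    proof (subst borel_measurable_iff_le, intro allI)
      fix a
      have "{w \<in> W. w t \<le> a} \<in> E"
        unfolding E_def using t by (intro CollectI exI[of _ "{t}"] exI[of _ "\<lambda>_. a"]) auto
      then show "{w \<in> space (sigma W E). w t \<le> a} \<in> sets (sigma W E)"
        using EW by (auto simp: space_measure_of_conv)
    qed
  qed (use EW in \<open>auto simp: space_measure_of_conv\<close>)
  have "sets ?B \<subseteq> sigma_sets W E"
  proof
    fix A assume A: "A \<in> sets ?B"
    then have "A \<subseteq> W" using sets.sets_into_space[OF A] by simp
    moreover have "(\<lambda>w. w) -` A \<inter> space (sigma W E) \<in> sets (sigma W E)"
      by (rule measurable_sets[OF sub1 A])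
    ultimately show "A \<in> sigma_sets W E" using EW by (simp add: space_measure_of_conv Int_absorb2)
  qed
  moreover have "E \<subseteq> sets ?B"
  proof
    fix A assume "A \<in> E"
    then obtain F c where F: "finite F" "F \<subseteq> S" "A = {w \<in> W. \<forall>s\<in>F. w s \<le> c s}"
      unfolding E_def by auto
    have "{w \<in> space ?B. \<forall>s\<in>F. w s \<le> c s} \<in> sets ?B"
    proof (rule sets.sets_Collect_finite_All[OF _ F(1)])
      fix s assume "s \<in> F"
      then have [measurable]: "(\<lambda>w. w s) \<in> borel_measurable ?B"
        using F(2) by (intro measurable_coordinate) auto
      show "{w \<in> space ?B. w s \<le> c s} \<in> sets ?B" by measurable
    qed
    then show "A \<in> sets ?B" using F(3) by simp
  qed
  then have "sigma_sets W E \<subseteq> sets ?B"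
    using sets.sigma_sets_subset[of E ?B] by simp
  ultimately have gen: "sets ?B = sigma_sets W E" by blast
  show ?thesis
  proof (rule measure_eqI_generator_eq[where A = "\<lambda>_. W"])
    show "Int_stable E"
      unfolding Int_stable_def
    proof (intro ballI)
      fix A B assume "A \<in> E" "B \<in> E"
      then obtain F c where F: "finite F" "F \<subseteq> S" "A = {w \<in> W. \<forall>s\<in>F. w s \<le> c s}"
        unfolding E_def by blast
      from \<open>B \<in> E\<close> obtain G d where G: "finite G" "G \<subseteq> S" "B = {w \<in> W. \<forall>s\<in>G. w s \<le> d s}"
        unfolding E_def by blast
      define e where "e s = (if s \<in> F \<and> s \<in> G then min (c s) (d s) else if s \<in> F then c s else d s)" for s
      have "x \<le> e s \<longleftrightarrow> (s \<in> F \<longrightarrow> x \<le> c s) \<and> (s \<in> G \<longrightarrow> x \<le> d s)" if "s \<in> F \<union> G" for s x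
        using that unfolding e_def by (cases "s \<in> F"; cases "s \<in> G"; simp)
      then have "A \<inter> B = {w \<in> W. \<forall>s\<in>F \<union> G. w s \<le> e s}"
        unfolding F(3) G(3) by blast
      moreover have "finite (F \<union> G)" "F \<union> G \<subseteq> S" using F G by auto
      ultimately show "A \<inter> B \<in> E"
        unfolding E_def by (intro CollectI exI[of _ "F \<union> G"] exI[of _ e]) auto
    qed
    have "W \<in> E"
      unfolding E_def by (intro CollectI exI[of _ "{}"] exI[of _ "\<lambda>_. 0"]) auto
    then show "range (\<lambda>_::nat. W) \<subseteq> E" by auto
    show "E \<subseteq> Pow W" by (rule EW)
    show "sets N1 = sigma_sets W E" "sets N2 = sigma_sets W E" using sets gen by simp_all
    show "(\<Union>i::nat. W) = W" by simp
    show "emeasure N1 W \<noteq> \<infinity>" by (rule fin)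
    fix X assume "X \<in> E"
    then show "emeasure N1 X = emeasure N2 X" unfolding E_def using eq by clarify
  qed
qed

section \<open>Shifting a Brownian motion along a step function\<close>

locale brownian_motion =
  fixes M :: "'a measure" and B :: "real \<Rightarrow> 'a \<Rightarrow> real"
  assumes bm: "standard_brownian_motion M B"

sublocale brownian_motion \<subseteq> prob_space M
  using bm unfolding standard_brownian_motion_def by blast

context brownian_motion
begin

lemma B_measurable [measurable (raw)]: "0 \<le> t \<Longrightarrow> B t \<in> borel_measurable M"
  using bm unfolding standard_brownian_motion_def by blast

lemma B_0: "\<omega> \<in> space M \<Longrightarrow> B 0 \<omega> = 0"
  using bm unfolding standard_brownian_motion_def by blast

lemma increment_distributed:
  "0 \<le> s \<Longrightarrow> s < t \<Longrightarrow>
    distributed M lborel (\<lambda>\<omega>. B t \<omega> - B s \<omega>) (\<lambda>x. ennreal (normal_density 0 (sqrt (t - s)) x))"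
  using bm unfolding standard_brownian_motion_def by blast

lemma increments_indep:
  "0 \<le> t 0 \<Longrightarrow> (\<And>i. i < n \<Longrightarrow> t i \<le> t (Suc i)) \<Longrightarrow>
    indep_vars (\<lambda>_. borel) (\<lambda>i \<omega>. B (t (Suc i)) \<omega> - B (t i) \<omega>) {..<n::nat}"
  using bm unfolding standard_brownian_motion_def by blast

text \<open>
  Multiplying the centred normal density of variance \<open>t - s\<close> by the exponential completes the
  square and moves the mean to \<open>a * (t - s)\<close>.
\<close>

lemma increment_shift:
  assumes st: "0 \<le> s" "s \<le> t" and A[measurable]: "A \<in> sets borel"
  shows "(\<integral>\<^sup>+ \<omega>. ennreal (exp (a * (B t \<omega> - B s \<omega>) - a\<^sup>2 * (t - s) / 2)) * indicator A (B t \<omega> - B s \<omega>) \<partial>M)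
    = (\<integral>\<^sup>+ \<omega>. indicator A (B t \<omega> - B s \<omega> + a * (t - s)) \<partial>M)"
proof (cases "s = t")
  case True
  then show ?thesis by simp
next
  case False
  then have lt: "s < t" using st by simp
  define d where "d = t - s"
  have d: "d > 0" unfolding d_def using lt by simp
  note D = increment_distributed[OF st(1) lt, folded d_def]
  have dens: "normal_density 0 (sqrt d) x * exp (a * x - a\<^sup>2 * d / 2) = normal_density 0 (sqrt d) (x - a * d)" for x
  proof -
    have "- (x - a * d)\<^sup>2 / (2 * d) = - x\<^sup>2 / (2 * d) + (a * x - a\<^sup>2 * d / 2)"
      using d by (simp add: field_simps power2_eq_square)
    then show ?thesis
      using d unfolding normal_density_def by (simp add: mult_exp_exp)
  qed
  have "(\<integral>\<^sup>+ \<omega>. ennreal (exp (a * (B t \<omega> - B s \<omega>) - a\<^sup>2 * d / 2)) * indicator A (B t \<omega> - B s \<omega>) \<partial>M)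
     = (\<integral>\<^sup>+ x. ennreal (normal_density 0 (sqrt d) x) * (ennreal (exp (a * x - a\<^sup>2 * d / 2)) * indicator A x) \<partial>lborel)"
    by (rule distributed_nn_integral[OF D, symmetric]) simp
  also have "\<dots> = (\<integral>\<^sup>+ x. ennreal (normal_density 0 (sqrt d) (x - a * d)) * indicator A x \<partial>lborel)"
    by (intro nn_integral_cong)
       (simp add: dens[symmetric] ennreal_mult mult.assoc)
  also have "\<dots> = (\<integral>\<^sup>+ x. ennreal (normal_density 0 (sqrt d) x) * indicator A (x + a * d) \<partial>lborel)"
    by (subst nn_integral_real_affine[where c = 1 and t = "a * d"]) (auto simp: add.commute)
  also have "\<dots> = (\<integral>\<^sup>+ \<omega>. indicator A (B t \<omega> - B s \<omega> + a * d) \<partial>M)"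
    by (rule distributed_nn_integral[OF D]) simp
  finally show ?thesis unfolding d_def .
qed

text \<open>
  Since the increments are independent, shifting all of them at once has the product of the
  exponentials as its density.
\<close>

lemma increments_shift:
  fixes t a :: "nat \<Rightarrow> real" and n :: nat
  defines "Z \<equiv> \<lambda>i \<omega>. B (t (Suc i)) \<omega> - B (t i) \<omega>"
    and "PM \<equiv> PiM {..<n} (\<lambda>_. borel)"
  assumes t: "0 \<le> t 0" "\<And>i. i < n \<Longrightarrow> t i \<le> t (Suc i)"
    and \<Phi>[measurable]: "\<Phi> \<in> borel_measurable PM"
  shows "(\<integral>\<^sup>+ \<omega>. ennreal (exp (\<Sum>i<n. a i * Z i \<omega> - (a i)\<^sup>2 * (t (Suc i) - t i) / 2)) *
            \<Phi> (\<lambda>i\<in>{..<n}. Z i \<omega>) \<partial>M)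
    = (\<integral>\<^sup>+ \<omega>. \<Phi> (\<lambda>i\<in>{..<n}. Z i \<omega> + a i * (t (Suc i) - t i)) \<partial>M)"
proof -
  have tpos: "0 \<le> t i" if "i \<le> n" for i
    using that by (induction i) (use t in \<open>auto intro: order_trans\<close>)
  have Zm[measurable]: "Z i \<in> borel_measurable M" if "i < n" for i
    unfolding Z_def using tpos that by (intro borel_measurable_diff B_measurable) auto
  define d where "d i = t (Suc i) - t i" for i
  define e where "e i \<omega> = exp (a i * Z i \<omega> - (a i)\<^sup>2 * d i / 2)" for i \<omega>
  have em[measurable]: "e i \<in> borel_measurable M" if "i < n" for i
    unfolding e_def using Zm[OF that] by measurable
  have esum: "ennreal (exp (\<Sum>i<n. a i * Z i \<omega> - (a i)\<^sup>2 * d i / 2)) = (\<Prod>i<n. ennreal (e i \<omega>))" for \<omega>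
    unfolding e_def by (subst exp_sum) (auto simp: prod_ennreal)
  define D where "D \<omega> = (\<Prod>i<n. ennreal (e i \<omega>))" for \<omega>
  have Dm[measurable]: "D \<in> borel_measurable M"
    unfolding D_def by (intro borel_measurable_prod_ennreal measurable_compose[OF em measurable_ennreal]) auto
  define X where "X \<omega> = (\<lambda>i\<in>{..<n}. Z i \<omega>)" for \<omega>
  define Y where "Y \<omega> = (\<lambda>i\<in>{..<n}. Z i \<omega> + a i * d i)" for \<omega>
  have Xm[measurable]: "X \<in> measurable M PM"
    unfolding X_def PM_def by (intro measurable_restrict) (auto intro: Zm)
  have Ym[measurable]: "Y \<in> measurable M PM"
    unfolding Y_def PM_def by (intro measurable_restrict) (auto intro: borel_measurable_add Zm)
  have indep: "indep_vars (\<lambda>_. borel) Z {..<n}"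
    unfolding Z_def by (rule increments_indep[OF t])
  have prod: "(\<integral>\<^sup>+ \<omega>. (\<Prod>i<n. f i (Z i \<omega>)) \<partial>M) = (\<Prod>i<n. \<integral>\<^sup>+ \<omega>. f i (Z i \<omega>) \<partial>M)"
    if "\<And>i. f i \<in> borel_measurable borel" for f :: "nat \<Rightarrow> real \<Rightarrow> ennreal"
    by (rule indep_vars_nn_integral)
       (use indep_vars_compose2[OF indep, of f "\<lambda>_. borel"] that in auto)
  have "distr (density M D) PM X = distr M PM Y"
  proof (rule measure_eqI_PiM_finite[where I = "{..<n}" and M = "\<lambda>_. borel"
        and A = "\<lambda>_. Pi\<^sub>E {..<n} (\<lambda>_. UNIV)"])
    show "sets (distr (density M D) PM X) = sets (Pi\<^sub>M {..<n} (\<lambda>_. borel))"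
         "sets (distr M PM Y) = sets (Pi\<^sub>M {..<n} (\<lambda>_. borel))"
      by (simp_all add: PM_def)
    have eq: "emeasure (distr (density M D) PM X) (Pi\<^sub>E {..<n} A) = emeasure (distr M PM Y) (Pi\<^sub>E {..<n} A)"
      if A: "\<And>i. i \<in> {..<n} \<Longrightarrow> A i \<in> sets borel" for A
    proof -
      define A' where "A' i = (if i < n then A i else UNIV)" for i
      have A'[measurable]: "A' i \<in> sets borel" for i unfolding A'_def using A by auto
      have PA: "Pi\<^sub>E {..<n} A = Pi\<^sub>E {..<n} A'" unfolding A'_def by (intro PiE_cong) auto
      have PAm[measurable]: "Pi\<^sub>E {..<n} A' \<in> sets PM"
        unfolding PM_def by (intro sets_PiM_I_finite) auto
      have ind: "indicator (Pi\<^sub>E {..<n} A') (\<lambda>i\<in>{..<n}. z i) = (\<Prod>i<n. indicator (A' i) (z i) :: ennreal)"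
        for z :: "nat \<Rightarrow> real"
      proof (cases "\<forall>i<n. z i \<in> A' i")
        case True
        then have "(\<lambda>i\<in>{..<n}. z i) \<in> Pi\<^sub>E {..<n} A'" by auto
        then show ?thesis using True by simp
      next
        case False
        then have "(\<lambda>i\<in>{..<n}. z i) \<notin> Pi\<^sub>E {..<n} A'" by (force simp: PiE_iff)
        moreover have "(\<Prod>i<n. indicator (A' i) (z i) :: ennreal) = 0"
          using False by (intro prod_zero) (auto simp: indicator_def)
        ultimately show ?thesis by simp
      qed
      have "emeasure (distr (density M D) PM X) (Pi\<^sub>E {..<n} A')
         = (\<integral>\<^sup>+ \<omega>. D \<omega> * indicator (Pi\<^sub>E {..<n} A') (X \<omega>) \<partial>M)"
        by (subst emeasure_distr, simp, simp, subst emeasure_density)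
           (auto intro!: nn_integral_cong split: split_indicator)
      also have "\<dots> = (\<integral>\<^sup>+ \<omega>. (\<Prod>i<n. ennreal (exp (a i * Z i \<omega> - (a i)\<^sup>2 * d i / 2)) * indicator (A' i) (Z i \<omega>)) \<partial>M)"
        unfolding X_def ind D_def e_def prod.distrib ..
      also have "\<dots> = (\<Prod>i<n. \<integral>\<^sup>+ \<omega>. ennreal (exp (a i * Z i \<omega> - (a i)\<^sup>2 * d i / 2)) * indicator (A' i) (Z i \<omega>) \<partial>M)"
        by (rule prod[of "\<lambda>i x. ennreal (exp (a i * x - (a i)\<^sup>2 * d i / 2)) * indicator (A' i) x"]) simp
      also have "\<dots> = (\<Prod>i<n. \<integral>\<^sup>+ \<omega>. indicator (A' i) (Z i \<omega> + a i * d i) \<partial>M)"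
        unfolding Z_def d_def by (intro prod.cong refl increment_shift) (use t tpos in auto)
      also have "\<dots> = (\<integral>\<^sup>+ \<omega>. (\<Prod>i<n. indicator (A' i) (Z i \<omega> + a i * d i)) \<partial>M)"
        by (rule prod[of "\<lambda>i x. indicator (A' i) (x + a i * d i)", symmetric]) simp
      also have "\<dots> = (\<integral>\<^sup>+ \<omega>. indicator (Pi\<^sub>E {..<n} A') (Y \<omega>) \<partial>M)"
        unfolding Y_def ind ..
      also have "\<dots> = emeasure (distr M PM Y) (Pi\<^sub>E {..<n} A')"
        by (subst nn_integral_indicator[symmetric], simp, subst nn_integral_distr) auto
      finally show ?thesis unfolding PA .
    qed
    show "\<And>A. (\<And>i. i \<in> {..<n} \<Longrightarrow> A i \<in> sets borel) \<Longrightarrow>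
         emeasure (distr (density M D) PM X) (Pi\<^sub>E {..<n} A) = emeasure (distr M PM Y) (Pi\<^sub>E {..<n} A)"
      by (rule eq)
    show "range (\<lambda>_::nat. Pi\<^sub>E {..<n} (\<lambda>_. UNIV)) \<subseteq> prod_algebra {..<n} (\<lambda>_. borel :: real measure)"
      by (auto intro!: prod_algebraI_finite)
    show "(\<Union>i::nat. Pi\<^sub>E {..<n} (\<lambda>_. UNIV)) = space (Pi\<^sub>M {..<n} (\<lambda>_. borel :: real measure))"
      by (simp add: space_PiM)
    interpret Y: prob_space "distr M PM Y" by (rule prob_space_distr) simp
    show "emeasure (distr (density M D) PM X) (Pi\<^sub>E {..<n} (\<lambda>_. UNIV)) \<noteq> \<infinity>"
      by (subst eq) auto
  qed simp
  then have "(\<integral>\<^sup>+ z. \<Phi> z \<partial>distr (density M D) PM X) = (\<integral>\<^sup>+ z. \<Phi> z \<partial>distr M PM Y)" by simp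
  then have "(\<integral>\<^sup>+ \<omega>. D \<omega> * \<Phi> (X \<omega>) \<partial>M) = (\<integral>\<^sup>+ \<omega>. \<Phi> (Y \<omega>) \<partial>M)"
    by (simp add: nn_integral_distr nn_integral_density)
  then show ?thesis
    unfolding d_def[symmetric] esum D_def X_def Y_def .
qed

end

subsection \<open>Step functions on a grid\<close>

lemma exists_grid:
  fixes F :: "real set"
  assumes "finite F" "0 \<in> F" "F \<subseteq> {0..}"
  shows "\<exists>t n. t 0 = 0 \<and> (\<forall>i<n. t i < t (Suc i)) \<and> F = t ` {..n::nat}"
proof -
  define ts where "ts = sorted_list_of_set F"
  have ts: "set ts = F" "sorted ts" "distinct ts" unfolding ts_def using assms(1) by auto
  have ne: "ts \<noteq> []" using ts assms(2) by auto
  define n where "n = length ts - 1"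
  have len: "length ts = Suc n" unfolding n_def using ne by (cases ts) auto
  have "ts ! 0 = 0"
  proof -
    obtain i where i: "i < length ts" "ts ! i = 0" using assms(2) ts(1) by (metis in_set_conv_nth)
    have "ts ! 0 \<le> ts ! i" using ts(2) i(1) by (auto intro: sorted_nth_mono)
    moreover have "ts ! 0 \<in> F" using ts(1) len by (metis nth_mem zero_less_Suc)
    ultimately show ?thesis using i(2) assms(3) by force
  qed
  moreover have "ts ! i < ts ! Suc i" if "i < n" for i
  proof -
    have "ts ! i \<le> ts ! Suc i" using that len ts(2) by (intro sorted_nth_mono) auto
    moreover have "ts ! i \<noteq> ts ! Suc i" using that len ts(3) by (simp add: nth_eq_iff_index_eq)
    ultimately show ?thesis by simp
  qed
  moreover have "F = (!) ts ` {..n}"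
    using ts(1) len by (auto simp: set_conv_nth less_Suc_eq_le image_iff)
  ultimately show ?thesis by blast
qed

locale grid =
  fixes t :: "nat \<Rightarrow> real" and n :: nat
  assumes t0: "t 0 = 0" and step: "\<And>i. i < n \<Longrightarrow> t i < t (Suc i)"
begin

lemma t_less: "i < j \<Longrightarrow> j \<le> n \<Longrightarrow> t i < t j"
proof (induction j)
  case (Suc j)
  then show ?case using step[of j] by (cases "i = j") force+
qed simp

lemma t_le: "i \<le> j \<Longrightarrow> j \<le> n \<Longrightarrow> t i \<le> t j"
  using t_less[of i j] by (cases "i = j") auto

lemma t_le_iff: "i \<le> n \<Longrightarrow> j \<le> n \<Longrightarrow> t i \<le> t j \<longleftrightarrow> i \<le> j"
  using t_le[of i j] t_less[of j i] by (cases "i \<le> j") (auto simp: not_le)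

text \<open>
  On a grid that contains all the endpoints, overlapping intervals no longer matter: every sum
  over the list becomes a sum over the grid cells, by telescoping.
\<close>

lemma step_sum_on_grid:
  fixes G :: "real \<Rightarrow> real"
  assumes "\<forall>(a, l, r)\<in>set xs. l \<in> t ` {..n} \<and> r \<in> t ` {..n} \<and> l \<le> r"
  shows "(\<Sum>(a, l, r)\<leftarrow>xs. a * (G r - G l)) =
    (\<Sum>i<n. step_fun xs (t (Suc i)) * (G (t (Suc i)) - G (t i)))"
  using assms
proof (induction xs)
  case Nil
  then show ?case by (simp add: step_fun_def)
next
  case (Cons x xs)
  obtain a l r where x: "x = (a, l, r)" by (cases x)
  obtain j k where jk: "l = t j" "r = t k" "j \<le> n" "k \<le> n" "t j \<le> t k"
    using Cons.prems x by auto
  then have jk': "j \<le> k" using t_le_iff by blast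
  have cell: "indicator {l<..r} (t (Suc i)) = (if i \<in> {j..<k} then 1 else 0 :: real)" if "i < n" for i
  proof -
    have "t j < t (Suc i) \<longleftrightarrow> j \<le> i" using t_le_iff[of "Suc i" j] that jk by (auto simp: not_le[symmetric])
    moreover have "t (Suc i) \<le> t k \<longleftrightarrow> i < k" using t_le_iff[of "Suc i" k] that jk by auto
    ultimately show ?thesis unfolding jk by (auto simp: indicator_def)
  qed
  have "(\<Sum>i<n. a * indicator {l<..r} (t (Suc i)) * (G (t (Suc i)) - G (t i)))
      = (\<Sum>i<n. if i \<in> {j..<k} then a * (G (t (Suc i)) - G (t i)) else 0)"
    by (intro sum.cong refl) (simp add: cell)
  also have "\<dots> = (\<Sum>i\<in>{j..<k}. a * (G (t (Suc i)) - G (t i)))"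
    using jk by (subst sum.inter_restrict[symmetric]) (auto intro!: sum.cong)
  also have "\<dots> = a * (G r - G l)"
    unfolding jk(1,2) sum_distrib_left[symmetric]
    by (subst sum_Suc_diff'[OF jk', of "\<lambda>i. G (t i)"]) simp
  finally show ?case
    using Cons by (simp add: x step_fun_def distrib_right sum.distrib)
qed

lemma step_fun_on_grid:
  assumes "\<forall>(a, l, r)\<in>set xs. l \<in> t ` {..n} \<and> r \<in> t ` {..n} \<and> l \<le> r"
  shows "step_fun xs x = (\<Sum>i<n. step_fun xs (t (Suc i)) * indicator {t i<..t (Suc i)} x)"
proof -
  have "step_fun xs x = (\<Sum>(a, l, r)\<leftarrow>xs. a * (indicator {..r} x - indicator {..l} x))"
    unfolding step_fun_def
    by (intro arg_cong[where f = sum_list] map_cong refl)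
       (use assms in \<open>auto split: split_indicator\<close>)
  also have "\<dots> = (\<Sum>i<n. step_fun xs (t (Suc i)) * (indicator {..t (Suc i)} x - indicator {..t i} x))"
    by (rule step_sum_on_grid[OF assms])
  also have "\<dots> = (\<Sum>i<n. step_fun xs (t (Suc i)) * indicator {t i<..t (Suc i)} x)"
    by (intro sum.cong refl arg_cong2[where f = "(*)"])
       (use step in \<open>force split: split_indicator\<close>)
  finally show ?thesis .
qed

lemma step_fun_square_on_grid:
  assumes "\<forall>(a, l, r)\<in>set xs. l \<in> t ` {..n} \<and> r \<in> t ` {..n} \<and> l \<le> r"
  shows "(step_fun xs x)\<^sup>2 = (\<Sum>i<n. (step_fun xs (t (Suc i)))\<^sup>2 * indicator {t i<..t (Suc i)} x)"
proof -
  have disj: "indicator {t i<..t (Suc i)} x * indicator {t j<..t (Suc j)} x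
      = (if j = i then indicator {t i<..t (Suc i)} x else 0 :: real)" if "i < n" "j < n" for i j
  proof -
    consider "j = i" | "Suc i \<le> j" | "Suc j \<le> i" by linarith
    then show ?thesis
    proof cases
      case 2
      then have "t (Suc i) \<le> t j" using that by (intro t_le) auto
      then show ?thesis using 2 by (auto split: split_indicator)
    next
      case 3
      then have "t (Suc j) \<le> t i" using that by (intro t_le) auto
      then show ?thesis using 3 by (auto split: split_indicator)
    qed (auto split: split_indicator)
  qed
  let ?a = "\<lambda>i. step_fun xs (t (Suc i))"
  have "(step_fun xs x)\<^sup>2 = (\<Sum>i<n. \<Sum>j<n. ?a i * ?a j * (indicator {t i<..t (Suc i)} x * indicator {t j<..t (Suc j)} x))"
    unfolding power2_eq_square step_fun_on_grid[OF assms, of x] sum_product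
    by (intro sum.cong refl) (simp only: mult_ac)
  also have "\<dots> = (\<Sum>i<n. \<Sum>j<n. if j = i then (?a i)\<^sup>2 * indicator {t i<..t (Suc i)} x else 0)"
    by (intro sum.cong refl) (auto simp: disj power2_eq_square)
  also have "\<dots> = (\<Sum>i<n. (?a i)\<^sup>2 * indicator {t i<..t (Suc i)} x)"
    by (intro sum.cong refl) (simp add: sum.delta)
  finally show ?thesis .
qed

end

definition nonneg_steps :: "(real \<times> real \<times> real) list \<Rightarrow> bool" where
  "nonneg_steps xs \<longleftrightarrow> (\<forall>(a, l, r)\<in>set xs. 0 \<le> l \<and> l \<le> r)"

definition step_energy :: "(real \<times> real \<times> real) list \<Rightarrow> real" where
  "step_energy xs = (LINT x|lborel. (step_fun xs x)\<^sup>2)"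

definition step_drift :: "(real \<times> real \<times> real) list \<Rightarrow> real \<Rightarrow> real" where
  "step_drift xs u = (LINT x|lborel. indicator {0..u} x * step_fun xs x)"

context grid
begin

lemma integral_grid_cells:
  assumes "k \<le> n"
  shows "(LINT x|lborel. (\<Sum>i<k. c i * indicator {t i<..t (Suc i)} x)) = (\<Sum>i<k. c i * (t (Suc i) - t i))"
proof -
  have le: "t i \<le> t (Suc i)" if "i < k" for i using step[of i] that assms by simp
  have "(LINT x|lborel. (\<Sum>i<k. c i * indicator {t i<..t (Suc i)} x))
      = (\<Sum>i<k. LINT x|lborel. c i * indicator {t i<..t (Suc i)} x)"
    using le by (intro Bochner_Integration.integral_sum integrable_mult_right integrable_real_indicator) auto
  also have "\<dots> = (\<Sum>i<k. c i * (t (Suc i) - t i))"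
    using le by (intro sum.cong refl) simp
  finally show ?thesis .
qed

lemma step_energy_on_grid:
  assumes "\<forall>(a, l, r)\<in>set xs. l \<in> t ` {..n} \<and> r \<in> t ` {..n} \<and> l \<le> r"
  shows "step_energy xs = (\<Sum>i<n. (step_fun xs (t (Suc i)))\<^sup>2 * (t (Suc i) - t i))"
proof -
  have "step_energy xs
      = (LINT x|lborel. (\<Sum>i<n. (step_fun xs (t (Suc i)))\<^sup>2 * indicator {t i<..t (Suc i)} x))"
    unfolding step_energy_def
    by (rule Bochner_Integration.integral_cong[OF refl step_fun_square_on_grid[OF assms]])
  also have "\<dots> = (\<Sum>i<n. (step_fun xs (t (Suc i)))\<^sup>2 * (t (Suc i) - t i))"
    by (rule integral_grid_cells) simp
  finally show ?thesis .
qed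

lemma step_drift_on_grid:
  assumes xs: "\<forall>(a, l, r)\<in>set xs. l \<in> t ` {..n} \<and> r \<in> t ` {..n} \<and> l \<le> r" and k: "k \<le> n"
  shows "step_drift xs (t k) = (\<Sum>i<k. step_fun xs (t (Suc i)) * (t (Suc i) - t i))"
proof -
  let ?a = "\<lambda>i. step_fun xs (t (Suc i))"
  have ind: "indicator {0..t k} x * indicator {t i<..t (Suc i)} x =
      (if i < k then indicator {t i<..t (Suc i)} x else 0 :: real)" if "i < n" for i x
  proof -
    have "0 \<le> t i" using t_le[of 0 i] that t0 by simp
    moreover have "t (Suc i) \<le> t k" if "i < k" using that k by (intro t_le) auto
    moreover have "t k \<le> t i" if "\<not> i < k" using that \<open>i < n\<close> by (intro t_le) auto
    ultimately show ?thesis by (cases "i < k") (auto split: split_indicator)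
  qed
  have eq: "indicator {0..t k} x * step_fun xs x = (\<Sum>i<k. ?a i * indicator {t i<..t (Suc i)} x)" for x
  proof -
    have "indicator {0..t k} x * step_fun xs x
        = (\<Sum>i<n. ?a i * (indicator {0..t k} x * indicator {t i<..t (Suc i)} x))"
      unfolding step_fun_on_grid[OF xs, of x] sum_distrib_left
      by (intro sum.cong refl) (simp only: mult_ac)
    also have "\<dots> = (\<Sum>i<n. if i \<in> {..<k} then ?a i * indicator {t i<..t (Suc i)} x else 0)"
      by (intro sum.cong refl) (auto simp: ind)
    also have "\<dots> = (\<Sum>i<k. ?a i * indicator {t i<..t (Suc i)} x)"
      using k by (subst sum.inter_restrict[symmetric]) (auto intro!: sum.cong)
    finally show ?thesis .
  qed
  show ?thesis unfolding step_drift_def eq by (rule integral_grid_cells[OF k])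
qed

end

lemma borel_measurable_step_integral:
  assumes B: "\<And>u. 0 \<le> u \<Longrightarrow> B u \<in> borel_measurable M" and "nonneg_steps xs"
  shows "step_integral B xs \<in> borel_measurable M"
  using assms(2)
proof (induction xs)
  case (Cons x xs)
  obtain a l r where x: "x = (a, l, r)" by (cases x)
  have "B r \<in> borel_measurable M" "B l \<in> borel_measurable M" "step_integral B xs \<in> borel_measurable M"
    using Cons x by (auto simp: nonneg_steps_def intro!: B)
  moreover have "step_integral B (x # xs) = (\<lambda>\<omega>. a * (B r \<omega> - B l \<omega>) + step_integral B xs \<omega>)"
    by (auto simp: step_integral_def x)
  ultimately show ?case by simp
qed (simp add: step_integral_def[abs_def])

context brownian_motion
begin

lemma step_integral_measurable: "nonneg_steps xs \<Longrightarrow> step_integral B xs \<in> borel_measurable M"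
  by (rule borel_measurable_step_integral[OF B_measurable])

text \<open>
  Refining to a grid that contains the endpoints of the steps and the observation times reduces
  the formula for step functions to the shift of independent increments.
\<close>

lemma step_cameron_martin:
  fixes s :: "'i \<Rightarrow> real"
  assumes xs: "nonneg_steps xs" and I: "finite I" and s: "\<And>i. i \<in> I \<Longrightarrow> 0 \<le> s i"
  shows "(\<integral>\<^sup>+ \<omega>. ennreal (exp (step_integral B xs \<omega> - step_energy xs / 2)) *
            indicator {\<omega>. \<forall>i\<in>I. B (s i) \<omega> \<le> c i} \<omega> \<partial>M)
       = emeasure M {\<omega> \<in> space M. \<forall>i\<in>I. B (s i) \<omega> + step_drift xs (s i) \<le> c i}"
proof -
  \<comment> \<open>The time 0 starts the grid, so that values at grid points are sums of increments.\<close>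
  define F where "F = insert 0 (s ` I \<union> (\<lambda>(a, l, r). l) ` set xs \<union> (\<lambda>(a, l, r). r) ` set xs)"
  have "finite F" "0 \<in> F" "F \<subseteq> {0..}"
    unfolding F_def using I s xs by (auto simp: nonneg_steps_def)
  then obtain t n where t: "t 0 = 0" "\<And>i. i < n \<Longrightarrow> t i < t (Suc i)" "F = t ` {..n::nat}"
    using exists_grid by metis
  interpret g: grid t n using t by unfold_locales
  have xs_grid: "\<forall>(a, l, r)\<in>set xs. l \<in> t ` {..n} \<and> r \<in> t ` {..n} \<and> l \<le> r"
    using xs unfolding t(3)[symmetric] F_def nonneg_steps_def by (force simp: image_iff)
  have "\<exists>k\<le>n. s i = t k" if "i \<in> I" for i
  proof -
    have "s i \<in> t ` {..n}" unfolding t(3)[symmetric] F_def using that by auto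
    then show ?thesis by auto
  qed
  then obtain \<kappa> where \<kappa>: "\<And>i. i \<in> I \<Longrightarrow> \<kappa> i \<le> n \<and> s i = t (\<kappa> i)" by metis
  define Z where "Z i \<omega> = B (t (Suc i)) \<omega> - B (t i) \<omega>" for i \<omega>
  let ?a = "\<lambda>i. step_fun xs (t (Suc i))"
  let ?d = "\<lambda>i. t (Suc i) - t i"
  have I_eq: "step_integral B xs \<omega> - step_energy xs / 2 = (\<Sum>i<n. ?a i * Z i \<omega> - (?a i)\<^sup>2 * ?d i / 2)" for \<omega>
    unfolding step_integral_def g.step_sum_on_grid[OF xs_grid, of "\<lambda>t. B t \<omega>"]
      g.step_energy_on_grid[OF xs_grid] Z_def
    by (simp add: sum_subtractf sum_divide_distrib)
  have B_eq: "B (t k) \<omega> = (\<Sum>j<k. Z j \<omega>)" if "\<omega> \<in> space M" for k \<omega>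
    unfolding Z_def sum_lessThan_telescope[of "\<lambda>j. B (t j) \<omega>"] using t(1) B_0[OF that] by simp
  define \<Phi> :: "(nat \<Rightarrow> real) \<Rightarrow> ennreal"
    where "\<Phi> z = indicator {z. \<forall>i\<in>I. (\<Sum>j<\<kappa> i. z j) \<le> c i} z" for z
  let ?PM = "PiM {..<n} (\<lambda>_. borel :: real measure)"
  have \<Phi>m: "\<Phi> \<in> borel_measurable ?PM"
    unfolding \<Phi>_def
  proof (rule borel_measurable_indicator')
    have "(\<lambda>z. \<Sum>j<\<kappa> i. z j) \<in> borel_measurable ?PM" if "i \<in> I" for i
      using \<kappa>[OF that] by (intro borel_measurable_sum measurable_component_singleton) auto
    then show "{z \<in> space ?PM. z \<in> {z. \<forall>i\<in>I. (\<Sum>j<\<kappa> i. z j) \<le> c i}} \<in> sets ?PM"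
      unfolding mem_Collect_eq using I
      by (intro sets.sets_Collect_finite_All borel_measurable_le) auto
  qed
  have R: "(\<Sum>j<\<kappa> i. (\<lambda>i\<in>{..<n}. z i) j) = (\<Sum>j<\<kappa> i. z j)" if "i \<in> I" for i and z :: "nat \<Rightarrow> real"
    using \<kappa>[OF that] by (intro sum.cong) auto
  have \<Phi>R: "\<Phi> (\<lambda>i\<in>{..<n}. z i) = indicator {z. \<forall>i\<in>I. (\<Sum>j<\<kappa> i. z j) \<le> c i} z" for z
    unfolding \<Phi>_def indicator_def mem_Collect_eq using R by (simp del: restrict_apply)
  have "(\<integral>\<^sup>+ \<omega>. ennreal (exp (step_integral B xs \<omega> - step_energy xs / 2)) *
            indicator {\<omega>. \<forall>i\<in>I. B (s i) \<omega> \<le> c i} \<omega> \<partial>M)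
      = (\<integral>\<^sup>+ \<omega>. ennreal (exp (\<Sum>i<n. ?a i * Z i \<omega> - (?a i)\<^sup>2 * ?d i / 2)) * \<Phi> (\<lambda>i\<in>{..<n}. Z i \<omega>) \<partial>M)"
    unfolding I_eq
    by (intro nn_integral_cong arg_cong2[where f = "(*)"] refl)
       (auto simp: \<Phi>R indicator_def \<kappa> B_eq)
  also have "\<dots> = (\<integral>\<^sup>+ \<omega>. \<Phi> (\<lambda>i\<in>{..<n}. Z i \<omega> + ?a i * ?d i) \<partial>M)"
    unfolding Z_def by (rule increments_shift) (use t(1) less_imp_le[OF t(2)] \<Phi>m in auto)
  also have "\<dots> = (\<integral>\<^sup>+ \<omega>. indicator {\<omega> \<in> space M. \<forall>i\<in>I. B (s i) \<omega> + step_drift xs (s i) \<le> c i} \<omega> \<partial>M)"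
    by (intro nn_integral_cong)
       (auto simp: \<Phi>R indicator_def \<kappa> B_eq g.step_drift_on_grid[OF xs_grid] sum.distrib)
  also have "\<dots> = emeasure M {\<omega> \<in> space M. \<forall>i\<in>I. B (s i) \<omega> + step_drift xs (s i) \<le> c i}"
  proof (rule nn_integral_indicator)
    show "{\<omega> \<in> space M. \<forall>i\<in>I. B (s i) \<omega> + step_drift xs (s i) \<le> c i} \<in> sets M"
      using I s by (intro sets.sets_Collect_finite_All borel_measurable_le borel_measurable_add B_measurable) auto
  qed
  finally show ?thesis .
qed

lemma step_exponential_mean:
  assumes "nonneg_steps xs"
  shows "(\<integral>\<^sup>+ \<omega>. ennreal (exp (step_integral B xs \<omega> - step_energy xs / 2)) \<partial>M) = 1"
  using step_cameron_martin[OF assms, where I = "{}" and s = "\<lambda>_. 0"] by (simp add: emeasure_space_1)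

end

definition scale_steps :: "real \<Rightarrow> (real \<times> real \<times> real) list \<Rightarrow> (real \<times> real \<times> real) list" where
  "scale_steps b xs = map (\<lambda>(a, l, r). (b * a, l, r)) xs"

lemma step_fun_scale: "step_fun (scale_steps b xs) x = b * step_fun xs x"
  unfolding step_fun_def scale_steps_def by (induction xs) (auto simp: algebra_simps)

lemma step_integral_scale: "step_integral B (scale_steps b xs) \<omega> = b * step_integral B xs \<omega>"
  unfolding step_integral_def scale_steps_def by (induction xs) (auto simp: algebra_simps)

lemma step_fun_append: "step_fun (xs @ ys) x = step_fun xs x + step_fun ys x"
  unfolding step_fun_def by simp

lemma step_integral_append: "step_integral B (xs @ ys) \<omega> = step_integral B xs \<omega> + step_integral B ys \<omega>"
  unfolding step_integral_def by simp

lemma step_energy_scale: "step_energy (scale_steps b xs) = b\<^sup>2 * step_energy xs"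
  unfolding step_energy_def step_fun_scale by (simp add: power_mult_distrib)

lemma nonneg_steps_scale: "nonneg_steps xs \<Longrightarrow> nonneg_steps (scale_steps b xs)"
  unfolding nonneg_steps_def scale_steps_def by auto

lemma nonneg_steps_append: "nonneg_steps xs \<Longrightarrow> nonneg_steps ys \<Longrightarrow> nonneg_steps (xs @ ys)"
  unfolding nonneg_steps_def by auto

lemma step_energy_nonneg: "0 \<le> step_energy xs"
  unfolding step_energy_def by simp

context brownian_motion
begin

lemma step_integral_mgf:
  assumes "nonneg_steps xs"
  shows "(\<integral>\<^sup>+ \<omega>. ennreal (exp (b * step_integral B xs \<omega>)) \<partial>M) = ennreal (exp (b\<^sup>2 * step_energy xs / 2))"
proof -
  have [measurable]: "step_integral B xs \<in> borel_measurable M" by (rule step_integral_measurable[OF assms])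
  let ?V = "b\<^sup>2 * step_energy xs"
  have "1 = (\<integral>\<^sup>+ \<omega>. ennreal (exp (b * step_integral B xs \<omega> - ?V / 2)) \<partial>M)"
    using step_exponential_mean[OF nonneg_steps_scale[OF assms, of b]]
    by (simp add: step_integral_scale step_energy_scale)
  then have "ennreal (exp (?V / 2)) = ennreal (exp (?V / 2)) * (\<integral>\<^sup>+ \<omega>. ennreal (exp (b * step_integral B xs \<omega> - ?V / 2)) \<partial>M)"
    by simp
  also have "\<dots> = (\<integral>\<^sup>+ \<omega>. ennreal (exp (?V / 2)) * ennreal (exp (b * step_integral B xs \<omega> - ?V / 2)) \<partial>M)"
    by (rule nn_integral_cmult[symmetric]) simp
  also have "\<dots> = (\<integral>\<^sup>+ \<omega>. ennreal (exp (b * step_integral B xs \<omega>)) \<partial>M)"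
    by (simp add: ennreal_mult[symmetric] mult_exp_exp)
  finally show ?thesis ..
qed

text \<open>
  A crude form of the Ito isometry. It follows from the exponential moments because
  \<open>x\<^sup>2 + 2 \<le> exp x + exp (- x)\<close>; scaling the integral to energy 1 gives the factor
  \<open>2 * exp (1 / 2) - 2 \<le> 2\<close>.
\<close>

lemma step_integral_second_moment:
  assumes xs: "nonneg_steps xs"
  shows "(\<integral>\<^sup>+ \<omega>. ennreal ((step_integral B xs \<omega>)\<^sup>2) \<partial>M) \<le> ennreal (2 * step_energy xs)"
proof -
  let ?I = "step_integral B xs" and ?V = "step_energy xs"
  have [measurable]: "?I \<in> borel_measurable M" by (rule step_integral_measurable[OF xs])
  have sq: "x\<^sup>2 + 2 \<le> exp x + exp (- x)" for x :: real
  proof -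
    have "x\<^sup>2 + 2 \<le> exp x + exp (- x)" if "0 \<le> x" for x :: real
    proof -
      have "(\<lambda>x. exp x + exp (- x) - x\<^sup>2 - 2) 0 \<le> (\<lambda>x. exp x + exp (- x) - x\<^sup>2 - 2) x"
      proof (rule DERIV_nonneg_imp_nondecreasing[OF that])
        fix y :: real assume y: "0 \<le> y" "y \<le> x"
        have "0 \<le> exp y - exp (- y) - 2 * y"
        proof -
          have "(\<lambda>x. exp x - exp (- x) - 2 * x) 0 \<le> (\<lambda>x. exp x - exp (- x) - 2 * x) y"
          proof (rule DERIV_nonneg_imp_nondecreasing[OF y(1)])
            fix z :: real
            have "0 \<le> (exp (z / 2) - exp (- z / 2))\<^sup>2" by simp
            also have "\<dots> = exp z + exp (- z) - 2"
              by (simp add: power2_eq_square algebra_simps mult_exp_exp)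
            finally have "0 \<le> exp z + exp (- z) - 2" .
            moreover have "((\<lambda>x. exp x - exp (- x) - 2 * x) has_real_derivative exp z + exp (- z) - 2) (at z)"
              by (auto intro!: derivative_eq_intros)
            ultimately show "\<exists>D. ((\<lambda>x. exp x - exp (- x) - 2 * x) has_real_derivative D) (at z) \<and> 0 \<le> D"
              by blast
          qed
          then show ?thesis by simp
        qed
        moreover have "((\<lambda>x. exp x + exp (- x) - x\<^sup>2 - 2) has_real_derivative exp y - exp (- y) - 2 * y) (at y)"
          by (auto intro!: derivative_eq_intros)
        ultimately show "\<exists>D. ((\<lambda>x. exp x + exp (- x) - x\<^sup>2 - 2) has_real_derivative D) (at y) \<and> 0 \<le> D"
          by blast
      qed
      then show ?thesis by simp
    qed
    from this[of x] this[of "- x"] show ?thesis by (cases "0 \<le> x") (auto simp: add.commute)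
  qed
  have bound: "ennreal (b\<^sup>2) * (\<integral>\<^sup>+ \<omega>. ennreal ((?I \<omega>)\<^sup>2) \<partial>M) + 2 \<le> ennreal (2 * exp (b\<^sup>2 * ?V / 2))" for b
  proof -
    have "ennreal (b\<^sup>2) * (\<integral>\<^sup>+ \<omega>. ennreal ((?I \<omega>)\<^sup>2) \<partial>M) + 2 = (\<integral>\<^sup>+ \<omega>. ennreal (b\<^sup>2) * ennreal ((?I \<omega>)\<^sup>2) + 2 \<partial>M)"
      by (simp add: nn_integral_add nn_integral_cmult emeasure_space_1)
    also have "\<dots> \<le> (\<integral>\<^sup>+ \<omega>. ennreal (exp (b * ?I \<omega>)) + ennreal (exp (- b * ?I \<omega>)) \<partial>M)"
    proof (rule nn_integral_mono)
      fix \<omega>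
      have "ennreal (b\<^sup>2) * ennreal ((?I \<omega>)\<^sup>2) + 2 = ennreal ((b * ?I \<omega>)\<^sup>2 + 2)"
        by (simp add: ennreal_mult[symmetric] power_mult_distrib)
      also have "\<dots> \<le> ennreal (exp (b * ?I \<omega>) + exp (- b * ?I \<omega>))"
        using sq[of "b * ?I \<omega>"] by (intro ennreal_leI) simp
      finally show "ennreal (b\<^sup>2) * ennreal ((?I \<omega>)\<^sup>2) + 2 \<le> ennreal (exp (b * ?I \<omega>)) + ennreal (exp (- b * ?I \<omega>))"
        by simp
    qed
    also have "\<dots> = ennreal (exp (b\<^sup>2 * ?V / 2)) + ennreal (exp (b\<^sup>2 * ?V / 2))"
      using step_integral_mgf[OF xs, of b] step_integral_mgf[OF xs, of "- b"]
      by (subst nn_integral_add) auto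
    finally show ?thesis by (simp flip: ennreal_plus)
  qed
  obtain K where K: "(\<integral>\<^sup>+ \<omega>. ennreal ((?I \<omega>)\<^sup>2) \<partial>M) = ennreal K" "0 \<le> K"
  proof -
    have "(\<integral>\<^sup>+ \<omega>. ennreal ((?I \<omega>)\<^sup>2) \<partial>M) + 2 \<le> ennreal (2 * exp (1\<^sup>2 * ?V / 2))"
      using bound[of 1] by simp
    then have "(\<integral>\<^sup>+ \<omega>. ennreal ((?I \<omega>)\<^sup>2) \<partial>M) \<noteq> \<infinity>" by (auto simp: top_unique)
    then show ?thesis using that by (metis ennreal_cases infinity_ennreal_def)
  qed
  have bd: "b\<^sup>2 * K + 2 \<le> 2 * exp (b\<^sup>2 * ?V / 2)" for b
  proof -
    have "ennreal (b\<^sup>2 * K + 2) \<le> ennreal (2 * exp (b\<^sup>2 * ?V / 2))"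
      using bound[of b] K by (simp add: ennreal_mult)
    then show ?thesis by simp
  qed
  have "K \<le> 2 * ?V"
  proof (cases "?V = 0")
    case True
    then show ?thesis using bd[of 1] K(2) by simp
  next
    case False
    then have V: "?V > 0" using step_energy_nonneg[of xs] by simp
    \<comment> \<open>This choice of \<open>b\<close> normalises the energy to 1.\<close>
    have "(1 / sqrt ?V)\<^sup>2 = 1 / ?V" using V by (simp add: power_divide)
    then have "K / ?V + 2 \<le> 2 * exp (1 / 2)" using bd[of "1 / sqrt ?V"] V by simp
    moreover have "exp (1 / 2 :: real) \<le> 2" using exp_bound_half[of "1/2 :: real"] by simp
    ultimately have "K / ?V \<le> 2" by simp
    then show ?thesis using V by (simp add: field_simps)
  qed
  then show ?thesis using K by (simp add: ennreal_leI)
qed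

end

section \<open>The Cameron--Martin formula\<close>

subsection \<open>Mean square limits\<close>

text \<open>Summable second moments force the squares to be summable almost surely.\<close>

lemma AE_tendsto_zero_of_square_bound:
  fixes f :: "nat \<Rightarrow> 'a \<Rightarrow> real"
  assumes f[measurable]: "\<And>n. f n \<in> borel_measurable M"
    and bound: "\<And>n. (\<integral>\<^sup>+ x. ennreal ((f n x)\<^sup>2) \<partial>M) \<le> ennreal (C * (1 / 2) ^ n)" and C: "0 \<le> C"
  shows "AE x in M. (\<lambda>n. f n x) \<longlonglongrightarrow> 0"
proof -
  have "(\<integral>\<^sup>+ x. (\<Sum>n. ennreal ((f n x)\<^sup>2)) \<partial>M) = (\<Sum>n. \<integral>\<^sup>+ x. ennreal ((f n x)\<^sup>2) \<partial>M)"
    by (rule nn_integral_suminf) simp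
  also have "\<dots> \<le> (\<Sum>n. ennreal (C * (1 / 2) ^ n))"
    by (intro suminf_le bound) auto
  also have "\<dots> = ennreal (\<Sum>n. C * (1 / 2) ^ n)"
    using C by (intro suminf_ennreal2 summable_mult summable_geometric) auto
  finally have "(\<integral>\<^sup>+ x. (\<Sum>n. ennreal ((f n x)\<^sup>2)) \<partial>M) \<noteq> \<infinity>" by (auto simp: top_unique)
  then have "AE x in M. (\<Sum>n. ennreal ((f n x)\<^sup>2)) \<noteq> \<infinity>"
    by (intro nn_integral_noteq_infinite) auto
  then show ?thesis
  proof eventually_elim
    case (elim x)
    then have "summable (\<lambda>n. (f n x)\<^sup>2)"
      by (intro summable_suminf_not_top) auto
    then have "(\<lambda>n. (f n x)\<^sup>2) \<longlonglongrightarrow> 0" by (rule summable_LIMSEQ_zero)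
    then have "(\<lambda>n. sqrt ((f n x)\<^sup>2)) \<longlonglongrightarrow> sqrt 0" by (rule tendsto_real_sqrt)
    then show ?case by (simp add: tendsto_rabs_zero_iff)
  qed
qed

text \<open>
  This is how weighted inequalities such as \<open>2 * \<bar>x * y\<bar> \<le> \<epsilon> * x\<^sup>2 + y\<^sup>2 / \<epsilon>\<close> lead to limits:
  \<open>\<epsilon>\<close> is chosen before \<open>n\<close>.
\<close>

lemma tendsto_of_small_plus_geometric:
  fixes x :: "nat \<Rightarrow> real"
  assumes "\<And>\<epsilon>. \<epsilon> > 0 \<Longrightarrow> \<exists>K. \<forall>n. \<bar>x n - l\<bar> \<le> \<epsilon> * C + K * (1 / 2) ^ n"
  shows "x \<longlonglongrightarrow> l"
proof (rule LIMSEQ_I)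
  fix r :: real assume r: "0 < r"
  define \<epsilon> where "\<epsilon> = r / (2 * (\<bar>C\<bar> + 1))"
  have \<epsilon>: "\<epsilon> > 0" unfolding \<epsilon>_def using r by (simp add: add_nonneg_pos)
  have "\<epsilon> * C \<le> \<epsilon> * (\<bar>C\<bar> + 1)" using \<epsilon> by (intro mult_left_mono) auto
  also have "\<dots> = r / 2" unfolding \<epsilon>_def by (simp add: field_simps)
  finally have \<epsilon>C: "\<epsilon> * C \<le> r / 2" .
  obtain K where K: "\<And>n. \<bar>x n - l\<bar> \<le> \<epsilon> * C + K * (1 / 2) ^ n" using assms[OF \<epsilon>] by blast
  have "(\<lambda>n. K * (1 / 2) ^ n) \<longlonglongrightarrow> K * 0"
    by (intro tendsto_mult tendsto_const LIMSEQ_power_zero) simp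
  then have "\<forall>\<^sub>F n in sequentially. K * (1 / 2) ^ n < r / 2"
    using r by (intro order_tendstoD(2)[where a = "r / 2"]) auto
  then have "\<forall>\<^sub>F n in sequentially. norm (x n - l) < r"
  proof eventually_elim
    case (elim n)
    then show ?case using K[of n] \<epsilon>C by simp
  qed
  then show "\<exists>no. \<forall>n\<ge>no. norm (x n - l) < r" by (simp add: eventually_sequentially)
qed

lemma step_fun_measurable [measurable]: "step_fun xs \<in> borel_measurable borel"
proof (induction xs)
  case (Cons x xs)
  obtain a l r where x: "x = (a, l, r)" by (cases x)
  have "step_fun (x # xs) = (\<lambda>s. a * indicator {l<..r} s + step_fun xs s)"
    by (auto simp: step_fun_def x)
  then show ?case using Cons by simp
qed (simp add: step_fun_def[abs_def])

lemma step_fun_integrable: "integrable lborel (step_fun xs)"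
proof (induction xs)
  case (Cons x xs)
  obtain a l r where x: "x = (a, l, r)" by (cases x)
  have "step_fun (x # xs) = (\<lambda>s. a * indicator {l<..r} s + step_fun xs s)"
    by (auto simp: step_fun_def x)
  moreover have "integrable lborel (\<lambda>s. a * indicator {l<..r} s)"
    by (cases "l \<le> r") (auto intro!: integrable_mult_right integrable_real_indicator)
  ultimately show ?case using Cons by simp
qed (simp add: step_fun_def[abs_def])

lemma step_fun_bounded: "\<bar>step_fun xs s\<bar> \<le> (\<Sum>(a, l, r)\<leftarrow>xs. \<bar>a\<bar>)"
proof (induction xs)
  case (Cons x xs)
  obtain a l r where x: "x = (a, l, r)" by (cases x)
  have "\<bar>a * indicator {l<..r} s\<bar> \<le> \<bar>a\<bar>" by (simp add: indicator_def)
  then show ?case using Cons by (simp add: step_fun_def x)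
qed (simp add: step_fun_def)

lemma step_fun_square_integrable: "integrable lborel (\<lambda>s. (step_fun xs s)\<^sup>2)"
proof (rule Bochner_Integration.integrable_bound)
  let ?A = "\<Sum>(a, l, r)\<leftarrow>xs. \<bar>a\<bar>"
  show "integrable lborel (\<lambda>s. ?A * step_fun xs s)" by (intro integrable_mult_right step_fun_integrable)
  show "AE s in lborel. norm ((step_fun xs s)\<^sup>2) \<le> norm (?A * step_fun xs s)"
  proof (rule AE_I2)
    fix s
    have "\<bar>step_fun xs s\<bar> * \<bar>step_fun xs s\<bar> \<le> ?A * \<bar>step_fun xs s\<bar>"
      by (intro mult_right_mono step_fun_bounded) simp
    also have "\<dots> \<le> \<bar>?A\<bar> * \<bar>step_fun xs s\<bar>" by (intro mult_right_mono) auto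
    finally show "norm ((step_fun xs s)\<^sup>2) \<le> norm (?A * step_fun xs s)"
      by (simp add: power2_eq_square abs_mult)
  qed
qed simp

lemma step_fun_negative: "nonneg_steps xs \<Longrightarrow> s < 0 \<Longrightarrow> step_fun xs s = 0"
proof (induction xs)
  case (Cons x xs)
  obtain a l r where x: "x = (a, l, r)" by (cases x)
  show ?case using Cons by (auto simp: step_fun_def x nonneg_steps_def)
qed (simp add: step_fun_def)

lemma measurable_halfline [measurable (raw)]:
  "f \<in> borel_measurable borel \<Longrightarrow> f \<in> borel_measurable lebesgue_halfline"
  by (intro measurable_restrict_space1 measurable_completion) simp

lemma integral_step_square_halfline:
  assumes xs: "nonneg_steps xs"
  shows "integrable lebesgue_halfline (\<lambda>s. (step_fun xs s)\<^sup>2)"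
    and "(LINT s|lebesgue_halfline. (step_fun xs s)\<^sup>2) = step_energy xs"
proof -
  have eq: "indicator {0..} s *\<^sub>R (step_fun xs s)\<^sup>2 = (step_fun xs s)\<^sup>2" for s
    using step_fun_negative[OF xs, of s] by (cases "0 \<le> s") auto
  have "integrable lebesgue (\<lambda>s. (step_fun xs s)\<^sup>2)"
    using step_fun_square_integrable[of xs] by (simp add: integrable_completion)
  then show "integrable lebesgue_halfline (\<lambda>s. (step_fun xs s)\<^sup>2)"
    by (subst integrable_restrict_space) (simp_all only: eq, auto)
  show "(LINT s|lebesgue_halfline. (step_fun xs s)\<^sup>2) = step_energy xs"
    unfolding step_energy_def
    by (subst integral_restrict_space) (auto simp only: eq integral_completion, auto simp: integral_completion)
qed

lemma integral_initial_interval: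
  fixes f :: "real \<Rightarrow> real"
  shows "(LINT s|lebesgue_on {0..u}. f s) = (LINT s|lebesgue_halfline. indicator {0..u} s * f s)"
    and "integrable (lebesgue_on {0..u}) f \<longleftrightarrow> integrable lebesgue_halfline (\<lambda>s. indicator {0..u} s * f s)"
proof -
  have eq: "indicator {0..} s *\<^sub>R (indicator {0..u} s * f s) = indicator {0..u} s *\<^sub>R f s" for s
    by (auto split: split_indicator)
  show "(LINT s|lebesgue_on {0..u}. f s) = (LINT s|lebesgue_halfline. indicator {0..u} s * f s)"
    by (subst (1 2) integral_restrict_space) (simp_all only: eq, auto)
  show "integrable (lebesgue_on {0..u}) f \<longleftrightarrow> integrable lebesgue_halfline (\<lambda>s. indicator {0..u} s * f s)"
    by (subst (1 2) integrable_restrict_space) (simp_all only: eq, auto)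
qed

lemma step_drift_eq: "step_drift xs u = (LINT s|lebesgue_halfline. indicator {0..u} s * step_fun xs s)"
proof -
  have eq: "indicator {0..} s *\<^sub>R (indicator {0..u} s * step_fun xs s) = indicator {0..u} s * step_fun xs s" for s
    by (auto split: split_indicator)
  show ?thesis
    unfolding step_drift_def
    by (subst integral_restrict_space) (auto simp only: eq, auto simp: integral_completion)
qed

lemma square_integrable_diff:
  assumes f: "f \<in> borel_measurable N" "integrable N (\<lambda>s. (f s)\<^sup>2 :: real)"
    and g: "g \<in> borel_measurable N" "integrable N (\<lambda>s. (g s)\<^sup>2 :: real)"
  shows "integrable N (\<lambda>s. (f s - g s)\<^sup>2)"
proof (rule Bochner_Integration.integrable_bound)
  show "integrable N (\<lambda>s. 2 * (f s)\<^sup>2 + 2 * (g s)\<^sup>2)" using f g by simp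
  have "(x - y)\<^sup>2 \<le> 2 * x\<^sup>2 + 2 * y\<^sup>2" for x y :: real
    using zero_le_power2[of "x + y"] by (simp add: power2_eq_square algebra_simps)
  then show "AE s in N. norm ((f s - g s)\<^sup>2) \<le> norm (2 * (f s)\<^sup>2 + 2 * (g s)\<^sup>2)" by simp
qed (use f(1) g(1) in simp)

lemma abs_le_eps_plus_square:
  fixes x :: real
  assumes "\<epsilon> > 0"
  shows "\<bar>x\<bar> \<le> \<epsilon> + x\<^sup>2 / \<epsilon>"
proof (cases "\<bar>x\<bar> \<le> \<epsilon>")
  case False
  then have "\<epsilon> * \<bar>x\<bar> \<le> \<bar>x\<bar> * \<bar>x\<bar>" using assms by (intro mult_right_mono) auto
  then have "\<bar>x\<bar> \<le> x\<^sup>2 / \<epsilon>" using assms by (simp add: field_simps power2_eq_square)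
  then show ?thesis using assms by simp
qed (use assms in \<open>simp add: add_increasing2\<close>)

lemma L2_halfline_integrable_initial:
  assumes f: "f \<in> L2_halfline"
  shows "integrable lebesgue_halfline (\<lambda>s. indicator {0..u} s * f s)"
proof (rule Bochner_Integration.integrable_bound)
  have fm[measurable]: "f \<in> borel_measurable lebesgue_halfline"
    and fi: "integrable lebesgue_halfline (\<lambda>s. (f s)\<^sup>2)"
    using f unfolding L2_halfline_def by auto
  have "integrable (lebesgue_on {0..u}) (\<lambda>s. 1 :: real)" by (simp add: integrable_restrict_space)
  then have "integrable lebesgue_halfline (\<lambda>s. indicator {0..u} s :: real)"
    unfolding integral_initial_interval(2) by simp
  then show "integrable lebesgue_halfline (\<lambda>s. indicator {0..u} s + (f s)\<^sup>2)" using fi by simp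
  show "AE s in lebesgue_halfline. norm (indicator {0..u} s * f s) \<le> norm (indicator {0..u} s + (f s)\<^sup>2)"
    using abs_le_eps_plus_square[of 1 "f _"] by (intro AE_I2) (auto split: split_indicator)
  show "(\<lambda>s. indicator {0..u} s * f s) \<in> borel_measurable lebesgue_halfline" by simp
qed

context
  fixes g :: "real \<Rightarrow> real" and \<phi> :: "nat \<Rightarrow> (real \<times> real \<times> real) list"
  assumes g: "g \<in> L2_halfline" and \<phi>: "\<And>n. nonneg_steps (\<phi> n)"
    and approx: "\<And>n. (\<integral>\<^sup>+ s. ennreal ((g s - step_fun (\<phi> n) s)\<^sup>2) \<partial>lebesgue_halfline) \<le> ennreal ((1 / 2) ^ n)"
begin

lemma approx_integrable: "integrable lebesgue_halfline (\<lambda>s. (g s - step_fun (\<phi> n) s)\<^sup>2)"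
  using g integral_step_square_halfline(1)[OF \<phi>] unfolding L2_halfline_def
  by (intro square_integrable_diff) auto

lemma approx_integral: "(LINT s|lebesgue_halfline. (g s - step_fun (\<phi> n) s)\<^sup>2) \<le> (1 / 2) ^ n"
proof -
  have "ennreal (LINT s|lebesgue_halfline. (g s - step_fun (\<phi> n) s)\<^sup>2) \<le> ennreal ((1 / 2) ^ n)"
    using approx[of n] by (subst nn_integral_eq_integral[symmetric]) (auto intro: approx_integrable)
  then show ?thesis by simp
qed

lemma step_energy_tendsto: "(\<lambda>n. step_energy (\<phi> n)) \<longlonglongrightarrow> (LINT s|lebesgue_halfline. (g s)\<^sup>2)"
proof (rule tendsto_of_small_plus_geometric[where C = "LINT s|lebesgue_halfline. (g s)\<^sup>2"])
  fix \<epsilon> :: real assume \<epsilon>: "\<epsilon> > 0"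
  have gi: "integrable lebesgue_halfline (\<lambda>s. (g s)\<^sup>2)" using g unfolding L2_halfline_def by auto
  have pt: "\<bar>y\<^sup>2 - x\<^sup>2\<bar> \<le> \<epsilon> * x\<^sup>2 + (1 + 1 / \<epsilon>) * (x - y)\<^sup>2" for x y :: real
  proof -
    have "0 \<le> (\<epsilon> * \<bar>x\<bar> - \<bar>x - y\<bar>)\<^sup>2 / \<epsilon>" using \<epsilon> by simp
    also have "\<dots> = \<epsilon> * x\<^sup>2 + (x - y)\<^sup>2 / \<epsilon> - 2 * (\<bar>x\<bar> * \<bar>x - y\<bar>)"
      using \<epsilon> by (simp add: power2_diff power_mult_distrib field_simps) (simp add: power2_eq_square)
    finally have "2 * (\<bar>x\<bar> * \<bar>x - y\<bar>) \<le> \<epsilon> * x\<^sup>2 + (x - y)\<^sup>2 / \<epsilon>" by simp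
    moreover have "y\<^sup>2 - x\<^sup>2 = (x - y)\<^sup>2 - 2 * (x * (x - y))" by (simp add: power2_eq_square algebra_simps)
    then have "\<bar>y\<^sup>2 - x\<^sup>2\<bar> \<le> (x - y)\<^sup>2 + 2 * (\<bar>x\<bar> * \<bar>x - y\<bar>)"
      using abs_triangle_ineq4[of "(x - y)\<^sup>2" "2 * (x * (x - y))"] by (simp add: abs_mult)
    ultimately show ?thesis by (simp add: distrib_right)
  qed
  have "\<bar>step_energy (\<phi> n) - (LINT s|lebesgue_halfline. (g s)\<^sup>2)\<bar>
      \<le> \<epsilon> * (LINT s|lebesgue_halfline. (g s)\<^sup>2) + (1 + 1 / \<epsilon>) * (1 / 2) ^ n" for n
  proof -
    note pi = integral_step_square_halfline[OF \<phi>[of n]]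
    have "\<bar>step_energy (\<phi> n) - (LINT s|lebesgue_halfline. (g s)\<^sup>2)\<bar>
        = \<bar>LINT s|lebesgue_halfline. (step_fun (\<phi> n) s)\<^sup>2 - (g s)\<^sup>2\<bar>"
      using pi gi by simp
    also have "\<dots> \<le> (LINT s|lebesgue_halfline. \<bar>(step_fun (\<phi> n) s)\<^sup>2 - (g s)\<^sup>2\<bar>)"
      by (rule integral_abs_bound)
    also have "\<dots> \<le> (LINT s|lebesgue_halfline. \<epsilon> * (g s)\<^sup>2 + (1 + 1 / \<epsilon>) * (g s - step_fun (\<phi> n) s)\<^sup>2)"
      using pi gi approx_integrable[of n] by (intro integral_mono pt) auto
    also have "\<dots> = \<epsilon> * (LINT s|lebesgue_halfline. (g s)\<^sup>2)
        + (1 + 1 / \<epsilon>) * (LINT s|lebesgue_halfline. (g s - step_fun (\<phi> n) s)\<^sup>2)"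
      using gi approx_integrable[of n] by simp
    also have "\<dots> \<le> \<epsilon> * (LINT s|lebesgue_halfline. (g s)\<^sup>2) + (1 + 1 / \<epsilon>) * (1 / 2) ^ n"
      using approx_integral[of n] \<epsilon> by (intro add_left_mono mult_left_mono) auto
    finally show ?thesis .
  qed
  then show "\<exists>K. \<forall>n. \<bar>step_energy (\<phi> n) - (LINT s|lebesgue_halfline. (g s)\<^sup>2)\<bar>
      \<le> \<epsilon> * (LINT s|lebesgue_halfline. (g s)\<^sup>2) + K * (1 / 2) ^ n" by blast
qed

lemma step_drift_tendsto:
  assumes u: "0 \<le> u"
  shows "(\<lambda>n. step_drift (\<phi> n) u) \<longlonglongrightarrow> (LINT s|lebesgue_on {0..u}. g s)"
proof (rule tendsto_of_small_plus_geometric[where C = u])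
  fix \<epsilon> :: real assume \<epsilon>: "\<epsilon> > 0"
  have one: "integrable lebesgue_halfline (\<lambda>s. indicator {0..u} s :: real)"
    using integral_initial_interval(2)[of u "\<lambda>_. 1"] by (simp add: integrable_restrict_space)
  have one': "(LINT s|lebesgue_halfline. indicator {0..u} s) = u"
    using integral_initial_interval(1)[of u "\<lambda>_. 1"] u by (simp add: measure_restrict_space)
  have "step_fun xs \<in> L2_halfline" if "nonneg_steps xs" for xs
    using integral_step_square_halfline(1)[OF that] unfolding L2_halfline_def by simp
  note int = L2_halfline_integrable_initial[OF this[OF \<phi>], of u] L2_halfline_integrable_initial[OF g, of u]
  have "\<bar>step_drift (\<phi> n) u - (LINT s|lebesgue_on {0..u}. g s)\<bar> \<le> \<epsilon> * u + 1 / \<epsilon> * (1 / 2) ^ n" for n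
  proof -
    have "\<bar>step_drift (\<phi> n) u - (LINT s|lebesgue_on {0..u}. g s)\<bar>
        = \<bar>LINT s|lebesgue_halfline. indicator {0..u} s * step_fun (\<phi> n) s - indicator {0..u} s * g s\<bar>"
      unfolding step_drift_eq integral_initial_interval(1) using int by simp
    also have "\<dots> \<le> (LINT s|lebesgue_halfline. \<bar>indicator {0..u} s * step_fun (\<phi> n) s - indicator {0..u} s * g s\<bar>)"
      by (rule integral_abs_bound)
    also have "\<dots> \<le> (LINT s|lebesgue_halfline. \<epsilon> * indicator {0..u} s + 1 / \<epsilon> * (g s - step_fun (\<phi> n) s)\<^sup>2)"
    proof (rule integral_mono)
      fix s
      show "\<bar>indicator {0..u} s * step_fun (\<phi> n) s - indicator {0..u} s * g s\<bar>
          \<le> \<epsilon> * indicator {0..u} s + 1 / \<epsilon> * (g s - step_fun (\<phi> n) s)\<^sup>2"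
        using abs_le_eps_plus_square[OF \<epsilon>, of "g s - step_fun (\<phi> n) s"] \<epsilon>
        by (auto split: split_indicator simp: abs_minus_commute)
    qed (use int one approx_integrable[of n] in auto)
    also have "\<dots> = \<epsilon> * u + 1 / \<epsilon> * (LINT s|lebesgue_halfline. (g s - step_fun (\<phi> n) s)\<^sup>2)"
      using one one' approx_integrable[of n] by simp
    also have "\<dots> \<le> \<epsilon> * u + 1 / \<epsilon> * (1 / 2) ^ n"
      using approx_integral[of n] \<epsilon> by (intro add_left_mono mult_left_mono) auto
    finally show ?thesis .
  qed
  then show "\<exists>K. \<forall>n. \<bar>step_drift (\<phi> n) u - (LINT s|lebesgue_on {0..u}. g s)\<bar> \<le> \<epsilon> * u + K * (1 / 2) ^ n"
    by blast
qed

end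

text \<open>
  Terms that are far enough out in the defining sequence make the errors summable, as almost
  sure convergence requires.
\<close>

lemma wiener_integral_fast_steps:
  assumes "wiener_integral M B f J"
  shows "\<exists>\<phi>. \<forall>n. nonneg_steps (\<phi> n) \<and>
    (\<integral>\<^sup>+ s. ennreal ((f s - step_fun (\<phi> n) s)\<^sup>2) \<partial>lebesgue_halfline) \<le> ennreal ((1 / 2) ^ n) \<and>
    (\<integral>\<^sup>+ \<omega>. ennreal ((J \<omega> - step_integral B (\<phi> n) \<omega>)\<^sup>2) \<partial>M) \<le> ennreal ((1 / 2) ^ n)"
proof -
  obtain \<psi> where \<psi>: "\<And>n. nonneg_steps (\<psi> n)"
      "(\<lambda>n. \<integral>\<^sup>+ s. ennreal ((f s - step_fun (\<psi> n) s)\<^sup>2) \<partial>lebesgue_halfline) \<longlonglongrightarrow> 0"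
      "(\<lambda>n. \<integral>\<^sup>+ \<omega>. ennreal ((J \<omega> - step_integral B (\<psi> n) \<omega>)\<^sup>2) \<partial>M) \<longlonglongrightarrow> 0"
    using assms unfolding wiener_integral_def nonneg_steps_def by blast
  have "\<exists>m. (\<integral>\<^sup>+ s. ennreal ((f s - step_fun (\<psi> m) s)\<^sup>2) \<partial>lebesgue_halfline) \<le> ennreal ((1 / 2) ^ n) \<and>
    (\<integral>\<^sup>+ \<omega>. ennreal ((J \<omega> - step_integral B (\<psi> m) \<omega>)\<^sup>2) \<partial>M) \<le> ennreal ((1 / 2) ^ n)" for n :: nat
  proof -
    have p: "ennreal ((1 / 2) ^ n) > 0" by simp
    have "\<forall>\<^sub>F m in sequentially. (\<integral>\<^sup>+ s. ennreal ((f s - step_fun (\<psi> m) s)\<^sup>2) \<partial>lebesgue_halfline) < ennreal ((1 / 2) ^ n) \<and>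
      (\<integral>\<^sup>+ \<omega>. ennreal ((J \<omega> - step_integral B (\<psi> m) \<omega>)\<^sup>2) \<partial>M) < ennreal ((1 / 2) ^ n)"
      by (intro eventually_conj order_tendstoD(2)[OF \<psi>(2) p] order_tendstoD(2)[OF \<psi>(3) p])
    then show ?thesis
      using eventually_happens[of _ sequentially] by (fastforce intro: less_imp_le)
  qed
  then have "\<forall>n. \<exists>m. (\<integral>\<^sup>+ s. ennreal ((f s - step_fun (\<psi> m) s)\<^sup>2) \<partial>lebesgue_halfline) \<le> ennreal ((1 / 2) ^ n) \<and>
    (\<integral>\<^sup>+ \<omega>. ennreal ((J \<omega> - step_integral B (\<psi> m) \<omega>)\<^sup>2) \<partial>M) \<le> ennreal ((1 / 2) ^ n)" by (rule allI)
  from choice[OF this] obtain m where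
    m: "\<forall>n. (\<integral>\<^sup>+ s. ennreal ((f s - step_fun (\<psi> (m n)) s)\<^sup>2) \<partial>lebesgue_halfline) \<le> ennreal ((1 / 2) ^ n) \<and>
    (\<integral>\<^sup>+ \<omega>. ennreal ((J \<omega> - step_integral B (\<psi> (m n)) \<omega>)\<^sup>2) \<partial>M) \<le> ennreal ((1 / 2) ^ n)" ..
  show ?thesis by (rule exI[of _ "\<lambda>n. \<psi> (m n)"]) (use \<psi>(1) m in blast)
qed

lemma ennreal_square_triangle:
  fixes x y z :: real
  shows "ennreal ((x - z)\<^sup>2) \<le> 2 * ennreal ((x - y)\<^sup>2) + 2 * ennreal ((y - z)\<^sup>2)"
proof -
  have "(x - z)\<^sup>2 \<le> 2 * (x - y)\<^sup>2 + 2 * (y - z)\<^sup>2"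
    using zero_le_power2[of "x - y - (y - z)"] by (simp add: power2_eq_square algebra_simps)
  then have "ennreal ((x - z)\<^sup>2) \<le> ennreal (2 * (x - y)\<^sup>2 + 2 * (y - z)\<^sup>2)" by (rule ennreal_leI)
  then show ?thesis by (simp add: ennreal_mult)
qed

context brownian_motion
begin

text \<open>
  Any two step approximations of the integrand have nearby integrals, so along every
  sufficiently fast approximation the step integrals converge to the Wiener integral almost
  surely, not only along the sequence that defines it.
\<close>

lemma wiener_integral_AE_limit:
  assumes J: "wiener_integral M B f J" and \<phi>: "\<And>n. nonneg_steps (\<phi> n)"
    and approx: "\<And>n. (\<integral>\<^sup>+ s. ennreal ((f s - step_fun (\<phi> n) s)\<^sup>2) \<partial>lebesgue_halfline) \<le> ennreal ((1 / 2) ^ n)"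
  shows "AE \<omega> in M. (\<lambda>n. step_integral B (\<phi> n) \<omega>) \<longlonglongrightarrow> J \<omega>"
proof -
  have Jm[measurable]: "J \<in> borel_measurable M" and f: "f \<in> L2_halfline"
    using J unfolding wiener_integral_def by auto
  have fm[measurable]: "f \<in> borel_measurable lebesgue_halfline" using f unfolding L2_halfline_def by auto
  obtain \<psi> where \<psi>: "\<And>n. nonneg_steps (\<psi> n)"
    "\<And>n. (\<integral>\<^sup>+ s. ennreal ((f s - step_fun (\<psi> n) s)\<^sup>2) \<partial>lebesgue_halfline) \<le> ennreal ((1 / 2) ^ n)"
    "\<And>n. (\<integral>\<^sup>+ \<omega>. ennreal ((J \<omega> - step_integral B (\<psi> n) \<omega>)\<^sup>2) \<partial>M) \<le> ennreal ((1 / 2) ^ n)"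
    using wiener_integral_fast_steps[OF J] by blast
  have [measurable]: "step_integral B (\<phi> n) \<in> borel_measurable M" "step_integral B (\<psi> n) \<in> borel_measurable M" for n
    by (intro step_integral_measurable \<phi> \<psi>)+
  have "(\<integral>\<^sup>+ \<omega>. ennreal ((J \<omega> - step_integral B (\<phi> n) \<omega>)\<^sup>2) \<partial>M) \<le> ennreal (18 * (1 / 2) ^ n)" for n
  proof -
    \<comment> \<open>The energy of the difference is at most \<open>4 * (1 / 2) ^ n\<close>, which yields the factor
      \<open>18 = 2 + 2 * (2 * 4)\<close>.\<close>
    define \<delta> where "\<delta> = \<psi> n @ scale_steps (- 1) (\<phi> n)"
    have \<delta>: "nonneg_steps \<delta>" unfolding \<delta>_def by (intro nonneg_steps_append nonneg_steps_scale \<phi> \<psi>)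
    have \<delta>I: "step_integral B \<delta> \<omega> = step_integral B (\<psi> n) \<omega> - step_integral B (\<phi> n) \<omega>" for \<omega>
      unfolding \<delta>_def by (simp add: step_integral_append step_integral_scale)
    have \<delta>f: "step_fun \<delta> s = step_fun (\<psi> n) s - step_fun (\<phi> n) s" for s
      unfolding \<delta>_def by (simp add: step_fun_append step_fun_scale)
    have "ennreal (step_energy \<delta>) = (\<integral>\<^sup>+ s. ennreal ((step_fun (\<psi> n) s - step_fun (\<phi> n) s)\<^sup>2) \<partial>lebesgue_halfline)"
      using integral_step_square_halfline[OF \<delta>] by (subst nn_integral_eq_integral) (auto simp: \<delta>f)
    also have "\<dots> \<le> (\<integral>\<^sup>+ s. 2 * ennreal ((step_fun (\<psi> n) s - f s)\<^sup>2) + 2 * ennreal ((f s - step_fun (\<phi> n) s)\<^sup>2) \<partial>lebesgue_halfline)"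
      by (intro nn_integral_mono ennreal_square_triangle)
    also have "\<dots> = 2 * (\<integral>\<^sup>+ s. ennreal ((f s - step_fun (\<psi> n) s)\<^sup>2) \<partial>lebesgue_halfline)
        + 2 * (\<integral>\<^sup>+ s. ennreal ((f s - step_fun (\<phi> n) s)\<^sup>2) \<partial>lebesgue_halfline)"
      by (subst nn_integral_add) (auto simp: nn_integral_cmult power2_commute)
    also have "\<dots> \<le> 2 * ennreal ((1 / 2) ^ n) + 2 * ennreal ((1 / 2) ^ n)"
      by (intro add_mono mult_left_mono approx \<psi>) auto
    also have "\<dots> = ennreal (2 * (1 / 2) ^ n + 2 * (1 / 2) ^ n)"
      by (subst ennreal_plus) (auto simp: ennreal_mult simp del: ennreal_plus)
    finally have E: "step_energy \<delta> \<le> 4 * (1 / 2) ^ n" by simp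
    have "(\<integral>\<^sup>+ \<omega>. ennreal ((J \<omega> - step_integral B (\<phi> n) \<omega>)\<^sup>2) \<partial>M)
        \<le> (\<integral>\<^sup>+ \<omega>. 2 * ennreal ((J \<omega> - step_integral B (\<psi> n) \<omega>)\<^sup>2) + 2 * ennreal ((step_integral B \<delta> \<omega>)\<^sup>2) \<partial>M)"
      unfolding \<delta>I by (intro nn_integral_mono ennreal_square_triangle)
    also have "\<dots> = 2 * (\<integral>\<^sup>+ \<omega>. ennreal ((J \<omega> - step_integral B (\<psi> n) \<omega>)\<^sup>2) \<partial>M)
        + 2 * (\<integral>\<^sup>+ \<omega>. ennreal ((step_integral B \<delta> \<omega>)\<^sup>2) \<partial>M)"
      unfolding \<delta>I by (subst nn_integral_add) (auto simp: nn_integral_cmult)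
    also have "\<dots> \<le> 2 * ennreal ((1 / 2) ^ n) + 2 * ennreal (2 * step_energy \<delta>)"
      by (intro add_mono mult_left_mono \<psi> step_integral_second_moment \<delta>) auto
    also have "\<dots> = ennreal (2 * (1 / 2) ^ n + 2 * (2 * step_energy \<delta>))"
      using step_energy_nonneg[of \<delta>] by (simp add: ennreal_mult)
    also have "\<dots> \<le> ennreal (18 * (1 / 2) ^ n)"
      using E by (intro ennreal_leI) simp
    finally show ?thesis .
  qed
  then have "AE \<omega> in M. (\<lambda>n. J \<omega> - step_integral B (\<phi> n) \<omega>) \<longlonglongrightarrow> 0"
    by (intro AE_tendsto_zero_of_square_bound[where C = 18]) auto
  then show ?thesis
  proof eventually_elim
    case (elim \<omega>)
    then have "(\<lambda>n. J \<omega> - (J \<omega> - step_integral B (\<phi> n) \<omega>)) \<longlonglongrightarrow> J \<omega> - 0"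
      by (intro tendsto_diff tendsto_const)
    then show ?case by simp
  qed
qed

lemma no_atoms:
  assumes "0 < s"
  shows "AE \<omega> in M. B s \<omega> \<noteq> x"
proof -
  note D = increment_distributed[OF order_refl assms]
  have "emeasure M ((\<lambda>\<omega>. B s \<omega> - B 0 \<omega>) -` {x} \<inter> space M)
      = (\<integral>\<^sup>+ y. ennreal (normal_density 0 (sqrt (s - 0)) y) * indicator {x} y \<partial>lborel)"
    by (rule distributed_emeasure[OF D]) simp
  also have "\<dots> = 0"
    by (subst nn_integral_0_iff_AE) (use AE_lborel_singleton[of x] in \<open>auto elim!: eventually_mono\<close>)
  also have "(\<lambda>\<omega>. B s \<omega> - B 0 \<omega>) -` {x} \<inter> space M = {\<omega> \<in> space M. B s \<omega> = x}"
    using B_0 by auto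
  finally have "emeasure M {\<omega> \<in> space M. B s \<omega> = x} = 0" .
  moreover have "{\<omega> \<in> space M. B s \<omega> = x} \<in> sets M"
    using assms by (intro borel_measurable_eq B_measurable) auto
  ultimately show ?thesis by (intro AE_I[of _ _ "{\<omega> \<in> space M. B s \<omega> = x}"]) auto
qed

text \<open>
  Along fast approximating step functions the densities \<open>Dn n\<close> converge almost surely. Fatou's
  lemma on the event and on its complement gives one inequality each. Their sum is an equality because the limit density still has
  mean 1: the second moments of the \<open>Dn n\<close> are bounded, so no mass escapes.
\<close>

theorem cameron_martin_cylinders:
  fixes s :: "'i \<Rightarrow> real"
  assumes J: "wiener_integral M B g J" and I: "finite I" and s: "\<And>i. i \<in> I \<Longrightarrow> 0 \<le> s i"
  shows "(\<integral>\<^sup>+ \<omega>. ennreal (exp (J \<omega> - (LINT x|lebesgue_halfline. (g x)\<^sup>2) / 2)) *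
            indicator {\<omega>. \<forall>i\<in>I. B (s i) \<omega> \<le> c i} \<omega> \<partial>M)
       = emeasure M {\<omega> \<in> space M. \<forall>i\<in>I. B (s i) \<omega> + (LINT x|lebesgue_on {0..s i}. g x) \<le> c i}"
proof -
  have g: "g \<in> L2_halfline" and Jm[measurable]: "J \<in> borel_measurable M"
    using J unfolding wiener_integral_def by auto
  obtain \<phi> where \<phi>: "\<And>n. nonneg_steps (\<phi> n)"
    "\<And>n. (\<integral>\<^sup>+ s. ennreal ((g s - step_fun (\<phi> n) s)\<^sup>2) \<partial>lebesgue_halfline) \<le> ennreal ((1 / 2) ^ n)"
    using wiener_integral_fast_steps[OF J] by blast
  define V where "V = (LINT x|lebesgue_halfline. (g x)\<^sup>2)"
  define D where "D \<omega> = exp (J \<omega> - V / 2)" for \<omega>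
  define Dn where "Dn n \<omega> = exp (step_integral B (\<phi> n) \<omega> - step_energy (\<phi> n) / 2)" for n \<omega>
  have [measurable]: "step_integral B (\<phi> n) \<in> borel_measurable M" for n
    by (intro step_integral_measurable \<phi>)
  have [measurable]: "D \<in> borel_measurable M" "Dn n \<in> borel_measurable M" for n
    unfolding D_def Dn_def by measurable
  have En: "(\<lambda>n. step_energy (\<phi> n)) \<longlonglongrightarrow> V"
    unfolding V_def by (rule step_energy_tendsto[OF g \<phi>])
  have Dlim: "AE \<omega> in M. (\<lambda>n. Dn n \<omega>) \<longlonglongrightarrow> D \<omega>"
    using wiener_integral_AE_limit[OF J \<phi>]
  proof eventually_elim
    case (elim \<omega>)
    then show ?case unfolding D_def Dn_def by (intro tendsto_intros En) auto
  qed
  have Dn1: "(\<integral>\<^sup>+ \<omega>. ennreal (Dn n \<omega>) \<partial>M) = 1" for n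
    unfolding Dn_def by (rule step_exponential_mean[OF \<phi>(1)])
  have Dn2: "(\<integral>\<^sup>+ \<omega>. ennreal ((Dn n \<omega>)\<^sup>2) \<partial>M) = ennreal (exp (step_energy (\<phi> n)))" for n
  proof -
    let ?E = "step_energy (\<phi> n)"
    have "(\<integral>\<^sup>+ \<omega>. ennreal ((Dn n \<omega>)\<^sup>2) \<partial>M) = (\<integral>\<^sup>+ \<omega>. ennreal (exp (- ?E)) * ennreal (exp (2 * step_integral B (\<phi> n) \<omega>)) \<partial>M)"
      unfolding Dn_def
      by (intro nn_integral_cong) (simp add: power2_eq_square mult_exp_exp ennreal_mult[symmetric])
    also have "\<dots> = ennreal (exp (- ?E)) * ennreal (exp (2\<^sup>2 * ?E / 2))"
      by (subst nn_integral_cmult) (auto simp: step_integral_mgf[OF \<phi>(1)])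
    also have "\<dots> = ennreal (exp ?E)"
      by (simp add: ennreal_mult[symmetric] mult_exp_exp)
    finally show ?thesis .
  qed
  define A where "A = {\<omega> \<in> space M. \<forall>i\<in>I. B (s i) \<omega> \<le> c i}"
  define A' where "A' = {\<omega> \<in> space M. \<forall>i\<in>I. B (s i) \<omega> + (LINT x|lebesgue_on {0..s i}. g x) \<le> c i}"
  define An where "An n = {\<omega> \<in> space M. \<forall>i\<in>I. B (s i) \<omega> + step_drift (\<phi> n) (s i) \<le> c i}" for n
  have meas[measurable]: "A \<in> sets M" "A' \<in> sets M" "An n \<in> sets M" for n
    unfolding A_def A'_def An_def using I s
    by (intro sets.sets_Collect_finite_All borel_measurable_le borel_measurable_add B_measurable; simp)+
  have DnA: "(\<integral>\<^sup>+ \<omega>. ennreal (Dn n \<omega>) * indicator A \<omega> \<partial>M) = emeasure M (An n)" for n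
  proof -
    have "(\<integral>\<^sup>+ \<omega>. ennreal (Dn n \<omega>) * indicator A \<omega> \<partial>M)
       = (\<integral>\<^sup>+ \<omega>. ennreal (Dn n \<omega>) * indicator {\<omega>. \<forall>i\<in>I. B (s i) \<omega> \<le> c i} \<omega> \<partial>M)"
      by (intro nn_integral_cong) (auto simp: A_def indicator_def)
    then show ?thesis
      unfolding Dn_def An_def using step_cameron_martin[OF \<phi>(1) I s] by simp
  qed
  \<comment> \<open>The drifts converge, and \<open>B (s i)\<close> almost surely avoids the limiting level unless \<open>s i = 0\<close>,
    where all drifts vanish.\<close>
  have ind: "AE \<omega> in M. (\<lambda>n. indicator (An n) \<omega> :: ennreal) \<longlonglongrightarrow> indicator A' \<omega>"
  proof -
    let ?h = "\<lambda>u. LINT x|lebesgue_on {0..u}. g x"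
    have "AE \<omega> in M. \<forall>i\<in>I. 0 < s i \<longrightarrow> B (s i) \<omega> \<noteq> c i - ?h (s i)"
      using no_atoms by (subst AE_finite_all[OF I]) auto
    then show ?thesis
    proof (rule AE_mp, intro AE_I2 impI)
      fix \<omega> assume \<omega>: "\<omega> \<in> space M" and ne: "\<forall>i\<in>I. 0 < s i \<longrightarrow> B (s i) \<omega> \<noteq> c i - ?h (s i)"
      have "\<forall>\<^sub>F n in sequentially. B (s i) \<omega> + step_drift (\<phi> n) (s i) \<le> c i \<longleftrightarrow> B (s i) \<omega> + ?h (s i) \<le> c i"
        if i: "i \<in> I" for i
      proof (cases "s i = 0")
        case True
        have "(LINT x|lborel. indicator {0..0} x * step_fun (\<phi> n) x) = 0" for n
          by (intro integral_eq_zero_AE) (use AE_lborel_singleton[of "0::real"] in \<open>auto elim!: eventually_mono\<close>)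
        then have "step_drift (\<phi> n) 0 = 0" for n unfolding step_drift_def .
        moreover have "?h 0 = 0" by (intro integral_eq_zero_null_sets) auto
        ultimately show ?thesis using True by simp
      next
        case False
        then have pos: "0 < s i" using s[OF i] by simp
        have lim: "(\<lambda>n. B (s i) \<omega> + step_drift (\<phi> n) (s i)) \<longlonglongrightarrow> B (s i) \<omega> + ?h (s i)"
          by (intro tendsto_add tendsto_const step_drift_tendsto[OF g \<phi>] s i)
        consider "B (s i) \<omega> + ?h (s i) < c i" | "c i < B (s i) \<omega> + ?h (s i)"
          using ne i pos by fastforce
        then show ?thesis
        proof cases
          case 1
          show ?thesis using order_tendstoD(2)[OF lim 1] by eventually_elim (use 1 in simp)
        next
          case 2
          show ?thesis using order_tendstoD(1)[OF lim 2] by eventually_elim (use 2 in simp)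
        qed
      qed
      then have "\<forall>\<^sub>F n in sequentially. \<forall>i\<in>I. B (s i) \<omega> + step_drift (\<phi> n) (s i) \<le> c i \<longleftrightarrow> B (s i) \<omega> + ?h (s i) \<le> c i"
        by (intro eventually_ball_finite I) auto
      then have "\<forall>\<^sub>F n in sequentially. (indicator (An n) \<omega> :: ennreal) = indicator A' \<omega>"
        by eventually_elim (auto simp: An_def A'_def indicator_def)
      then show "(\<lambda>n. indicator (An n) \<omega> :: ennreal) \<longlonglongrightarrow> indicator A' \<omega>"
        by (rule tendsto_eventually)
    qed
  qed
  have lim: "(\<lambda>n. \<integral>\<^sup>+ \<omega>. indicator (An n) \<omega> \<partial>M) \<longlonglongrightarrow> (\<integral>\<^sup>+ \<omega>. indicator A' \<omega> \<partial>M)"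
    by (rule nn_integral_dominated_convergence[where w = "\<lambda>_. 1"])
       (use ind in \<open>auto simp: emeasure_space_1 split: split_indicator\<close>)
  have limc: "(\<lambda>n. \<integral>\<^sup>+ \<omega>. 1 - indicator (An n) \<omega> \<partial>M) \<longlonglongrightarrow> (\<integral>\<^sup>+ \<omega>. 1 - indicator A' \<omega> \<partial>M)"
  proof (rule nn_integral_dominated_convergence[where w = "\<lambda>_. 1"])
    show "AE \<omega> in M. (\<lambda>n. 1 - indicator (An n) \<omega> :: ennreal) \<longlonglongrightarrow> 1 - indicator A' \<omega>"
      using ind by eventually_elim (intro tendsto_diff_ennreal tendsto_const, auto simp: indicator_def split: if_splits)
  qed (auto simp: emeasure_space_1 split: split_indicator)
  have fatou: "(\<integral>\<^sup>+ \<omega>. ennreal (D \<omega>) * f \<omega> \<partial>M) \<le> r"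
    if [measurable]: "f \<in> borel_measurable M" and fr: "(\<lambda>n. \<integral>\<^sup>+ \<omega>. ennreal (Dn n \<omega>) * f \<omega> \<partial>M) \<longlonglongrightarrow> r"
      and fin: "\<And>\<omega>. f \<omega> < \<infinity>"
    for f r
  proof -
    have "(\<integral>\<^sup>+ \<omega>. ennreal (D \<omega>) * f \<omega> \<partial>M) = (\<integral>\<^sup>+ \<omega>. liminf (\<lambda>n. ennreal (Dn n \<omega>) * f \<omega>) \<partial>M)"
    proof (rule nn_integral_cong_AE, use Dlim in eventually_elim)
      case (elim \<omega>)
      then have "(\<lambda>n. ennreal (Dn n \<omega>) * f \<omega>) \<longlonglongrightarrow> ennreal (D \<omega>) * f \<omega>"
        using fin[of \<omega>] by (intro tendsto_mult_ennreal tendsto_ennrealI tendsto_const) auto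
      then show ?case by (intro lim_imp_Liminf[symmetric]) auto
    qed
    also have "\<dots> \<le> liminf (\<lambda>n. \<integral>\<^sup>+ \<omega>. ennreal (Dn n \<omega>) * f \<omega> \<partial>M)"
      by (rule nn_integral_liminf) simp
    also have "\<dots> = r" using fr by (intro lim_imp_Liminf) auto
    finally show ?thesis .
  qed
  have le1: "(\<integral>\<^sup>+ \<omega>. ennreal (D \<omega>) * indicator A \<omega> \<partial>M) \<le> emeasure M A'"
    by (rule fatou) (use lim in \<open>auto simp: DnA split: split_indicator\<close>)
  have complement: "(\<integral>\<^sup>+ \<omega>. 1 \<partial>M) = emeasure M S + (\<integral>\<^sup>+ \<omega>. 1 - indicator S \<omega> \<partial>M)" if [measurable]: "S \<in> sets M" for S
  proof -
    have "(\<integral>\<^sup>+ \<omega>. 1 \<partial>M) = (\<integral>\<^sup>+ \<omega>. indicator S \<omega> + (1 - indicator S \<omega>) \<partial>M)"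
      by (intro nn_integral_cong) (auto split: split_indicator)
    also have "\<dots> = (\<integral>\<^sup>+ \<omega>. indicator S \<omega> \<partial>M) + (\<integral>\<^sup>+ \<omega>. 1 - indicator S \<omega> \<partial>M)"
      by (rule nn_integral_add) auto
    finally show ?thesis by simp
  qed
  have DnAc: "(\<integral>\<^sup>+ \<omega>. ennreal (Dn n \<omega>) * (1 - indicator A \<omega>) \<partial>M) = (\<integral>\<^sup>+ \<omega>. 1 - indicator (An n) \<omega> \<partial>M)" for n
  proof -
    have "emeasure M (An n) + (\<integral>\<^sup>+ \<omega>. ennreal (Dn n \<omega>) * (1 - indicator A \<omega>) \<partial>M) = (\<integral>\<^sup>+ \<omega>. ennreal (Dn n \<omega>) \<partial>M)"
      unfolding DnA[symmetric]
      by (subst nn_integral_add[symmetric]) (auto intro!: nn_integral_cong split: split_indicator)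
    also have "\<dots> = (\<integral>\<^sup>+ \<omega>. 1 \<partial>M)" using Dn1 by (simp add: emeasure_space_1)
    also have "\<dots> = emeasure M (An n) + (\<integral>\<^sup>+ \<omega>. 1 - indicator (An n) \<omega> \<partial>M)"
      by (rule complement) simp
    finally show ?thesis by (simp add: ennreal_add_left_cancel)
  qed
  have le2: "(\<integral>\<^sup>+ \<omega>. ennreal (D \<omega>) * (1 - indicator A \<omega>) \<partial>M) \<le> (\<integral>\<^sup>+ \<omega>. 1 - indicator A' \<omega> \<partial>M)"
    by (rule fatou) (use limc in \<open>auto simp: DnAc split: split_indicator\<close>)
  \<comment> \<open>Truncate at \<open>K\<close>: what exceeds \<open>K\<close> has mean at most the second moment over \<open>K\<close>.\<close>
  have D1: "1 \<le> (\<integral>\<^sup>+ \<omega>. ennreal (D \<omega>) \<partial>M)"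
  proof -
    have bound: "1 \<le> (\<integral>\<^sup>+ \<omega>. ennreal (D \<omega>) \<partial>M) + ennreal (exp V / K)" if K: "K > 0" for K
    proof (rule LIMSEQ_le_const)
      have "(\<lambda>n. \<integral>\<^sup>+ \<omega>. ennreal (min (Dn n \<omega>) K) \<partial>M) \<longlonglongrightarrow> (\<integral>\<^sup>+ \<omega>. ennreal (min (D \<omega>) K) \<partial>M)"
      proof (rule nn_integral_dominated_convergence[where w = "\<lambda>_. ennreal K"])
        show "AE \<omega> in M. (\<lambda>n. ennreal (min (Dn n \<omega>) K)) \<longlonglongrightarrow> ennreal (min (D \<omega>) K)"
          using Dlim by eventually_elim (intro tendsto_ennrealI tendsto_min tendsto_const)
      qed (auto simp: emeasure_space_1 ennreal_leI)
      then have "(\<lambda>n. (\<integral>\<^sup>+ \<omega>. ennreal (min (Dn n \<omega>) K) \<partial>M) + ennreal (exp (step_energy (\<phi> n)) / K))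
          \<longlonglongrightarrow> (\<integral>\<^sup>+ \<omega>. ennreal (min (D \<omega>) K) \<partial>M) + ennreal (exp V / K)"
        using K by (intro tendsto_add tendsto_ennrealI tendsto_intros En) auto
      moreover have "1 \<le> (\<integral>\<^sup>+ \<omega>. ennreal (min (Dn n \<omega>) K) \<partial>M) + ennreal (exp (step_energy (\<phi> n)) / K)" for n
      proof -
        have pt: "ennreal x \<le> ennreal (min x K) + ennreal (1 / K) * ennreal (x\<^sup>2)" if "0 \<le> x" for x
        proof -
          have "x \<le> min x K + 1 / K * x\<^sup>2"
          proof (cases "x \<le> K")
            case False
            then have "K * x \<le> x\<^sup>2" using K by (simp add: power2_eq_square mult_right_mono)
            then have "x \<le> 1 / K * x\<^sup>2" using K by (simp add: field_simps)
            then show ?thesis using False K by simp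
          qed (use K in simp)
          then have "ennreal x \<le> ennreal (min x K + 1 / K * x\<^sup>2)" by (rule ennreal_leI)
          then show ?thesis using K that by (simp add: ennreal_mult ennreal_plus del: times_divide_eq_left)
        qed
        have "1 = (\<integral>\<^sup>+ \<omega>. ennreal (Dn n \<omega>) \<partial>M)" using Dn1 by simp
        also have "\<dots> \<le> (\<integral>\<^sup>+ \<omega>. ennreal (min (Dn n \<omega>) K) + ennreal (1 / K) * ennreal ((Dn n \<omega>)\<^sup>2) \<partial>M)"
          by (intro nn_integral_mono pt) (simp add: Dn_def)
        also have "\<dots> = (\<integral>\<^sup>+ \<omega>. ennreal (min (Dn n \<omega>) K) \<partial>M) + ennreal (1 / K) * ennreal (exp (step_energy (\<phi> n)))"
          by (subst nn_integral_add) (auto simp: nn_integral_cmult Dn2)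
        finally show ?thesis using K by (simp add: ennreal_mult[symmetric])
      qed
      moreover have "(\<integral>\<^sup>+ \<omega>. ennreal (min (D \<omega>) K) \<partial>M) + ennreal (exp V / K)
          \<le> (\<integral>\<^sup>+ \<omega>. ennreal (D \<omega>) \<partial>M) + ennreal (exp V / K)"
        by (intro add_right_mono nn_integral_mono ennreal_leI) simp
      ultimately show "(\<lambda>n. (\<integral>\<^sup>+ \<omega>. ennreal (D \<omega>) \<partial>M) + ennreal (exp V / K)) \<longlonglongrightarrow> (\<integral>\<^sup>+ \<omega>. ennreal (D \<omega>) \<partial>M) + ennreal (exp V / K)"
        and "\<exists>N. \<forall>n\<ge>N. 1 \<le> (\<integral>\<^sup>+ \<omega>. ennreal (D \<omega>) \<partial>M) + ennreal (exp V / K)"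
        by (auto intro: order_trans[OF LIMSEQ_le_const])
    qed
    have "(\<lambda>k. (\<integral>\<^sup>+ \<omega>. ennreal (D \<omega>) \<partial>M) + ennreal (exp V / real (Suc k))) \<longlonglongrightarrow> (\<integral>\<^sup>+ \<omega>. ennreal (D \<omega>) \<partial>M) + ennreal 0"
      by (intro tendsto_add tendsto_const tendsto_ennrealI LIMSEQ_Suc lim_const_over_n)
    then show ?thesis
      using bound by (intro LIMSEQ_le_const[where X = "\<lambda>k. (\<integral>\<^sup>+ \<omega>. ennreal (D \<omega>) \<partial>M) + ennreal (exp V / real (Suc k))"]) auto
  qed
  have "emeasure M A' \<le> (\<integral>\<^sup>+ \<omega>. ennreal (D \<omega>) * indicator A \<omega> \<partial>M)"
  proof -
    let ?c = "\<integral>\<^sup>+ \<omega>. 1 - indicator A' \<omega> \<partial>M"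
    have fin: "?c \<noteq> \<infinity>"
    proof -
      have "?c \<le> (\<integral>\<^sup>+ \<omega>. 1 \<partial>M)" by (intro nn_integral_mono) (auto split: split_indicator)
      then show ?thesis by (auto simp: emeasure_space_1 top_unique)
    qed
    have "?c + emeasure M A' = (\<integral>\<^sup>+ \<omega>. 1 \<partial>M)"
      using complement[of A'] by (simp add: add.commute)
    also have "\<dots> \<le> (\<integral>\<^sup>+ \<omega>. ennreal (D \<omega>) \<partial>M)" using D1 by (simp add: emeasure_space_1)
    also have "\<dots> = (\<integral>\<^sup>+ \<omega>. ennreal (D \<omega>) * (1 - indicator A \<omega>) \<partial>M) + (\<integral>\<^sup>+ \<omega>. ennreal (D \<omega>) * indicator A \<omega> \<partial>M)"
      by (subst nn_integral_add[symmetric]) (auto intro!: nn_integral_cong split: split_indicator)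
    also have "\<dots> \<le> ?c + (\<integral>\<^sup>+ \<omega>. ennreal (D \<omega>) * indicator A \<omega> \<partial>M)"
      by (intro add_right_mono le2)
    finally show ?thesis using fin by (simp add: ennreal_add_left_cancel_le)
  qed
  then have "(\<integral>\<^sup>+ \<omega>. ennreal (D \<omega>) * indicator A \<omega> \<partial>M) = emeasure M A'" using le1 by simp
  moreover have "(\<integral>\<^sup>+ \<omega>. ennreal (D \<omega>) * indicator A \<omega> \<partial>M)
       = (\<integral>\<^sup>+ \<omega>. ennreal (D \<omega>) * indicator {\<omega>. \<forall>i\<in>I. B (s i) \<omega> \<le> c i} \<omega> \<partial>M)"
    by (intro nn_integral_cong) (auto simp: A_def indicator_def)
  ultimately show ?thesis unfolding A'_def D_def V_def by simp
qed

end

section \<open>Quadratic variation\<close>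

definition dyadic_variation :: "(real \<Rightarrow> real) \<Rightarrow> real \<Rightarrow> nat \<Rightarrow> real" where
  "dyadic_variation w T n = (\<Sum>i<2 ^ n. (w (T * real (Suc i) / 2 ^ n) - w (T * real i / 2 ^ n))\<^sup>2)"

context brownian_motion
begin

lemma increment_square_moments:
  assumes s: "0 \<le> s" and st: "s < t"
  defines "Y \<equiv> \<lambda>\<omega>. (B t \<omega> - B s \<omega>)\<^sup>2 - (t - s)"
  shows "integrable M Y" "(\<integral>\<omega>. Y \<omega> \<partial>M) = 0"
    and "integrable M (\<lambda>\<omega>. (Y \<omega>)\<^sup>2)" "(\<integral>\<omega>. (Y \<omega>)\<^sup>2 \<partial>M) = 2 * (t - s)\<^sup>2"
proof -
  define d where "d = t - s"
  have d: "d > 0" unfolding d_def using st by simp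
  note D = increment_distributed[OF s st, folded d_def]
  have m: "has_bochner_integral M (\<lambda>\<omega>. (B t \<omega> - B s \<omega>) ^ (2 * k)) (fact (2 * k) / ((2 / d) ^ k * fact k))" for k
  proof -
    have "has_bochner_integral lborel (\<lambda>x. normal_density 0 (sqrt d) x * x ^ (2 * k)) (fact (2 * k) / ((2 / d) ^ k * fact k))"
      using normal_moment_even[of "sqrt d" 0 k] d by simp
    then show ?thesis
      using distributed_integrable[OF D, of "\<lambda>x. x ^ (2 * k)"] distributed_integral[OF D, of "\<lambda>x. x ^ (2 * k)"]
      by (simp add: has_bochner_integral_iff)
  qed
  have m2: "has_bochner_integral M (\<lambda>\<omega>. (B t \<omega> - B s \<omega>)\<^sup>2) d" using m[of 1] by simp
  have m4: "has_bochner_integral M (\<lambda>\<omega>. (B t \<omega> - B s \<omega>) ^ 4) (3 * d\<^sup>2)"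
  proof -
    have "fact (2 * 2) / ((2 / d) ^ 2 * fact 2) = 3 * d\<^sup>2"
      using d by (simp add: fact_numeral power2_eq_square field_simps)
    then show ?thesis using m[of 2] by simp
  qed
  have "has_bochner_integral M (\<lambda>\<omega>. (B t \<omega> - B s \<omega>)\<^sup>2 - d) (d - d)"
    by (intro has_bochner_integral_diff m2) (simp add: has_bochner_integral_iff prob_space)
  then show "integrable M Y" "(\<integral>\<omega>. Y \<omega> \<partial>M) = 0"
    unfolding Y_def d_def by (simp_all add: has_bochner_integral_iff)
  have "has_bochner_integral M (\<lambda>\<omega>. (B t \<omega> - B s \<omega>) ^ 4 - 2 * d * (B t \<omega> - B s \<omega>)\<^sup>2 + d\<^sup>2) (3 * d\<^sup>2 - 2 * d * d + d\<^sup>2)"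
    by (intro has_bochner_integral_diff has_bochner_integral_add m4 has_bochner_integral_mult_right m2)
       (simp add: has_bochner_integral_iff prob_space)
  also have "(\<lambda>\<omega>. (B t \<omega> - B s \<omega>) ^ 4 - 2 * d * (B t \<omega> - B s \<omega>)\<^sup>2 + d\<^sup>2) = (\<lambda>\<omega>. (Y \<omega>)\<^sup>2)"
  proof
    fix \<omega>
    have "x ^ 4 - 2 * d * x\<^sup>2 + d\<^sup>2 = (x\<^sup>2 - d)\<^sup>2" for x :: real
      by (simp add: power2_eq_square power4_eq_xxxx algebra_simps)
    then show "(B t \<omega> - B s \<omega>) ^ 4 - 2 * d * (B t \<omega> - B s \<omega>)\<^sup>2 + d\<^sup>2 = (Y \<omega>)\<^sup>2"
      unfolding Y_def d_def by simp
  qed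
  finally show "integrable M (\<lambda>\<omega>. (Y \<omega>)\<^sup>2)" "(\<integral>\<omega>. (Y \<omega>)\<^sup>2 \<partial>M) = 2 * (t - s)\<^sup>2"
    by (simp_all add: has_bochner_integral_iff d_def power2_eq_square)
qed

text \<open>
  The squared increments are independent with mean equal to the length of their cell, so the
  mean square error of the dyadic sum is \<open>2 * T\<^sup>2 / 2 ^ n\<close>, which is summable.
\<close>

lemma dyadic_variation_AE_tendsto:
  assumes T: "0 < T"
  shows "AE \<omega> in M. dyadic_variation (\<lambda>t. B t \<omega>) T \<longlonglongrightarrow> T"
proof -
  define t where "t n i = T * real i / 2 ^ n" for n i :: nat
  define Y where "Y n i \<omega> = (B (t n (Suc i)) \<omega> - B (t n i) \<omega>)\<^sup>2 - (t n (Suc i) - t n i)" for n i \<omega>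
  have t0: "0 \<le> t n i" for n i unfolding t_def using T by simp
  have d: "t n (Suc i) - t n i = T / 2 ^ n" for n i
    unfolding t_def by (simp add: field_simps)
  have lt: "t n i < t n (Suc i)" for n i
  proof -
    have "0 < T / 2 ^ n" using T by simp
    then show ?thesis using d[of n i] by linarith
  qed
  note Y_mom = increment_square_moments[OF t0 lt, folded Y_def]
  have indep: "indep_vars (\<lambda>_. borel) (Y n) {..<2 ^ n}" for n
    using indep_vars_compose2[OF increments_indep[of "t n" "2 ^ n"],
        of "\<lambda>i x. x\<^sup>2 - (t n (Suc i) - t n i)" "\<lambda>_. borel"] t0 less_imp_le[OF lt]
    unfolding Y_def by simp
  have cross: "integrable M (\<lambda>\<omega>. Y n i \<omega> * Y n j \<omega>)"
    "(\<integral>\<omega>. Y n i \<omega> * Y n j \<omega> \<partial>M) = (if j = i then 2 * (T / 2 ^ n)\<^sup>2 else 0)"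
    if "i < 2 ^ n" "j < 2 ^ n" for n i j
  proof -
    have "integrable M (\<lambda>\<omega>. Y n i \<omega> * Y n j \<omega>) \<and>
      (\<integral>\<omega>. Y n i \<omega> * Y n j \<omega> \<partial>M) = (if j = i then 2 * (T / 2 ^ n)\<^sup>2 else 0)"
    proof (cases "j = i")
      case True
      then show ?thesis using Y_mom(3,4)[of n i] d[of n i] by (simp add: power2_eq_square)
    next
      case False
      have ind: "indep_vars (\<lambda>_. borel) (Y n) {i, j}"
        using that by (intro indep_vars_subset[OF indep]) auto
      show ?thesis
        using indep_vars_lebesgue_integral[OF _ ind] indep_vars_integrable[OF _ ind] Y_mom(1,2) False by simp
    qed
    then show "integrable M (\<lambda>\<omega>. Y n i \<omega> * Y n j \<omega>)"
      "(\<integral>\<omega>. Y n i \<omega> * Y n j \<omega> \<partial>M) = (if j = i then 2 * (T / 2 ^ n)\<^sup>2 else 0)" by auto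
  qed
  have [measurable]: "Y n i \<in> borel_measurable M" for n i using Y_mom(1)[of n i] by auto
  have "(\<integral>\<^sup>+ \<omega>. ennreal ((\<Sum>i<2 ^ n. Y n i \<omega>)\<^sup>2) \<partial>M) \<le> ennreal (2 * T\<^sup>2 * (1 / 2) ^ n)" for n
  proof -
    have sq: "(\<Sum>i<2 ^ n. Y n i \<omega>)\<^sup>2 = (\<Sum>i<2 ^ n. \<Sum>j<2 ^ n. Y n i \<omega> * Y n j \<omega>)" for \<omega>
      by (simp add: power2_eq_square sum_product)
    have "integrable M (\<lambda>\<omega>. (\<Sum>i<2 ^ n. Y n i \<omega>)\<^sup>2)"
      unfolding sq by (intro Bochner_Integration.integrable_sum cross) auto
    then have "(\<integral>\<^sup>+ \<omega>. ennreal ((\<Sum>i<2 ^ n. Y n i \<omega>)\<^sup>2) \<partial>M) = ennreal (\<integral>\<omega>. (\<Sum>i<2 ^ n. Y n i \<omega>)\<^sup>2 \<partial>M)"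
      by (intro nn_integral_eq_integral) auto
    also have "(\<integral>\<omega>. (\<Sum>i<2 ^ n. Y n i \<omega>)\<^sup>2 \<partial>M) = (\<Sum>i<2 ^ n. \<Sum>j<2 ^ n. \<integral>\<omega>. Y n i \<omega> * Y n j \<omega> \<partial>M)"
      unfolding sq
      by (subst Bochner_Integration.integral_sum, intro Bochner_Integration.integrable_sum cross, simp, simp,
          intro sum.cong refl Bochner_Integration.integral_sum cross) auto
    also have "\<dots> = (\<Sum>i<(2::nat) ^ n. \<Sum>j<(2::nat) ^ n. if j = i then 2 * (T / 2 ^ n)\<^sup>2 else 0)"
      by (intro sum.cong refl cross) auto
    also have "\<dots> = (\<Sum>i<(2::nat) ^ n. 2 * (T / 2 ^ n)\<^sup>2)"
      by (intro sum.cong refl) (simp add: sum.delta)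
    also have "\<dots> = 2 * T\<^sup>2 * (1 / 2) ^ n"
      by (simp add: power2_eq_square field_simps)
    finally show ?thesis by simp
  qed
  then have "AE \<omega> in M. (\<lambda>n. \<Sum>i<2 ^ n. Y n i \<omega>) \<longlonglongrightarrow> 0"
    by (intro AE_tendsto_zero_of_square_bound[where C = "2 * T\<^sup>2"]) auto
  then show ?thesis
  proof eventually_elim
    case (elim \<omega>)
    have "dyadic_variation (\<lambda>t. B t \<omega>) T = (\<lambda>n. (\<Sum>i<2 ^ n. Y n i \<omega>) + T)"
    proof
      fix n
      have "(\<Sum>i<2 ^ n. Y n i \<omega>) = dyadic_variation (\<lambda>t. B t \<omega>) T n - (\<Sum>i<(2::nat) ^ n. t n (Suc i) - t n i)"
        unfolding dyadic_variation_def Y_def sum_subtractf t_def ..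
      also have "(\<Sum>i<(2::nat) ^ n. t n (Suc i) - t n i) = T" unfolding d by simp
      finally show "dyadic_variation (\<lambda>t. B t \<omega>) T n = (\<Sum>i<2 ^ n. Y n i \<omega>) + T" by simp
    qed
    moreover have "(\<lambda>n. (\<Sum>i<2 ^ n. Y n i \<omega>) + T) \<longlonglongrightarrow> 0 + T"
      by (intro tendsto_add elim tendsto_const)
    ultimately show ?case by simp
  qed
qed

end

section \<open>Time horizons in \<open>(0,\<infinity>]\<close>\<close>

lemma time_interval_ennreal: "0 \<le> T \<Longrightarrow> time_interval (ennreal T) = {0..T}"
  unfolding time_interval_def by (auto simp: ennreal_le_iff)

lemma time_interval_infinity: "time_interval \<infinity> = {0..}"
  unfolding time_interval_def by auto

lemma time_interval_cases:
  obtains "t = \<infinity>" "time_interval t = {0..}"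
  | T where "0 \<le> T" "t = ennreal T" "time_interval t = {0..T}"
  by (cases t rule: ennreal_cases) (auto simp: time_interval_ennreal time_interval_infinity[simplified])

lemma time_interval_subset: "time_interval t \<subseteq> {0..}"
  unfolding time_interval_def by auto

lemma time_interval_down: "u \<in> time_interval t \<Longrightarrow> 0 \<le> s \<Longrightarrow> s \<le> u \<Longrightarrow> s \<in> time_interval t"
  unfolding time_interval_def by (auto intro: order_trans[OF ennreal_leI])

lemma time_interval_lebesgue [measurable]: "time_interval t \<in> sets lebesgue"
  by (cases t rule: time_interval_cases) auto

lemma time_interval_mono: "s \<le> t \<Longrightarrow> time_interval s \<subseteq> time_interval t"
  unfolding time_interval_def by auto

lemma time_interval_scale:
  "s \<in> time_interval t \<Longrightarrow> 0 \<le> \<tau> \<Longrightarrow> s * \<tau> \<in> time_interval (t * ennreal \<tau>)"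
  unfolding time_interval_def by (auto simp: ennreal_mult intro: mult_right_mono)

definition cut_time :: "ennreal \<Rightarrow> real \<Rightarrow> real" where
  "cut_time t u = enn2real (min (ennreal u) t)"

lemma cut_time_nonneg: "0 \<le> cut_time t u"
  unfolding cut_time_def by simp

lemma ennreal_cut_time: "ennreal (cut_time t u) = min (ennreal u) t"
  unfolding cut_time_def by (rule ennreal_enn2real) (simp add: min_less_iff_disj)

lemma cut_time_in: "cut_time t u \<in> time_interval t"
  unfolding time_interval_def by (simp add: cut_time_nonneg ennreal_cut_time)

lemma cut_time_pos: "0 < t \<Longrightarrow> 0 < u \<Longrightarrow> 0 < cut_time t u"
  using ennreal_cut_time[of t u] cut_time_nonneg[of t u]
  by (cases "cut_time t u = 0") (auto simp: min_def split: if_splits)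

lemma cut_time_measurable [measurable]: "cut_time t \<in> borel_measurable borel"
  unfolding cut_time_def by measurable

text \<open>
  The time at which a grey path up to \<open>t\<close> has to be read in order to see the Brownian path at
  time \<open>r\<close>, or at the last time it reaches.
\<close>

lemma cut_time_scale:
  assumes \<tau>: "0 < \<tau>" and r: "0 \<le> r"
  shows "cut_time t (r / \<tau>) * \<tau> = cut_time (t * ennreal \<tau>) r"
proof -
  have e: "ennreal (r / \<tau>) * ennreal \<tau> = ennreal r"
    using assms by (simp add: ennreal_mult[symmetric])
  have "min (ennreal (r / \<tau>)) t * ennreal \<tau> = min (ennreal (r / \<tau>) * ennreal \<tau>) (t * ennreal \<tau>)"
    by (rule min_of_mono[symmetric]) (auto intro!: monoI mult_right_mono)
  then have "ennreal (cut_time t (r / \<tau>) * \<tau>) = ennreal (cut_time (t * ennreal \<tau>) r)"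
    using \<tau> by (simp add: ennreal_mult cut_time_nonneg ennreal_cut_time e)
  then show ?thesis using \<tau> by (simp add: cut_time_nonneg)
qed

definition cut_steps :: "ennreal \<Rightarrow> (real \<times> real \<times> real) list \<Rightarrow> (real \<times> real \<times> real) list" where
  "cut_steps t xs = map (\<lambda>(a, l, r). (a, cut_time t l, cut_time t r)) xs"

lemma nonneg_steps_cut: "nonneg_steps xs \<Longrightarrow> nonneg_steps (cut_steps t xs)"
  unfolding nonneg_steps_def cut_steps_def cut_time_def
  by (force intro!: enn2real_mono min.mono ennreal_leI simp: min_less_iff_disj)

lemma step_fun_cut:
  assumes "nonneg_steps xs"
  shows "step_fun (cut_steps t xs) s = step_fun xs s * indicator (time_interval t) s"
  using assms
proof (induction xs)
  case (Cons x xs)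
  obtain a l r where x: "x = (a, l, r)" by (cases x)
  have lr: "0 \<le> l" "l \<le> r" using Cons.prems x by (auto simp: nonneg_steps_def)
  have "indicator {cut_time t l<..cut_time t r} s = (indicator {l<..r} s * indicator (time_interval t) s :: real)"
  proof (cases "0 \<le> s")
    case True
    have "cut_time t l < s \<longleftrightarrow> min (ennreal l) t < ennreal s"
      unfolding ennreal_cut_time[symmetric] by (simp add: ennreal_less_iff cut_time_nonneg)
    moreover have "s \<le> cut_time t r \<longleftrightarrow> ennreal s \<le> min (ennreal r) t"
      unfolding ennreal_cut_time[symmetric] by (simp add: ennreal_le_iff cut_time_nonneg)
    ultimately have "s \<in> {cut_time t l<..cut_time t r} \<longleftrightarrow> s \<in> {l<..r} \<and> s \<in> time_interval t"
      using True lr by (auto simp: time_interval_def min_less_iff_disj ennreal_less_iff ennreal_le_iff)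
    then show ?thesis by (auto simp: indicator_def)
  next
    case False
    then have "s \<notin> {cut_time t l<..cut_time t r}" using cut_time_nonneg[of t l] by auto
    moreover have "s \<notin> time_interval t" using False unfolding time_interval_def by auto
    ultimately show ?thesis by simp
  qed
  then show ?case
    using Cons by (simp add: x cut_steps_def step_fun_def nonneg_steps_def distrib_right)
qed (simp add: cut_steps_def step_fun_def)

lemma step_integral_cut:
  "step_integral B (cut_steps t xs) \<omega> = step_integral (\<lambda>u. B (cut_time t u)) xs \<omega>"
  unfolding step_integral_def cut_steps_def by (induction xs) auto

text \<open>Cutting the integrand and the steps at the same time can only decrease the distance.\<close>

lemma cut_steps_approx:
  assumes xs: "nonneg_steps xs"
    and approx: "(\<integral>\<^sup>+ s. ennreal ((f s * indicator (time_interval \<infinity>) s - step_fun xs s)\<^sup>2) \<partial>lebesgue_halfline) \<le> C"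
  shows "(\<integral>\<^sup>+ s. ennreal ((f s * indicator (time_interval t) s - step_fun (cut_steps t xs) s)\<^sup>2) \<partial>lebesgue_halfline) \<le> C"
proof -
  have "(\<integral>\<^sup>+ s. ennreal ((f s * indicator (time_interval t) s - step_fun (cut_steps t xs) s)\<^sup>2) \<partial>lebesgue_halfline)
      \<le> (\<integral>\<^sup>+ s. ennreal ((f s * indicator (time_interval \<infinity>) s - step_fun xs s)\<^sup>2) \<partial>lebesgue_halfline)"
    by (intro nn_integral_mono)
       (auto simp: step_fun_cut[OF xs] time_interval_infinity[simplified] space_restrict_space split: split_indicator)
  then show ?thesis using approx by simp
qed

section \<open>Paths up to a horizon\<close>

definition paths_until :: "ennreal \<Rightarrow> (real \<Rightarrow> real) set" where
  "paths_until t = (\<lambda>w. restrict w (time_interval t)) ` paths"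

definition path_space :: "ennreal \<Rightarrow> (real \<Rightarrow> real) measure" where
  "path_space t = borel_measure_of (loc_unif_topology (time_interval t) (paths_until t))"

lemma restrict_paths: "w \<in> paths \<Longrightarrow> restrict w {0..} = w"
  unfolding paths_def by (auto intro: extensional_restrict)

lemma paths_until_infinity: "paths_until \<infinity> = paths"
  unfolding paths_until_def time_interval_infinity by (simp add: restrict_paths cong: image_cong)

lemma path_space_infinity: "path_space \<infinity> = path_borel"
  unfolding path_space_def path_borel_def time_interval_infinity paths_until_infinity ..

lemma path_space_ennreal: "0 \<le> T \<Longrightarrow> path_space (ennreal T) = path_borel_upto T"
  unfolding path_space_def path_borel_upto_def paths_until_def paths_upto_def
  by (simp add: time_interval_ennreal)

lemma space_path_space [simp]: "space (path_space t) = paths_until t"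
  unfolding path_space_def by simp

lemma paths_until_continuous: "v \<in> paths_until t \<Longrightarrow> continuous_on (time_interval t) v"
  unfolding paths_until_def paths_def
  using time_interval_subset[of t] by (auto intro: continuous_on_subset)

text \<open>The natural numbers exhaust an infinite horizon, and a finite horizon exhausts itself.\<close>

definition exhausting_times :: "ennreal \<Rightarrow> real set" where
  "exhausting_times t = (insert (enn2real t) (range real)) \<inter> time_interval t"

lemma exhausting_times:
  shows "countable (exhausting_times t)"
    and "R \<in> exhausting_times t \<Longrightarrow> 0 \<le> R \<and> R \<in> time_interval t"
    and "compact K \<Longrightarrow> K \<subseteq> time_interval t \<Longrightarrow> \<exists>R\<in>exhausting_times t. K \<subseteq> {0..R}"
proof -
  show "countable (exhausting_times t)" unfolding exhausting_times_def by auto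
  show "R \<in> exhausting_times t \<Longrightarrow> 0 \<le> R \<and> R \<in> time_interval t"
    unfolding exhausting_times_def using time_interval_subset[of t] by auto
  assume K: "compact K" "K \<subseteq> time_interval t"
  show "\<exists>R\<in>exhausting_times t. K \<subseteq> {0..R}"
  proof (cases t rule: time_interval_cases)
    case 1
    obtain b where b: "\<And>x. x \<in> K \<Longrightarrow> norm x \<le> b"
      using compact_imp_bounded[OF K(1)] unfolding bounded_iff by blast
    obtain n :: nat where "b \<le> real n" using real_arch_simple by blast
    then have "K \<subseteq> {0..real n}" using b K(2) 1 by force
    then show ?thesis using 1 unfolding exhausting_times_def by (intro bexI[of _ "real n"]) auto
  next
    case (2 T)
    then show ?thesis using K(2) unfolding exhausting_times_def by (intro bexI[of _ T]) auto
  qed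
qed

lemma measurable_into_path_space:
  assumes "f \<in> space M \<rightarrow> paths_until t"
    and "\<And>s. s \<in> time_interval t \<Longrightarrow> (\<lambda>\<omega>. f \<omega> s) \<in> borel_measurable M"
  shows "f \<in> measurable M (path_space t)"
  unfolding path_space_def
  by (rule measurable_into_loc_unif[OF time_interval_down paths_until_continuous exhausting_times assms])

lemma path_space_coordinate: "s \<in> time_interval t \<Longrightarrow> (\<lambda>v. v s) \<in> borel_measurable (path_space t)"
  unfolding path_space_def by (rule measurable_coordinate)

lemma path_space_measure_eqI:
  assumes "sets N1 = sets (path_space t)" "sets N2 = sets (path_space t)"
    and "emeasure N1 (paths_until t) \<noteq> \<infinity>"
    and "\<And>F c. finite F \<Longrightarrow> F \<subseteq> time_interval t \<Longrightarrow>
      emeasure N1 {w \<in> paths_until t. \<forall>s\<in>F. w s \<le> c s} = emeasure N2 {w \<in> paths_until t. \<forall>s\<in>F. w s \<le> c s}"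
  shows "N1 = N2"
  by (rule measure_eqI_half_line_cylinders[OF time_interval_down paths_until_continuous exhausting_times])
     (use assms in \<open>auto simp: path_space_def\<close>)

text \<open>
  The functions \<open>gbm\<close> and \<open>gbm_shifted\<close>, and their restrictions, are the cases of an infinite and
  of a finite horizon; \<open>h = 0\<close> gives the process without shift.
\<close>

definition grey_path :: "ennreal \<Rightarrow> (real \<Rightarrow> real) \<Rightarrow> (real \<Rightarrow> real) \<times> real \<Rightarrow> real \<Rightarrow> real" where
  "grey_path t h = (\<lambda>(w, \<tau>). \<lambda>s\<in>time_interval t. w (s * \<tau>) + h (s * \<tau>))"

lemma grey_path_apply: "s \<in> time_interval t \<Longrightarrow> grey_path t h (w, \<tau>) s = w (s * \<tau>) + h (s * \<tau>)"
  unfolding grey_path_def by simp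

lemma gbm_shifted_eq: "gbm_shifted h = grey_path \<infinity> h"
  unfolding gbm_shifted_def grey_path_def time_interval_infinity ..

lemma gbm_eq: "gbm = grey_path \<infinity> (\<lambda>_. 0)"
  unfolding gbm_def grey_path_def time_interval_infinity by simp

lemma gbm_shifted_upto_eq: "0 \<le> T \<Longrightarrow> gbm_shifted_upto T h = grey_path (ennreal T) h"
  unfolding gbm_shifted_upto_def gbm_shifted_def grey_path_def
  by (auto simp: time_interval_ennreal fun_eq_iff restrict_def)

lemma gbm_upto_eq: "0 \<le> T \<Longrightarrow> gbm_upto T = grey_path (ennreal T) (\<lambda>_. 0)"
  unfolding gbm_upto_def gbm_def grey_path_def
  by (auto simp: time_interval_ennreal fun_eq_iff restrict_def)

lemma grey_path_in_paths:
  assumes w: "w \<in> paths" and h: "continuous_on {0..} h" "h 0 = 0" and \<tau>: "0 \<le> \<tau>"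
  shows "grey_path t h (w, \<tau>) \<in> paths_until t"
proof -
  have w': "continuous_on {0..} w" "w 0 = 0" using w unfolding paths_def by auto
  define v where "v = (\<lambda>s\<in>{0..}. w (s * \<tau>) + h (s * \<tau>))"
  have cont: "continuous_on {0..} (\<lambda>s. w (s * \<tau>) + h (s * \<tau>))"
    using \<tau> by (intro continuous_on_add continuous_on_compose2[OF w'(1)] continuous_on_compose2[OF h(1)]
        continuous_intros) auto
  have "continuous_on {0..} v"
    by (rule continuous_on_eq[OF cont]) (simp add: v_def)
  then have "v \<in> paths"
    unfolding paths_def using w'(2) h(2) by (auto simp: v_def)
  moreover have "grey_path t h (w, \<tau>) = restrict v (time_interval t)"
    unfolding grey_path_def v_def using time_interval_subset[of t] by (auto simp: restrict_def fun_eq_iff)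
  ultimately show ?thesis unfolding paths_until_def by blast
qed

lemma cameron_martin_0: "cameron_martin h h' \<Longrightarrow> h 0 = 0"
  unfolding cameron_martin_def by (auto intro!: integral_eq_zero_null_sets)

lemma cameron_martin_continuous:
  assumes "cameron_martin h h'"
  shows "continuous_on {0..} h"
proof -
  have h': "h' \<in> L2_halfline" and h: "\<And>t. 0 \<le> t \<Longrightarrow> h t = (LINT s|lebesgue_on {0..t}. h' s)"
    using assms unfolding cameron_martin_def by auto
  have int: "integrable (lebesgue_on {0..t}) h'" for t
    unfolding integral_initial_interval(2) by (rule L2_halfline_integrable_initial[OF h'])
  have cont: "continuous_on {0..N} h" for N
  proof -
    have "continuous_on {0..N} (\<lambda>x. integral {0..x} h')"
      by (intro indefinite_integral_continuous_1 integrable_on_lebesgue_on int) auto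
    then show ?thesis
      by (rule continuous_on_eq) (simp add: h lebesgue_integral_eq_integral[OF int])
  qed
  show ?thesis
    unfolding continuous_on_sequentially
  proof (intro allI ballI impI)
    fix x :: "nat \<Rightarrow> real" and a assume a: "a \<in> {0..}" and x: "(\<forall>n. x n \<in> {0..}) \<and> x \<longlonglongrightarrow> a"
    have "Bseq x" using x by (auto intro: convergent_imp_Bseq convergentI)
    then obtain K where K: "\<And>n. norm (x n) \<le> K" unfolding Bseq_def by blast
    have "\<forall>n. x n \<in> {0..max K a}" using K x by (auto simp: le_max_iff_disj)
    moreover have "a \<in> {0..max K a}" using a by auto
    ultimately show "(h \<circ> x) \<longlonglongrightarrow> h a"
      using cont[of "max K a"] x unfolding continuous_on_sequentially by blast
  qed
qed

section \<open>The random time\<close>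

lemma time_law_properties:
  assumes M: "time_density \<beta> M"
  shows "prob_space (time_law M)" and "space (time_law M) = {0..}"
    and "(\<lambda>\<tau>. \<tau>) \<in> borel_measurable (time_law M)"
    and "AE \<tau> in time_law M. 0 < \<tau>"
proof -
  let ?R = "restrict_space lborel {0..} :: real measure"
  have Mm: "M \<in> borel_measurable ?R" and Mpos: "\<And>\<tau>. 0 \<le> \<tau> \<Longrightarrow> 0 \<le> M \<tau>"
    and lap: "has_bochner_integral ?R (\<lambda>\<tau>. exp (- 0 * \<tau>) * M \<tau>) (mittag_leffler \<beta> (- 0))"
    using M unfolding time_density_def by auto
  have Mm': "(\<lambda>\<tau>. ennreal (M \<tau>)) \<in> borel_measurable ?R" using Mm by simp
  show sp: "space (time_law M) = {0..}"
    unfolding time_law_def by (simp add: space_restrict_space)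
  have "mittag_leffler \<beta> 0 = (\<Sum>n\<in>{0}. 0 ^ n / Gamma (\<beta> * real n + 1))"
    unfolding mittag_leffler_def by (rule suminf_finite) auto
  then have "mittag_leffler \<beta> 0 = 1" by simp
  then have int: "has_bochner_integral ?R M 1" using lap by simp
  have "emeasure (time_law M) (space (time_law M)) = (\<integral>\<^sup>+ \<tau>. ennreal (M \<tau>) \<partial>?R)"
    unfolding time_law_def space_density
    by (subst emeasure_density[OF Mm' sets.top]) (auto intro!: nn_integral_cong)
  also have "\<dots> = ennreal (LINT \<tau>|?R. M \<tau>)"
  proof (rule nn_integral_eq_integral)
    show "integrable ?R M" using int by (rule integrable.intros)
    show "AE \<tau> in ?R. 0 \<le> M \<tau>" by (rule AE_I2) (simp add: space_restrict_space Mpos)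
  qed
  also have "\<dots> = ennreal 1" unfolding has_bochner_integral_integral_eq[OF int] ..
  finally show "prob_space (time_law M)" by (intro prob_spaceI) (simp only: ennreal_1)
  show "(\<lambda>\<tau>. \<tau>) \<in> borel_measurable (time_law M)"
    unfolding time_law_def by (simp add: measurable_restrict_space1)
  have "AE \<tau> in lborel. \<tau> \<in> {0..} \<longrightarrow> (0::real) < \<tau>"
    using AE_lborel_singleton[of "0::real"] by eventually_elim auto
  then have "AE \<tau> in ?R. 0 < \<tau>" by (subst AE_restrict_space_iff) auto
  then show "AE \<tau> in time_law M. 0 < \<tau>"
    unfolding time_law_def AE_density[OF Mm'] by eventually_elim simp
qed

section \<open>Equivalence of the laws\<close>

text \<open>
  If the shifted image is the image of \<open>D\<close> times the original measure, its density composed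
  with \<open>X\<close> is the conditional expectation of \<open>D\<close> given \<open>X\<close>. When \<open>D\<close> is itself a function of
  \<open>X\<close>, this is \<open>D\<close>, and positivity of \<open>D\<close> gives equivalence.
\<close>

lemma RN_deriv_of_image:
  fixes D :: "'a \<Rightarrow> real" and G :: "'b \<Rightarrow> real"
  assumes Q: "prob_space Q"
    and X[measurable]: "X \<in> measurable Q N" and Y[measurable]: "Y \<in> measurable Q N"
    and D[measurable]: "D \<in> borel_measurable Q" and G[measurable]: "G \<in> borel_measurable N"
    and Gpos: "\<And>v. 0 < G v"
    and GX: "AE x in Q. G (X x) = D x"
    and image: "distr Q N Y = distr (density Q (\<lambda>x. ennreal (D x))) N X"
  shows "equivalent_measures (distr Q N Y) (distr Q N X)"
    and "AE x in Q. RN_deriv (distr Q N X) (distr Q N Y) (X x) = ennreal (D x)"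
proof -
  interpret Q: prob_space Q by (rule Q)
  interpret X: prob_space "distr Q N X" by (rule Q.prob_space_distr) simp
  have eq: "density (distr Q N X) (\<lambda>v. ennreal (G v)) = distr Q N Y"
  proof (rule measure_eqI)
    fix A assume "A \<in> sets (density (distr Q N X) (\<lambda>v. ennreal (G v)))"
    then have A[measurable]: "A \<in> sets N" by simp
    have "emeasure (density (distr Q N X) (\<lambda>v. ennreal (G v))) A = (\<integral>\<^sup>+ x. ennreal (G (X x)) * indicator A (X x) \<partial>Q)"
      by (simp add: emeasure_density nn_integral_distr)
    also have "\<dots> = (\<integral>\<^sup>+ x. ennreal (D x) * indicator (X -` A \<inter> space Q) x \<partial>Q)"
    proof (rule nn_integral_cong_AE)
      show "AE x in Q. ennreal (G (X x)) * indicator A (X x) = ennreal (D x) * indicator (X -` A \<inter> space Q) x"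
        using GX AE_space by eventually_elim (auto simp: indicator_def)
    qed
    also have "\<dots> = emeasure (distr (density Q (\<lambda>x. ennreal (D x))) N X) A"
      by (simp add: emeasure_distr emeasure_density)
    finally show "emeasure (density (distr Q N X) (\<lambda>v. ennreal (G v))) A = emeasure (distr Q N Y) A"
      by (simp add: image)
  qed simp
  have "AE v in distr Q N X. ennreal (G v) = RN_deriv (distr Q N X) (distr Q N Y) v"
    by (rule X.RN_deriv_unique) (auto simp: eq)
  then have "AE x in Q. ennreal (G (X x)) = RN_deriv (distr Q N X) (distr Q N Y) (X x)"
    by (rule AE_distrD[OF X])
  with GX show "AE x in Q. RN_deriv (distr Q N X) (distr Q N Y) (X x) = ennreal (D x)"
    by eventually_elim simp
  have "null_sets (density (distr Q N X) (\<lambda>v. ennreal (G v))) = null_sets (distr Q N X)"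
  proof (rule set_eqI)
    fix A
    have nz: "ennreal (G v) \<noteq> 0" for v using Gpos[of v] by simp
    have "A \<in> null_sets (density (distr Q N X) (\<lambda>v. ennreal (G v))) \<longleftrightarrow>
        A \<in> sets (distr Q N X) \<and> (AE v in distr Q N X. v \<notin> A)"
      by (subst null_sets_density_iff) (simp_all add: nz)
    also have "\<dots> \<longleftrightarrow> A \<in> null_sets (distr Q N X)"
      using AE_iff_null_sets[of A "distr Q N X"] by (meson null_setsD2)
    finally show "A \<in> null_sets (density (distr Q N X) (\<lambda>v. ennreal (G v))) \<longleftrightarrow> A \<in> null_sets (distr Q N X)" .
  qed
  then show "equivalent_measures (distr Q N Y) (distr Q N X)"
    unfolding equivalent_measures_def absolutely_continuous_def eq by simp
qed

locale grey_setting =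
  fixes \<beta> :: real and P :: "(real \<Rightarrow> real) measure" and M h h' :: "real \<Rightarrow> real"
    and J :: "ennreal \<Rightarrow> (real \<Rightarrow> real) \<Rightarrow> real"
  assumes P: "wiener_measure P" and M: "time_density \<beta> M" and h: "cameron_martin h h'"
    and J: "continuous_wiener_integral P (\<lambda>t w. w t) h' J"

sublocale grey_setting \<subseteq> W: brownian_motion P "\<lambda>t w. w t"
  using P unfolding wiener_measure_def by unfold_locales auto

sublocale grey_setting \<subseteq> L: prob_space "time_law M"
  by (rule time_law_properties(1)[OF M])

sublocale grey_setting \<subseteq> PL: pair_prob_space P "time_law M" ..

context grey_setting
begin

abbreviation "Q \<equiv> P \<Otimes>\<^sub>M time_law M"

lemma space_P: "space P = paths"
  using P sets_eq_imp_space_eq[of P path_borel] unfolding wiener_measure_def path_borel_def by simp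

lemma space_L: "space (time_law M) = {0..}"
  by (rule time_law_properties(2)[OF M])

lemma snd_measurable [measurable]: "snd \<in> borel_measurable Q"
  by (rule measurable_compose[OF measurable_snd time_law_properties(3)[OF M]])

lemma AE_Q_pos: "AE x in Q. 0 < snd x"
proof (rule PL.AE_pair_measure)
  show "{x \<in> space Q. 0 < snd x} \<in> sets Q" by measurable
  show "AE w in P. AE \<tau> in time_law M. 0 < snd (w, \<tau>)"
    using time_law_properties(4)[OF M] by simp
qed

lemma wiener_integral_J: "wiener_integral P (\<lambda>t w. w t) (\<lambda>s. h' s * indicator (time_interval t) s) (J t)"
  using J unfolding continuous_wiener_integral_def by blast

lemma h'_L2: "h' \<in> L2_halfline" using h unfolding cameron_martin_def by blast

lemma grey_path_measurable:
  assumes g: "continuous_on {0..} g" "g 0 = 0"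
  shows "grey_path t g \<in> measurable Q (path_space t)"
proof (rule measurable_into_path_space)
  show "grey_path t g \<in> space Q \<rightarrow> paths_until t"
    using grey_path_in_paths[OF _ g] by (auto simp: space_pair_measure space_P space_L)
  fix s assume s: "s \<in> time_interval t"
  have s0: "0 \<le> s" using s time_interval_subset by auto
  have "(\<lambda>x. fst x (s * snd x)) \<in> borel_measurable Q"
  proof (rule measurable_eval_random_time[where S = "{0..}" and X = "\<lambda>u x. fst x u" and \<rho> = "\<lambda>x. s * snd x"])
    show "(\<lambda>x. fst x u) \<in> borel_measurable Q" if "u \<in> {0..}" for u
      using measurable_compose[OF measurable_fst W.B_measurable] that by simp
  qed (use s0 in \<open>auto simp: space_pair_measure space_P space_L paths_def\<close>)
  moreover have "(\<lambda>x. g (s * snd x)) \<in> borel_measurable Q"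
    by (rule measurable_eval_random_time[where S = "{0..}" and X = "\<lambda>u x. g u" and \<rho> = "\<lambda>x. s * snd x"])
       (use s0 g in \<open>auto simp: space_pair_measure space_L\<close>)
  ultimately have "(\<lambda>x. fst x (s * snd x) + g (s * snd x)) \<in> borel_measurable Q" by simp
  then show "(\<lambda>x. grey_path t g x s) \<in> borel_measurable Q"
    using s by (simp add: grey_path_def case_prod_beta)
qed

lemma grey_path_section_measurable:
  assumes g: "continuous_on {0..} g" "g 0 = 0" and \<tau>: "0 \<le> \<tau>"
  shows "(\<lambda>w. grey_path t g (w, \<tau>)) \<in> measurable P (path_space t)"
  by (rule measurable_compose[OF measurable_Pair2' grey_path_measurable[OF g]]) (simp add: space_L \<tau>)

definition energy :: "ennreal \<Rightarrow> real" where
  "energy t = (LINT s|lebesgue_on (time_interval t). (h' s)\<^sup>2)"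

lemma energy_eq: "energy t = (LINT s|lebesgue_halfline. (h' s * indicator (time_interval t) s)\<^sup>2)"
proof -
  have eq: "indicator {0..} s *\<^sub>R (h' s * indicator (time_interval t) s)\<^sup>2 = indicator (time_interval t) s *\<^sub>R (h' s)\<^sup>2" for s
    using time_interval_subset[of t] by (auto split: split_indicator)
  show ?thesis
    unfolding energy_def by (subst (1 2) integral_restrict_space) (simp_all only: eq, auto)
qed

lemma energy_mono:
  assumes "s \<le> t"
  shows "energy s \<le> energy t"
proof -
  have hm[measurable]: "h' \<in> borel_measurable lebesgue_halfline"
    and hi: "integrable lebesgue_halfline (\<lambda>s. (h' s)\<^sup>2)"
    using h'_L2 unfolding L2_halfline_def by auto
  have tm[measurable]: "(indicator (time_interval t) :: real \<Rightarrow> real) \<in> borel_measurable lebesgue_halfline" for t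
    by (intro measurable_restrict_space1 borel_measurable_indicator time_interval_lebesgue)
  have "integrable lebesgue_halfline (\<lambda>s. (h' s * indicator (time_interval t) s)\<^sup>2)" for t
    by (rule Bochner_Integration.integrable_bound[OF hi]) (auto split: split_indicator)
  moreover have "(h' x * indicator (time_interval s) x)\<^sup>2 \<le> (h' x * indicator (time_interval t) x)\<^sup>2" for x
    using time_interval_mono[OF assms] by (auto split: split_indicator)
  ultimately show ?thesis unfolding energy_eq by (intro integral_mono)
qed

lemma energy_measurable: "(\<lambda>\<tau>. energy (t * ennreal \<tau>)) \<in> borel_measurable borel"
  by (intro borel_measurable_mono monoI energy_mono mult_left_mono ennreal_leI) auto

lemma exp_martingale_eq: "exp_martingale h' J t w = exp (J t w - energy t / 2)"
  unfolding exp_martingale_def energy_def ..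

text \<open>
  For a fixed value of the random time, the grey path is a rescaled Brownian path, and the
  Cameron--Martin formula applies with the integrand cut at the time that the path reaches.
\<close>

lemma fixed_time_shift:
  assumes \<tau>: "0 < \<tau>"
  shows "distr P (path_space t) (\<lambda>w. grey_path t h (w, \<tau>)) =
    distr (density P (\<lambda>w. ennreal (exp_martingale h' J (t * ennreal \<tau>) w))) (path_space t)
      (\<lambda>w. grey_path t (\<lambda>_. 0) (w, \<tau>))" (is "?N1 = ?N2")
proof (rule path_space_measure_eqI)
  let ?u = "t * ennreal \<tau>"
  have hm[measurable]: "(\<lambda>w. grey_path t h (w, \<tau>)) \<in> measurable P (path_space t)"
    using cameron_martin_continuous[OF h] cameron_martin_0[OF h] \<tau> by (intro grey_path_section_measurable) auto
  have zm[measurable]: "(\<lambda>w. grey_path t (\<lambda>_. 0) (w, \<tau>)) \<in> measurable P (path_space t)"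
    using \<tau> by (intro grey_path_section_measurable) auto
  have Jm[measurable]: "J ?u \<in> borel_measurable P"
    using wiener_integral_J[of ?u] unfolding wiener_integral_def by auto
  interpret N1: prob_space ?N1 by (rule W.prob_space_distr) simp
  show "emeasure ?N1 (paths_until t) \<noteq> \<infinity>" by simp
  fix F c assume F: "finite F" "F \<subseteq> time_interval t"
  have s0: "0 \<le> s * \<tau>" if "s \<in> F" for s using that F(2) time_interval_subset[of t] \<tau> by force
  define A where "A = {v \<in> paths_until t. \<forall>s\<in>F. v s \<le> c s}"
  have A[measurable]: "A \<in> sets (path_space t)"
  proof -
    have "{v \<in> space (path_space t). \<forall>s\<in>F. v s \<le> c s} \<in> sets (path_space t)"
      using F by (intro sets.sets_Collect_finite_All borel_measurable_le path_space_coordinate) auto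
    then show ?thesis by (simp add: A_def)
  qed
  have drift: "(LINT x|lebesgue_on {0..s * \<tau>}. h' x * indicator (time_interval ?u) x) = h (s * \<tau>)" if "s \<in> F" for s
  proof -
    have "s * \<tau> \<in> time_interval ?u" using that F(2) \<tau> by (intro time_interval_scale) auto
    then have "x \<in> time_interval ?u" if "x \<in> {0..s * \<tau>}" for x
      using that by (auto intro: time_interval_down)
    then have "(LINT x|lebesgue_on {0..s * \<tau>}. h' x * indicator (time_interval ?u) x) = (LINT x|lebesgue_on {0..s * \<tau>}. h' x)"
      by (intro Bochner_Integration.integral_cong) (auto simp: space_restrict_space)
    then show ?thesis using h s0[OF that] unfolding cameron_martin_def by simp
  qed
  have mem: "grey_path t g (w, \<tau>) \<in> A \<longleftrightarrow> (\<forall>s\<in>F. w (s * \<tau>) + g (s * \<tau>) \<le> c s)"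
    if "w \<in> space P" "continuous_on {0..} g" "g 0 = 0" for w g
    using that \<tau> grey_path_in_paths[of w g \<tau> t] F(2) by (auto simp: A_def space_P grey_path_apply subset_iff)
  have "emeasure ?N1 A = emeasure P {w \<in> space P. \<forall>s\<in>F. w (s * \<tau>) + h (s * \<tau>) \<le> c s}"
    by (subst emeasure_distr)
       (auto simp: mem cameron_martin_continuous[OF h] cameron_martin_0[OF h] intro!: arg_cong[where f = "emeasure P"])
  also have "\<dots> = emeasure P {w \<in> space P. \<forall>s\<in>F. w (s * \<tau>)
      + (LINT x|lebesgue_on {0..s * \<tau>}. h' x * indicator (time_interval ?u) x) \<le> c s}"
    using drift by (intro arg_cong[where f = "emeasure P"]) auto
  also have "\<dots> = (\<integral>\<^sup>+ w. ennreal (exp (J ?u w - energy ?u / 2)) * indicator {w. \<forall>s\<in>F. w (s * \<tau>) \<le> c s} w \<partial>P)"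
    unfolding energy_eq
    by (rule W.cameron_martin_cylinders[OF wiener_integral_J F(1) s0, symmetric])
  also have "\<dots> = (\<integral>\<^sup>+ w. ennreal (exp_martingale h' J ?u w)
      * indicator ((\<lambda>w. grey_path t (\<lambda>_. 0) (w, \<tau>)) -` A \<inter> space P) w \<partial>P)"
    unfolding exp_martingale_eq
    by (intro nn_integral_cong) (auto simp: mem indicator_def)
  also have "\<dots> = emeasure ?N2 A"
    by (subst emeasure_distr) (auto simp: exp_martingale_eq emeasure_density)
  finally show "emeasure ?N1 {w \<in> paths_until t. \<forall>s\<in>F. w s \<le> c s} = emeasure ?N2 {w \<in> paths_until t. \<forall>s\<in>F. w s \<le> c s}"
    unfolding A_def .
qed auto

text \<open>
  For a finite horizon, continuity in time makes the stochastic integral at the random time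
  jointly measurable, off a null set of paths. For an infinite horizon and \<open>\<tau> > 0\<close> it does not
  depend on \<open>\<tau>\<close> at all.
\<close>

lemma jointly_measurable_version:
  "\<exists>J'\<in>borel_measurable Q. (\<forall>\<tau>>0. AE w in P. J' (w, \<tau>) = J (t * ennreal \<tau>) w) \<and>
     (AE x in Q. J' x = J (t * ennreal (snd x)) (fst x))"
proof (cases t rule: time_interval_cases)
  case 1
  have Jm: "J \<infinity> \<in> borel_measurable P"
    using wiener_integral_J[of \<infinity>] unfolding wiener_integral_def by auto
  show ?thesis
  proof (intro bexI[of _ "\<lambda>x. J \<infinity> (fst x)"] conjI allI impI)
    show "(\<lambda>x. J \<infinity> (fst x)) \<in> borel_measurable Q"
      by (rule measurable_compose[OF measurable_fst Jm])
    show "AE w in P. J \<infinity> (fst (w, \<tau>)) = J (t * ennreal \<tau>) w" if "0 < \<tau>" for \<tau>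
      using that 1 by (simp add: ennreal_top_mult)
    show "AE x in Q. J \<infinity> (fst x) = J (t * ennreal (snd x)) (fst x)"
      using AE_Q_pos by eventually_elim (use 1 in \<open>simp add: ennreal_top_mult\<close>)
  qed
next
  case (2 T)
  have "AE w in P. continuous_on {0..} (\<lambda>u. J (ennreal u) w)"
    using J unfolding continuous_wiener_integral_def by blast
  then obtain N where N: "{w \<in> space P. \<not> continuous_on {0..} (\<lambda>u. J (ennreal u) w)} \<subseteq> N"
      "emeasure P N = 0" "N \<in> sets P"
    by (rule AE_E)
  define X where "X u x = (if fst x \<in> N then 0 else J (ennreal u) (fst x))" for u and x :: "(real \<Rightarrow> real) \<times> real"
  have tT: "t * ennreal \<tau> = ennreal (T * \<tau>)" for \<tau> using 2 by (simp add: ennreal_mult')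
  have notN: "AE w in P. w \<notin> N" using N by (intro AE_not_in null_setsI) auto
  show ?thesis
  proof (intro bexI[of _ "\<lambda>x. X (T * snd x) x"] conjI allI impI)
    show "(\<lambda>x. X (T * snd x) x) \<in> borel_measurable Q"
    proof (rule measurable_eval_random_time[where S = "{0..}" and X = X])
      fix u :: real
      have [measurable]: "J (ennreal u) \<in> borel_measurable P"
        using wiener_integral_J[of "ennreal u"] unfolding wiener_integral_def by auto
      have [measurable]: "N \<in> sets P" by fact
      show "X u \<in> borel_measurable Q" unfolding X_def by measurable
    next
      fix x assume "x \<in> space Q"
      then have "fst x \<in> space P" by (auto simp: space_pair_measure)
      then show "continuous_on {0..} (\<lambda>u. X u x)"
        using N(1) unfolding X_def by (cases "fst x \<in> N") auto
    qed (use 2 in \<open>auto simp: space_pair_measure space_L\<close>)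
    show "AE w in P. X (T * snd (w, \<tau>)) (w, \<tau>) = J (t * ennreal \<tau>) w" for \<tau>
      using notN by eventually_elim (simp add: X_def tT)
    have "AE x in Q. fst x \<notin> N"
    proof (rule PL.AE_pair_measure)
      have [measurable]: "N \<in> sets P" by fact
      show "{x \<in> space Q. fst x \<notin> N} \<in> sets Q" by measurable
      show "AE w in P. AE \<tau> in time_law M. fst (w, \<tau>) \<notin> N" using notN by simp
    qed
    then show "AE x in Q. X (T * snd x) x = J (t * ennreal (snd x)) (fst x)"
      by eventually_elim (simp add: X_def tT)
  qed
qed

text \<open>
  The quadratic variation of a grey path reveals the random time. Given the time, the step
  integrals that approximate the stochastic integral only use the path at rescaled times
  before the horizon. So the exponential is a function of the grey path.
\<close>

lemma exp_martingale_function_of_path: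
  assumes t: "0 < t"
  shows "\<exists>G\<in>borel_measurable (path_space t). (\<forall>v. 0 < G v) \<and>
    (\<forall>\<tau>>0. AE w in P. G (grey_path t (\<lambda>_. 0) (w, \<tau>)) = exp_martingale h' J (t * ennreal \<tau>) w)"
proof -
  obtain \<phi> where \<phi>: "\<And>n. nonneg_steps (\<phi> n)"
    "\<And>n. (\<integral>\<^sup>+ s. ennreal ((h' s * indicator (time_interval \<infinity>) s - step_fun (\<phi> n) s)\<^sup>2) \<partial>lebesgue_halfline)
      \<le> ennreal ((1 / 2) ^ n)"
    using wiener_integral_fast_steps[OF wiener_integral_J[of \<infinity>]] by blast
  \<comment> \<open>The variation is observed up to a positive finite time within the horizon.\<close>
  define R where "R = cut_time t 1"
  have R: "0 < R" "R \<in> time_interval t" unfolding R_def using t by (auto intro: cut_time_pos cut_time_in)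
  define q where "q v = lim (dyadic_variation v R) / R" for v
  \<comment> \<open>The Brownian path at time \<open>u\<close>, or at its last visible time, read off from \<open>v\<close>. Since
    \<open>cut_time\<close> always returns a time within the horizon, \<open>E\<close> makes sense also where the limit
    in \<open>q\<close> fails to exist.\<close>
  define E where "E u v = v (cut_time t (u / q v))" for u :: real and v :: "real \<Rightarrow> real"
  define G where "G v = exp (lim (\<lambda>n. step_integral E (\<phi> n) v) - energy (t * ennreal (q v)) / 2)" for v
  have grid: "R * real i / 2 ^ n \<in> time_interval t" if "i \<le> 2 ^ n" for i n
  proof (rule time_interval_down[OF R(2)])
    have "real i / 2 ^ n \<le> 1" using that by (simp add: divide_le_eq_1)
    then show "R * real i / 2 ^ n \<le> R" using mult_left_mono[of "real i / 2 ^ n" 1 R] R(1) by simp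
  qed (use R in simp)
  have "(\<lambda>v. dyadic_variation v R n) \<in> borel_measurable (path_space t)" for n
    unfolding dyadic_variation_def
    by (intro borel_measurable_sum borel_measurable_power borel_measurable_diff path_space_coordinate grid) auto
  then have q[measurable]: "q \<in> borel_measurable (path_space t)" unfolding q_def by measurable
  have "E u \<in> borel_measurable (path_space t)" for u
    unfolding E_def
  proof (rule measurable_eval_random_time[where S = "time_interval t" and X = "\<lambda>s v. v s"])
    show "(\<lambda>v. cut_time t (u / q v)) \<in> borel_measurable (path_space t)" by measurable
  qed (auto intro: path_space_coordinate time_interval_down cut_time_in paths_until_continuous
        simp: time_interval_subset)
  then have "step_integral E (\<phi> n) \<in> borel_measurable (path_space t)" for n
    by (intro borel_measurable_step_integral \<phi>)
  then have [measurable]: "(\<lambda>v. step_integral E (\<phi> n) v) \<in> borel_measurable (path_space t)" for n by simp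
  note [measurable] = measurable_compose[OF q energy_measurable]
  have "G \<in> borel_measurable (path_space t)" unfolding G_def by measurable
  moreover have "AE w in P. G (grey_path t (\<lambda>_. 0) (w, \<tau>)) = exp_martingale h' J (t * ennreal \<tau>) w"
    if \<tau>: "0 < \<tau>" for \<tau>
  proof -
    let ?u = "t * ennreal \<tau>"
    have "AE w in P. dyadic_variation w (R * \<tau>) \<longlonglongrightarrow> R * \<tau>"
      using W.dyadic_variation_AE_tendsto[of "R * \<tau>"] R(1) \<tau> by simp
    moreover have "AE w in P. (\<lambda>n. step_integral (\<lambda>t w. w t) (cut_steps ?u (\<phi> n)) w) \<longlonglongrightarrow> J ?u w"
      by (intro W.wiener_integral_AE_limit[OF wiener_integral_J] nonneg_steps_cut cut_steps_approx \<phi>)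
    ultimately show ?thesis
    proof eventually_elim
      case (elim w)
      let ?x = "grey_path t (\<lambda>_. 0) (w, \<tau>)"
      have "dyadic_variation ?x R = dyadic_variation w (R * \<tau>)"
      proof
        fix n
        have pt: "?x (R * real i / 2 ^ n) = w (R * \<tau> * real i / 2 ^ n)" if "i \<le> 2 ^ n" for i
          using grey_path_apply[OF grid[OF that]] by (simp add: mult_ac)
        show "dyadic_variation ?x R n = dyadic_variation w (R * \<tau>) n"
          unfolding dyadic_variation_def
        proof (intro sum.cong refl)
          fix i :: nat assume "i \<in> {..<2 ^ n}"
          then show "(?x (R * real (Suc i) / 2 ^ n) - ?x (R * real i / 2 ^ n))\<^sup>2
              = (w (R * \<tau> * real (Suc i) / 2 ^ n) - w (R * \<tau> * real i / 2 ^ n))\<^sup>2"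
            using pt[of i] pt[of "Suc i"] by (simp del: of_nat_Suc)
        qed
      qed
      then have q\<tau>: "q ?x = \<tau>" unfolding q_def using limI[OF elim(1)] R(1) by simp
      have "E r ?x = w (cut_time ?u r)" if "0 \<le> r" for r
        unfolding E_def q\<tau> grey_path_apply[OF cut_time_in] cut_time_scale[OF \<tau> that] by simp
      then have "step_integral E (\<phi> n) ?x = step_integral (\<lambda>t w. w t) (cut_steps ?u (\<phi> n)) w" for n
        unfolding step_integral_cut unfolding step_integral_def
        using \<phi>(1)[of n] by (intro arg_cong[where f = sum_list] map_cong refl) (auto simp: nonneg_steps_def)
      then have "lim (\<lambda>n. step_integral E (\<phi> n) ?x) = J ?u w" using limI[OF elim(2)] by simp
      then show ?case unfolding G_def q\<tau> exp_martingale_eq by simp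
    qed
  qed
  ultimately show ?thesis by (intro bexI[of _ G]) (auto simp: G_def)
qed

lemma AE_Q_of_sections:
  assumes [measurable]: "f \<in> borel_measurable Q" "g \<in> borel_measurable Q"
    and "\<And>\<tau>. 0 < \<tau> \<Longrightarrow> AE w in P. f (w, \<tau>) = (g (w, \<tau>) :: real)"
  shows "AE x in Q. f x = g x"
proof (rule PL.AE_pair_measure)
  show "{x \<in> space Q. f x = g x} \<in> sets Q" by measurable
  have "AE \<tau> in time_law M. AE w in P. f (w, \<tau>) = g (w, \<tau>)"
    using time_law_properties(4)[OF M] by eventually_elim (rule assms(3))
  then show "AE w in P. AE \<tau> in time_law M. f (w, \<tau>) = g (w, \<tau>)"
    by (subst PL.AE_commute) simp_all
qed

text \<open>
  By Fubini's theorem the formula for fixed \<open>\<tau>\<close> becomes one for the product measure. The weight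
  is replaced by a jointly measurable version \<open>D\<close> for this purpose.
\<close>

theorem grey_laws_equivalent:
  assumes t: "0 < t"
  defines "N \<equiv> path_space t" and "X \<equiv> grey_path t (\<lambda>_. 0)" and "Y \<equiv> grey_path t h"
  shows "equivalent_measures (distr Q N Y) (distr Q N X)"
    and "AE x in Q. RN_deriv (distr Q N X) (distr Q N Y) (X x)
      = ennreal (exp_martingale h' J (t * ennreal (snd x)) (fst x))"
proof -
  have X[measurable]: "X \<in> measurable Q N" unfolding X_def N_def by (intro grey_path_measurable) auto
  have Y[measurable]: "Y \<in> measurable Q N"
    unfolding Y_def N_def
    using cameron_martin_continuous[OF h] cameron_martin_0[OF h] by (rule grey_path_measurable)
  obtain J' where J'[measurable]: "J' \<in> borel_measurable Q"
    and J'1: "\<And>\<tau>. 0 < \<tau> \<Longrightarrow> AE w in P. J' (w, \<tau>) = J (t * ennreal \<tau>) w"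
    and J'2: "AE x in Q. J' x = J (t * ennreal (snd x)) (fst x)"
    using jointly_measurable_version[of t] by blast
  define D where "D x = exp (J' x - energy (t * ennreal (snd x)) / 2)" for x
  note [measurable] = measurable_compose[OF snd_measurable energy_measurable]
  have D[measurable]: "D \<in> borel_measurable Q" unfolding D_def by measurable
  have D1: "AE w in P. D (w, \<tau>) = exp_martingale h' J (t * ennreal \<tau>) w" if "0 < \<tau>" for \<tau>
    using J'1[OF that] by eventually_elim (simp add: D_def exp_martingale_eq)
  have D2: "AE x in Q. D x = exp_martingale h' J (t * ennreal (snd x)) (fst x)"
    using J'2 by eventually_elim (simp add: D_def exp_martingale_eq)
  obtain G where G[measurable]: "G \<in> borel_measurable N" and Gpos: "\<And>v. 0 < G v"
    and G1: "\<And>\<tau>. 0 < \<tau> \<Longrightarrow> AE w in P. G (X (w, \<tau>)) = exp_martingale h' J (t * ennreal \<tau>) w"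
    using exp_martingale_function_of_path[OF t] unfolding N_def X_def by blast
  have GX: "AE x in Q. G (X x) = D x"
  proof (rule AE_Q_of_sections)
    fix \<tau> :: real assume "0 < \<tau>"
    from G1[OF this] D1[OF this] show "AE w in P. G (X (w, \<tau>)) = D (w, \<tau>)" by eventually_elim simp
  qed simp_all
  have image: "distr Q N Y = distr (density Q (\<lambda>x. ennreal (D x))) N X"
  proof (rule measure_eqI)
    fix A assume "A \<in> sets (distr Q N Y)"
    then have A[measurable]: "A \<in> sets N" by simp
    have inner: "(\<integral>\<^sup>+ w. indicator A (Y (w, \<tau>)) \<partial>P) = (\<integral>\<^sup>+ w. ennreal (D (w, \<tau>)) * indicator A (X (w, \<tau>)) \<partial>P)"
      if \<tau>: "0 < \<tau>" for \<tau>
    proof -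
      let ?D = "\<lambda>w. ennreal (exp_martingale h' J (t * ennreal \<tau>) w)"
      have s: "\<tau> \<in> space (time_law M)" using \<tau> by (simp add: space_L)
      have [measurable]: "(\<lambda>w. Y (w, \<tau>)) \<in> measurable P N" "(\<lambda>w. X (w, \<tau>)) \<in> measurable P N"
        by (rule measurable_compose[OF measurable_Pair2'[OF s]], rule Y,
            rule measurable_compose[OF measurable_Pair2'[OF s]], rule X)
      have [measurable]: "J (t * ennreal \<tau>) \<in> borel_measurable P"
        using wiener_integral_J[of "t * ennreal \<tau>"] unfolding wiener_integral_def by auto
      have [measurable]: "?D \<in> borel_measurable P" unfolding exp_martingale_eq by measurable
      have "(\<integral>\<^sup>+ w. indicator A (Y (w, \<tau>)) \<partial>P) = (\<integral>\<^sup>+ v. indicator A v \<partial>distr P N (\<lambda>w. Y (w, \<tau>)))"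
        by (rule nn_integral_distr[symmetric]) simp_all
      also have "\<dots> = (\<integral>\<^sup>+ v. indicator A v \<partial>distr (density P ?D) N (\<lambda>w. X (w, \<tau>)))"
        unfolding N_def X_def Y_def fixed_time_shift[OF \<tau>] ..
      also have "\<dots> = (\<integral>\<^sup>+ w. ?D w * indicator A (X (w, \<tau>)) \<partial>P)"
        by (subst nn_integral_distr, simp, simp, subst nn_integral_density) auto
      also have "\<dots> = (\<integral>\<^sup>+ w. ennreal (D (w, \<tau>)) * indicator A (X (w, \<tau>)) \<partial>P)"
        using D1[OF \<tau>] by (intro nn_integral_cong_AE) (auto elim!: eventually_mono)
      finally show ?thesis .
    qed
    have "emeasure (distr Q N Y) A = (\<integral>\<^sup>+ x. indicator A (Y x) \<partial>Q)"
      by (subst nn_integral_indicator[symmetric], simp, subst nn_integral_distr) auto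
    also have "\<dots> = (\<integral>\<^sup>+ \<tau>. \<integral>\<^sup>+ w. indicator A (Y (w, \<tau>)) \<partial>P \<partial>time_law M)"
      by (rule PL.nn_integral_snd[symmetric]) simp
    also have "\<dots> = (\<integral>\<^sup>+ \<tau>. \<integral>\<^sup>+ w. ennreal (D (w, \<tau>)) * indicator A (X (w, \<tau>)) \<partial>P \<partial>time_law M)"
      using time_law_properties(4)[OF M] by (intro nn_integral_cong_AE) (auto elim!: eventually_mono simp: inner)
    also have "\<dots> = (\<integral>\<^sup>+ x. ennreal (D x) * indicator A (X x) \<partial>Q)"
      by (rule PL.nn_integral_snd) simp
    also have "\<dots> = emeasure (distr (density Q (\<lambda>x. ennreal (D x))) N X) A"
      by (subst nn_integral_indicator[symmetric], simp, subst nn_integral_distr, simp, simp,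
          subst nn_integral_density) auto
    finally show "emeasure (distr Q N Y) A = emeasure (distr (density Q (\<lambda>x. ennreal (D x))) N X) A" .
  qed simp
  have Q: "prob_space Q" by (rule PL.prob_space_axioms)
  note RN = RN_deriv_of_image[OF Q X Y D G Gpos GX image]
  show "equivalent_measures (distr Q N Y) (distr Q N X)" by (rule RN(1))
  show "AE x in Q. RN_deriv (distr Q N X) (distr Q N Y) (X x)
      = ennreal (exp_martingale h' J (t * ennreal (snd x)) (fst x))"
    using RN(2) D2 by eventually_elim simp
qed

end

theorem theorem3p1:
  fixes \<beta> :: real
    and P :: "(real \<Rightarrow> real) measure"
    and M h h' :: "real \<Rightarrow> real"
    and J :: "ennreal \<Rightarrow> (real \<Rightarrow> real) \<Rightarrow> real"
  assumes "0 < \<beta>" and "\<beta> < 1"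
    and "wiener_measure P"
    and "time_density \<beta> M"
    and "cameron_martin h h'"
    and "continuous_wiener_integral P (\<lambda>t w. w t) h' J"
  shows "(\<forall>T>0.
            equivalent_measures (gbm_shifted_law_upto P M h T) (gbm_law_upto P M T) \<and>
            (AE (w, \<tau>) in gbm_space P M.
               RN_deriv (gbm_law_upto P M T) (gbm_shifted_law_upto P M h T) (gbm_upto T (w, \<tau>)) =
                 ennreal (exp_martingale h' J (ennreal (T * \<tau>)) w))) \<and>
         equivalent_measures (gbm_shifted_law P M h) (gbm_law P M) \<and>
         (AE (w, \<tau>) in gbm_space P M.
            RN_deriv (gbm_law P M) (gbm_shifted_law P M h) (gbm (w, \<tau>)) =
              ennreal (exp_martingale h' J \<infinity> w))"
proof -
  interpret grey_setting \<beta> P M h h' J using assms(3-6) by unfold_locales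
  show ?thesis
  proof (intro conjI allI impI)
    fix T :: real assume T: "0 < T"
    have eqs: "gbm_shifted_law_upto P M h T = distr Q (path_space (ennreal T)) (grey_path (ennreal T) h)"
      "gbm_law_upto P M T = distr Q (path_space (ennreal T)) (grey_path (ennreal T) (\<lambda>_. 0))"
      "gbm_upto T = grey_path (ennreal T) (\<lambda>_. 0)"
      using T by (simp_all add: gbm_shifted_law_upto_def gbm_law_upto_def gbm_space_def
          path_space_ennreal gbm_upto_eq gbm_shifted_upto_eq)
    have T': "0 < ennreal T" using T by simp
    show "equivalent_measures (gbm_shifted_law_upto P M h T) (gbm_law_upto P M T)"
      unfolding eqs by (rule grey_laws_equivalent(1)[OF T'])
    show "AE (w, \<tau>) in gbm_space P M.
         RN_deriv (gbm_law_upto P M T) (gbm_shifted_law_upto P M h T) (gbm_upto T (w, \<tau>)) =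
           ennreal (exp_martingale h' J (ennreal (T * \<tau>)) w)"
      unfolding eqs gbm_space_def using grey_laws_equivalent(2)[OF T']
      by eventually_elim (use T in \<open>simp add: case_prod_beta ennreal_mult'\<close>)
  next
    have eqs: "gbm_shifted_law P M h = distr Q (path_space \<infinity>) (grey_path \<infinity> h)"
      "gbm_law P M = distr Q (path_space \<infinity>) (grey_path \<infinity> (\<lambda>_. 0))"
      unfolding gbm_shifted_law_def gbm_law_def gbm_space_def path_space_infinity gbm_eq gbm_shifted_eq by rule+
    have inf: "(0::ennreal) < \<infinity>" by simp
    show "equivalent_measures (gbm_shifted_law P M h) (gbm_law P M)"
      unfolding eqs by (rule grey_laws_equivalent(1)[OF inf])
    show "AE (w, \<tau>) in gbm_space P M.
            RN_deriv (gbm_law P M) (gbm_shifted_law P M h) (gbm (w, \<tau>)) =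
              ennreal (exp_martingale h' J \<infinity> w)"
      unfolding eqs gbm_eq gbm_space_def using grey_laws_equivalent(2)[OF inf] AE_Q_pos
      by eventually_elim (simp add: case_prod_beta ennreal_top_mult)
  qed
qed

end
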